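(* Let $A:\Lambda\to\mathcal{M}^*$, $t\mapsto\underline A_t$, be a smooth family satisfying (A1)-(A2). Then for Lebesgue almost every $t\in\Lambda$ there exists $\sigma=\sigma(t)>0$ such that for $\eta_t$-a.e. $\hat v\in\mathbb{P}^1$ (with $v$ a unit representative), with respect to $\mu$, $$\frac{\log\|A_t^nv\|-n\,L_1(A_t)}{\sigma\sqrt n}\xrightarrow{d}\mathcal{N}(0,1),$$ and moreover $$\frac{\log\|A_t^n\|-n\,L_1(A_t)}{\sigma\sqrt n}\xrightarrow{d}\mathcal{N}(0,1).$$
   Context: Bernoulli setting: $\mathscr{A}=\{1,\dots,k\}=\mathscr{A}_{\mathrm{sing}}\sqcup\mathscr{A}_{\mathrm{inv}}$ both nonempty, $p_i>0$, $X=\mathscr{A}^{\mathbb{Z}}$, $\mu=p^{\mathbb{Z}}$. $\mathcal{M}^*$: tuples with $\mathrm{rank}A_i=1$ ($i\in\mathscr{A}_{\mathrm{sing}}$), $\det A_j>0$ ($j\in\mathscr{A}_{\mathrm{inv}}$), $\hat r_i\ne\hat k_j$ for $i,j\in\mathscr{A}_{\mathrm{sing}}$ ($r_i,k_i$ range and kernel of $A_i$). $\Lambda\subset\mathbb{R}$ compact interval of length 1; (A1) $A_t(i)\equiv A_i$ for $i\in\mathscr{A}_{\mathrm{sing}}$; (A2) there is $c_0>0$ with $\frac{A_t(j)v\wedge\frac{d}{dt}A_t(j)v}{\|A_t(j)v\|^2}\ge c_0$ for all $t\in\Lambda$, $j\in\mathscr{A}_{\mathrm{inv}}$, $\hat v$.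 $A_t^n=A_t^n(\omega)=A_t(\omega_n)\cdots A_t(\omega_1)$ as a random matrix on $(X,\mu)$; $L_1(A_t)=\lim_n\frac1n\log\|A_t^n(\omega)\|$ $\mu$-a.e. Projective action of rank one matrices: constant map to range. $\eta_t$ is the unique stationary probability of $\mathcal{Q}_t\psi(\hat v)=\sum_ip_i\psi(\hat A_t(i)\hat v)$, i.e. $\eta_t=\sum_{s\in\mathscr{A}_{\mathrm{sing}}}p_s\sum_{n\ge0}\sum_{\underline\omega\in\mathscr{A}_{\mathrm{inv}}^n}p(\underline\omega)\delta_{\hat A_t^n(\underline\omega)\hat r_s}$. *)

theory Defs
  imports "HOL-Analysis.Analysis" "HOL-Probability.Probability"
begin

definition smooth_on :: "real set \<Rightarrow> (real \<Rightarrow> 'b::real_normed_vector) \<Rightarrow> bool" where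
  "smooth_on S f \<longleftrightarrow> (\<exists>D::nat \<Rightarrow> real \<Rightarrow> 'b. D 0 = f \<and>
      (\<forall>n. \<forall>t\<in>S. (D n has_vector_derivative D (Suc n) t) (at t within S)))"

definition wedge2 :: "real^2 \<Rightarrow> real^2 \<Rightarrow> real" where
  "wedge2 x y = x$1 * y$2 - x$2 * y$1"

(* points of P^1 are represented as lines (1-dim subspaces) of R^2 *)
definition line :: "real^2 \<Rightarrow> (real^2) set" where
  "line v = span {v}"

definition mrange :: "real^2^2 \<Rightarrow> (real^2) set" where
  "mrange M = range (\<lambda>x. M *v x)"

definition mkernel :: "real^2^2 \<Rightarrow> (real^2) set" where
  "mkernel M = {x. M *v x = 0}"

definition in_Mstar :: "'a set \<Rightarrow> ('a \<Rightarrow> real^2^2) \<Rightarrow> bool" where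
  "in_Mstar Sg B \<longleftrightarrow> (\<forall>i\<in>Sg. rank (B i) = 1) \<and> (\<forall>j\<in>-Sg. det (B j) > 0) \<and>
     (\<forall>i\<in>Sg. \<forall>j\<in>Sg. mrange (B i) \<noteq> mkernel (B j))"

fun prodA :: "('a \<Rightarrow> real^2^2) \<Rightarrow> (int \<Rightarrow> 'a) \<Rightarrow> nat \<Rightarrow> real^2^2" where
  "prodA B \<omega> 0 = mat 1"
| "prodA B \<omega> (Suc n) = B (\<omega> (int (Suc n))) ** prodA B \<omega> n"

definition opnorm :: "real^2^2 \<Rightarrow> real" where
  "opnorm M = onorm (\<lambda>x. M *v x)"

definition bernoulli :: "'a pmf \<Rightarrow> (int \<Rightarrow> 'a) measure" where
  "bernoulli P = PiM (UNIV :: int set) (\<lambda>_. measure_pmf P)"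

definition L1 :: "'a pmf \<Rightarrow> ('a \<Rightarrow> real^2^2) \<Rightarrow> real" where
  "L1 P B = (THE L. AE \<omega> in bernoulli P.
      (\<lambda>n. ln (opnorm (prodA B \<omega> n)) / real n) \<longlonglongrightarrow> L)"

fun wordmat :: "('a \<Rightarrow> real^2^2) \<Rightarrow> 'a list \<Rightarrow> real^2^2" where
  "wordmat B [] = mat 1"
| "wordmat B (a # w) = wordmat B w ** B a"

(* the stationary measure
   eta = sum_{s sing} p_s sum_n sum_{w in inv^n} p(w) delta_{A^n(w) r_s}
   as a measure on the set of lines of R^2 *)
definition eta :: "'a pmf \<Rightarrow> 'a set \<Rightarrow> ('a \<Rightarrow> real^2^2) \<Rightarrow> (real^2) set measure" where
  "eta P Sg B = density (count_space UNIV) (\<lambda>lin.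
     \<Sum>s\<in>Sg. ennreal (pmf P s) *
       (\<Sum>n. ennreal (\<Sum>w\<in>{w. length w = n \<and> set w \<subseteq> -Sg}.
             (\<Prod>a\<leftarrow>w. pmf P a) *
             (if (\<lambda>x. wordmat B w *v x) ` mrange (B s) = lin then 1 else 0))))"

end

theory Submission
  imports Defs "HOL-Real_Asymp.Real_Asymp"
begin

text \<open>
  Fix a singular letter \<open>s\<close>, so that \<open>A\<^sub>s x = (c \<bullet> x) r\<close> does not depend on \<open>t\<close>. Between two visits of \<open>s\<close> the
  matrix product restarts from \<open>r\<close>, hence \<open>H\<^sub>t w = ln \<bar>A\<^sub>t(w) r\<bar>\<close> is additive over the i.i.d. cycles cut out by \<open>s\<close>,
  and \<open>ln \<bar>A\<^sub>t\<^sup>n v\<bar>\<close> and \<open>ln \<bar>A\<^sub>t\<^sup>n\<bar>\<close> differ from \<open>H\<^sub>t\<close> by a quantity that is constant after the first visit.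
  The central limit theorem for sums of i.i.d. cycles carries over to \<open>H\<^sub>t\<close> by Wald's second identity, as soon as
  cycles have a finite second moment and \<open>H\<^sub>t - L n\<close> is not degenerate.

  The second moment may fail for exceptional \<open>t\<close>, namely when \<open>A\<^sub>t(w) r\<close> comes too close to a kernel.
  By (A2) the direction of \<open>A\<^sub>t(w) r\<close> turns with speed at least \<open>c0\<close>, so the set of \<open>t\<close> for which it is \<open>\<epsilon>\<close>-close
  to a given kernel has measure at most \<open>K\<^sup>n \<epsilon>\<close> for words of length \<open>n\<close>. The exponential constant costs only
  a factor \<open>n\<^sup>2\<close> in the integral of the squared logarithm over \<open>t\<close>, which the geometric tail of the cycle length absorbs.
  Degeneracy would force \<open>\<bar>c \<bullet> A\<^sub>t(j)\<^sup>n r\<bar> = q\<^sup>n\<^sup>+\<^sup>1\<close> for all \<open>n\<close>, which by rotation happens for almost no \<open>t\<close>.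
\<close>

section \<open>Perturbation of limits\<close>

text \<open>Only one singular letter \<open>s\<close> cuts the cycles; further singular letters may
  occur inside a cycle and nearly annihilate the vector there. Nonvanishing and logarithmic moments
  are therefore proved for words with any number of singular letters, by splitting at the first of
  them and so reducing to invertible words.

  The cycles live on an auxiliary space of i.i.d. words whose concatenation has i.i.d. letters, and
  only the laws of prefixes are transported to the Bernoulli measure. Accordingly the almost sure
  limit that identifies \<open>L1\<close> is derived from second moments of prefixes and of their
  one-letter increments, not from a strong law for cycles.

  Wald's identity needs coefficients that are known before the cycle which they multiply. This holds
  for "cycle j has started by time n", but not for "cycle j is complete by time n". Hence the
  started cycles are summed, and the cycle in progress is removed as a separate error, controlled by
  truncating its square.\<close>

lemma (in prob_space) weak_conv_perturb:
  fixes X Y :: "nat \<Rightarrow> 'a \<Rightarrow> real"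
  assumes [measurable]: "\<And>n. X n \<in> borel_measurable M" "\<And>n. Y n \<in> borel_measurable M"
    and \<mu>: "real_distribution \<mu>"
    and conv: "weak_conv_m (\<lambda>n. distr M borel (X n)) \<mu>"
    and diff: "\<And>t. (\<lambda>n. \<integral>\<omega>. norm (iexp (t * (Y n \<omega> - X n \<omega>)) - 1) \<partial>M) \<longlonglongrightarrow> 0"
  shows "weak_conv_m (\<lambda>n. distr M borel (Y n)) \<mu>"
proof (rule levy_continuity)
  have rd: "real_distribution (distr M borel Z)" if [measurable]: "Z \<in> borel_measurable M" for Z
    by (rule real_distribution_distr) (rule that)
  show "real_distribution (distr M borel (Y n))" for n
    by (rule rd) simp
  show "real_distribution \<mu>" by fact
  fix t
  have char_eq: "char (distr M borel Z) t = (CLINT \<omega>|M. iexp (t * Z \<omega>))"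
    if [measurable]: "Z \<in> borel_measurable M" for Z
    unfolding char_def by (subst integral_distr) auto
  have int: "integrable M (\<lambda>\<omega>. iexp (t * Z \<omega>))" if [measurable]: "Z \<in> borel_measurable M" for Z
    by (rule integrable_const_bound[where B=1]) auto
  have cX: "(\<lambda>n. char (distr M borel (X n)) t) \<longlonglongrightarrow> char \<mu> t"
    by (rule levy_continuity1[OF _ \<mu> conv]) (rule rd, simp)
  have le: "norm (char (distr M borel (Y n)) t - char (distr M borel (X n)) t)
      \<le> (\<integral>\<omega>. norm (iexp (t * (Y n \<omega> - X n \<omega>)) - 1) \<partial>M)" for n
  proof -
    have "char (distr M borel (Y n)) t - char (distr M borel (X n)) t
        = (CLINT \<omega>|M. iexp (t * Y n \<omega>) - iexp (t * X n \<omega>))"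
      by (subst Bochner_Integration.integral_diff) (simp_all only: char_eq int assms)
    also have "norm \<dots> \<le> (\<integral>\<omega>. norm (iexp (t * Y n \<omega>) - iexp (t * X n \<omega>)) \<partial>M)"
      by (rule integral_norm_bound)
    also have "\<dots> = (\<integral>\<omega>. norm (iexp (t * (Y n \<omega> - X n \<omega>)) - 1) \<partial>M)"
    proof (rule Bochner_Integration.integral_cong[OF refl])
      fix \<omega>
      \<comment> \<open>Factoring out \<open>iexp (t * X n \<omega>)\<close>, which has modulus one,
        leaves a quantity that depends on \<open>Y n - X n\<close> alone.\<close>
      have "iexp (t * Y n \<omega>) - iexp (t * X n \<omega>)
          = iexp (t * X n \<omega>) * (iexp (t * (Y n \<omega> - X n \<omega>)) - 1)"
        by (simp add: algebra_simps exp_add[symmetric] of_real_diff)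
      then show "norm (iexp (t * Y n \<omega>) - iexp (t * X n \<omega>)) = norm (iexp (t * (Y n \<omega> - X n \<omega>)) - 1)"
        by (simp add: norm_mult)
    qed
    finally show ?thesis .
  qed
  have "(\<lambda>n. char (distr M borel (Y n)) t - char (distr M borel (X n)) t) \<longlonglongrightarrow> 0"
    by (rule Lim_null_comparison[OF _ diff[of t]]) (use le in auto)
  from tendsto_add[OF this cX] show "(\<lambda>n. char (distr M borel (Y n)) t) \<longlonglongrightarrow> char \<mu> t"
    by simp
qed

text \<open>The form used to pass from \<open>H\<close> to logarithms of norms: there the two differ
  by an eventually constant amount divided by a multiple of \<open>sqrt (real n)\<close>.\<close>

lemma (in prob_space) weak_conv_perturb_AE:
  fixes X Y :: "nat \<Rightarrow> 'a \<Rightarrow> real"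
  assumes [measurable]: "\<And>n. X n \<in> borel_measurable M" "\<And>n. Y n \<in> borel_measurable M"
    and "real_distribution \<mu>"
    and "weak_conv_m (\<lambda>n. distr M borel (X n)) \<mu>"
    and diff: "AE \<omega> in M. (\<lambda>n. Y n \<omega> - X n \<omega>) \<longlonglongrightarrow> 0"
  shows "weak_conv_m (\<lambda>n. distr M borel (Y n)) \<mu>"
proof (rule weak_conv_perturb[of X Y])
  fix t
  have "(\<lambda>n. \<integral>\<omega>. norm (iexp (t * (Y n \<omega> - X n \<omega>)) - 1) \<partial>M) \<longlonglongrightarrow> (\<integral>\<omega>. 0 \<partial>M)"
  proof (rule integral_dominated_convergence[where w="\<lambda>_. 2"])
    show "AE \<omega> in M. (\<lambda>n. norm (iexp (t * (Y n \<omega> - X n \<omega>)) - 1)) \<longlonglongrightarrow> 0"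
      using diff
    proof eventually_elim
      case (elim \<omega>)
      have "(\<lambda>n. norm (iexp (t * (Y n \<omega> - X n \<omega>)) - 1)) \<longlonglongrightarrow> norm (iexp (t * 0) - 1)"
        by (intro tendsto_intros elim)
      then show ?case by simp
    qed
    show "AE \<omega> in M. norm (norm (iexp (t * (Y n \<omega> - X n \<omega>)) - 1)) \<le> 2" for n
    proof (intro AE_I2)
      fix \<omega>
      have "norm (iexp (t * (Y n \<omega> - X n \<omega>)) - 1) \<le> norm (iexp (t * (Y n \<omega> - X n \<omega>))) + norm (1::complex)"
        by (rule norm_triangle_ineq4)
      also have "\<dots> = 2" by simp
      finally show "norm (norm (iexp (t * (Y n \<omega> - X n \<omega>)) - 1)) \<le> 2" by simp
    qed
  qed auto
  then show "(\<lambda>n. \<integral>\<omega>. norm (iexp (t * (Y n \<omega> - X n \<omega>)) - 1) \<partial>M) \<longlonglongrightarrow> 0" by simp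
qed fact+

lemma (in prob_space) expectation_abs_le_sqrt:
  fixes X :: "'a \<Rightarrow> real"
  assumes [measurable]: "X \<in> borel_measurable M" and i2: "integrable M (\<lambda>x. (X x)\<^sup>2)"
  shows "integrable M X" "expectation (\<lambda>x. \<bar>X x\<bar>) \<le> sqrt (expectation (\<lambda>x. (X x)\<^sup>2))"
proof -
  show i1: "integrable M X" by (rule square_integrable_imp_integrable[OF _ i2]) simp
  have "0 \<le> variance (\<lambda>x. \<bar>X x\<bar>)" by (rule variance_positive)
  also have "\<dots> = expectation (\<lambda>x. \<bar>X x\<bar>\<^sup>2) - (expectation (\<lambda>x. \<bar>X x\<bar>))\<^sup>2"
    by (rule variance_eq) (use i1 i2 in auto)
  finally show "expectation (\<lambda>x. \<bar>X x\<bar>) \<le> sqrt (expectation (\<lambda>x. (X x)\<^sup>2))"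
    by (intro real_le_rsqrt) auto
qed

text \<open>The form used to exchange a random number of cycles for a deterministic one. Since
  \<open>norm (iexp s - 1) \<le> \<bar>s\<bar>\<close>, the first absolute moment of the difference
  suffices, and Cauchy-Schwarz bounds it by the second.\<close>

lemma (in prob_space) weak_conv_perturb_L2:
  fixes X Y :: "nat \<Rightarrow> 'a \<Rightarrow> real"
  assumes [measurable]: "\<And>n. X n \<in> borel_measurable M" "\<And>n. Y n \<in> borel_measurable M"
    and "real_distribution \<mu>"
    and "weak_conv_m (\<lambda>n. distr M borel (X n)) \<mu>"
    and int: "\<And>n. integrable M (\<lambda>\<omega>. (Y n \<omega> - X n \<omega>)\<^sup>2)"
    and diff: "(\<lambda>n. \<integral>\<omega>. (Y n \<omega> - X n \<omega>)\<^sup>2 \<partial>M) \<longlonglongrightarrow> 0"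
  shows "weak_conv_m (\<lambda>n. distr M borel (Y n)) \<mu>"
proof (rule weak_conv_perturb[of X Y])
  fix t
  have le: "(\<integral>\<omega>. norm (iexp (t * (Y n \<omega> - X n \<omega>)) - 1) \<partial>M) \<le> \<bar>t\<bar> * sqrt (\<integral>\<omega>. (Y n \<omega> - X n \<omega>)\<^sup>2 \<partial>M)" for n
  proof -
    let ?E = "\<lambda>\<omega>. \<bar>Y n \<omega> - X n \<omega>\<bar>"
    have i1: "integrable M (\<lambda>\<omega>. Y n \<omega> - X n \<omega>)"
      and E: "expectation ?E \<le> sqrt (\<integral>\<omega>. (Y n \<omega> - X n \<omega>)\<^sup>2 \<partial>M)"
      by (rule expectation_abs_le_sqrt[OF _ int], simp)+
    have pt: "norm (iexp s - 1) \<le> \<bar>s\<bar>" for s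
      using iexp_approx1[of s 0] by simp
    have "(\<integral>\<omega>. norm (iexp (t * (Y n \<omega> - X n \<omega>)) - 1) \<partial>M) \<le> (\<integral>\<omega>. \<bar>t\<bar> * ?E \<omega> \<partial>M)"
      by (rule integral_mono_AE')
         (use i1 pt[of "t * (Y n _ - X n _)"] in \<open>auto simp: abs_mult\<close>)
    also have "\<dots> = \<bar>t\<bar> * expectation ?E" by simp
    also have "\<dots> \<le> \<bar>t\<bar> * sqrt (\<integral>\<omega>. (Y n \<omega> - X n \<omega>)\<^sup>2 \<partial>M)"
      by (intro mult_left_mono E) auto
    finally show ?thesis .
  qed
  have lim: "(\<lambda>n. \<bar>t\<bar> * sqrt (\<integral>\<omega>. (Y n \<omega> - X n \<omega>)\<^sup>2 \<partial>M)) \<longlonglongrightarrow> 0"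
    using tendsto_mult[OF tendsto_const[of "\<bar>t\<bar>"] tendsto_real_sqrt[OF diff]] by simp
  show "(\<lambda>n. \<integral>\<omega>. norm (iexp (t * (Y n \<omega> - X n \<omega>)) - 1) \<partial>M) \<longlonglongrightarrow> 0"
    by (rule tendsto_sandwich[OF _ _ tendsto_const lim]) (use le in auto)
qed fact+

lemma abs_sum_increments:
  fixes d :: "nat \<Rightarrow> real"
  shows "\<bar>d (m + l)\<bar> \<le> \<bar>d m\<bar> + (\<Sum>i<l. \<bar>d (Suc (m + i)) - d (m + i)\<bar>)"
  by (induction l) auto

lemma square_add_sum_le:
  fixes b :: real
  shows "(b + (\<Sum>i<n. g i))\<^sup>2 \<le> 2 * b\<^sup>2 + 2 * real n * (\<Sum>i<n. (g i)\<^sup>2)"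
proof -
  have "(\<Sum>i<n. 1 * g i)\<^sup>2 \<le> (\<Sum>i<n. 1\<^sup>2) * (\<Sum>i<n. (g i)\<^sup>2)"
    by (rule Cauchy_Schwarz_ineq_sum)
  then have "(\<Sum>i<n. g i)\<^sup>2 \<le> real n * (\<Sum>i<n. (g i)\<^sup>2)" by simp
  moreover have "(b + (\<Sum>i<n. g i))\<^sup>2 \<le> 2 * b\<^sup>2 + 2 * (\<Sum>i<n. g i)\<^sup>2"
    using sum_squares_bound[of b "\<Sum>i<n. g i"] by (simp add: power2_sum)
  ultimately show ?thesis by simp
qed

text \<open>Along the squares the second moments are summable; between consecutive squares the
  increments are controlled by Cauchy--Schwarz, so no maximal inequality is required.\<close>
lemma (in prob_space) AE_sublinear_of_second_moments:
  fixes D :: "nat \<Rightarrow> 'a \<Rightarrow> real"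
  assumes [measurable]: "\<And>n. D n \<in> borel_measurable M"
    and C: "C \<ge> 0"
    and growth: "\<And>n. (\<integral>\<^sup>+\<omega>. ennreal ((D n \<omega>)\<^sup>2) \<partial>M) \<le> ennreal (C * real (Suc n))"
    and incr: "\<And>n. (\<integral>\<^sup>+\<omega>. ennreal ((D (Suc n) \<omega> - D n \<omega>)\<^sup>2) \<partial>M) \<le> ennreal C"
  shows "AE \<omega> in M. (\<lambda>n. D n \<omega> / real n) \<longlonglongrightarrow> 0"
proof -
  \<comment> \<open>\<open>B k\<close> dominates \<open>\<bar>D n\<bar>\<close> on the whole block
    from \<open>k\<^sup>2\<close> to the next square, which is \<open>2*k+1\<close> steps
    away.\<close>
  define B where "B k \<omega> = \<bar>D (k\<^sup>2) \<omega>\<bar> + (\<Sum>i<2*k+1. \<bar>D (Suc (k\<^sup>2+i)) \<omega> - D (k\<^sup>2+i) \<omega>\<bar>)" for k \<omega>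
  have [measurable]: "B k \<in> borel_measurable M" for k unfolding B_def by measurable
  have B_nonneg: "0 \<le> B k \<omega>" for k \<omega> unfolding B_def by (intro add_nonneg_nonneg sum_nonneg) auto
  \<comment> \<open>The second moment of \<open>B k\<close> is of order \<open>k\<^sup>2\<close>, by
    \<open>2*k+1\<close> increments and Cauchy-Schwarz. Dividing by the square index gives terms of
    order \<open>1 / k\<^sup>2\<close>, which are summable. The shift to \<open>Suc k\<close> avoids
    a zero denominator.\<close>
  define e where "e k \<omega> = (B (Suc k) \<omega> / real ((Suc k)\<^sup>2))\<^sup>2" for k \<omega>
  have [measurable]: "e k \<in> borel_measurable M" for k unfolding e_def by measurable
  have eB: "(\<integral>\<^sup>+\<omega>. ennreal ((B k \<omega>)\<^sup>2) \<partial>M) \<le> ennreal (10 * C * (real (Suc k))\<^sup>2)" for k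
  proof -
    have "(\<integral>\<^sup>+\<omega>. ennreal ((B k \<omega>)\<^sup>2) \<partial>M) \<le> (\<integral>\<^sup>+\<omega>. ennreal 2 * ennreal ((D (k\<^sup>2) \<omega>)\<^sup>2)
        + ennreal (2 * real (2*k+1)) * (\<Sum>i<2*k+1. ennreal ((D (Suc (k\<^sup>2+i)) \<omega> - D (k\<^sup>2+i) \<omega>)\<^sup>2)) \<partial>M)"
    proof (rule nn_integral_mono)
      fix \<omega>
      have "(B k \<omega>)\<^sup>2 \<le> 2 * (D (k\<^sup>2) \<omega>)\<^sup>2 + 2 * real (2*k+1) * (\<Sum>i<2*k+1. (D (Suc (k\<^sup>2+i)) \<omega> - D (k\<^sup>2+i) \<omega>)\<^sup>2)"
        using square_add_sum_le[of "\<bar>D (k\<^sup>2) \<omega>\<bar>" "\<lambda>i. \<bar>D (Suc (k\<^sup>2+i)) \<omega> - D (k\<^sup>2+i) \<omega>\<bar>" "2*k+1"]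
        unfolding B_def by simp
      then have "ennreal ((B k \<omega>)\<^sup>2) \<le> ennreal (2 * (D (k\<^sup>2) \<omega>)\<^sup>2 + 2 * real (2*k+1) * (\<Sum>i<2*k+1. (D (Suc (k\<^sup>2+i)) \<omega> - D (k\<^sup>2+i) \<omega>)\<^sup>2))"
        by (rule ennreal_leI)
      also have "\<dots> = ennreal 2 * ennreal ((D (k\<^sup>2) \<omega>)\<^sup>2)
        + ennreal (2 * real (2*k+1)) * (\<Sum>i<2*k+1. ennreal ((D (Suc (k\<^sup>2+i)) \<omega> - D (k\<^sup>2+i) \<omega>)\<^sup>2))"
        by (subst ennreal_plus) (auto intro!: sum_nonneg mult_nonneg_nonneg simp: ennreal_mult sum_ennreal sum_nonneg)
      finally show "ennreal ((B k \<omega>)\<^sup>2) \<le> \<dots>" .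
    qed
    also have "\<dots> = ennreal 2 * (\<integral>\<^sup>+\<omega>. ennreal ((D (k\<^sup>2) \<omega>)\<^sup>2) \<partial>M)
        + ennreal (2 * real (2*k+1)) * (\<Sum>i<2*k+1. \<integral>\<^sup>+\<omega>. ennreal ((D (Suc (k\<^sup>2+i)) \<omega> - D (k\<^sup>2+i) \<omega>)\<^sup>2) \<partial>M)"
      by (subst nn_integral_add, simp, simp, subst nn_integral_cmult, simp, subst nn_integral_cmult, simp,
          subst nn_integral_sum) auto
    also have "\<dots> \<le> ennreal 2 * ennreal (C * real (Suc (k\<^sup>2))) + ennreal (2 * real (2*k+1)) * (\<Sum>i<2*k+1. ennreal C)"
      by (intro add_mono mult_left_mono sum_mono growth incr) auto
    also have "\<dots> = ennreal (2 * (C * real (Suc (k\<^sup>2))) + 2 * real (2*k+1) * (real (2*k+1) * C))"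
    proof -
      have "(\<Sum>i<2*k+1. ennreal C) = ennreal (real (2*k+1) * C)"
        using C by (subst sum_ennreal) auto
      then show ?thesis using C by (simp only: ennreal_mult[symmetric] ennreal_plus[symmetric] mult_nonneg_nonneg of_nat_0_le_iff zero_le_numeral)
    qed
    also have "\<dots> \<le> ennreal (10 * C * (real (Suc k))\<^sup>2)"
    proof (rule ennreal_leI)
      have "2 * (C * real (Suc (k\<^sup>2))) + 2 * real (2*k+1) * (real (2*k+1) * C) = C * (10 * (real k)\<^sup>2 + 8 * real k + 4)"
        by (simp add: algebra_simps power2_eq_square)
      also have "\<dots> \<le> C * (10 * (real (Suc k))\<^sup>2)"
        by (rule mult_left_mono) (auto simp: algebra_simps power2_eq_square C)
      finally show "2 * (C * real (Suc (k\<^sup>2))) + 2 * real (2*k+1) * (real (2*k+1) * C) \<le> 10 * C * (real (Suc k))\<^sup>2"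
        by (simp add: algebra_simps)
    qed
    finally show ?thesis .
  qed
  have ee: "(\<integral>\<^sup>+\<omega>. ennreal (e k \<omega>) \<partial>M) \<le> ennreal (40 * C * (1 / (real (Suc k))\<^sup>2))" for k
  proof -
    let ?c = "1 / (real ((Suc k)\<^sup>2))\<^sup>2"
    have "(\<integral>\<^sup>+\<omega>. ennreal (e k \<omega>) \<partial>M) = (\<integral>\<^sup>+\<omega>. ennreal ?c * ennreal ((B (Suc k) \<omega>)\<^sup>2) \<partial>M)"
      unfolding e_def by (rule nn_integral_cong) (simp add: power_divide ennreal_mult[symmetric])
    also have "\<dots> = ennreal ?c * (\<integral>\<^sup>+\<omega>. ennreal ((B (Suc k) \<omega>)\<^sup>2) \<partial>M)"
      by (simp add: nn_integral_cmult)
    also have "\<dots> \<le> ennreal ?c * ennreal (10 * C * (real (Suc (Suc k)))\<^sup>2)"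
      by (intro mult_left_mono eB) auto
    also have "\<dots> = ennreal (?c * (10 * C * (real (Suc (Suc k)))\<^sup>2))"
      by (rule ennreal_mult[symmetric]) (use C in auto)
    also have "\<dots> \<le> ennreal (40 * C * (1 / (real (Suc k))\<^sup>2))"
    proof (rule ennreal_leI)
      \<comment> \<open>Squared, this doubling turns the constant 10 of \<open>eB\<close> into
        40.\<close>
      have "real (Suc (Suc k)) \<le> 2 * real (Suc k)" by simp
      then have "(real (Suc (Suc k)))\<^sup>2 \<le> (2 * real (Suc k))\<^sup>2" by (rule power_mono) simp
      then have "?c * (10 * C * (real (Suc (Suc k)))\<^sup>2) \<le> ?c * (10 * C * (2 * real (Suc k))\<^sup>2)"
        using C by (intro mult_left_mono) auto
      also have "\<dots> = 40 * C * (1 / (real (Suc k))\<^sup>2)"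
      proof -
        define y where "y = real (Suc k)"
        have "y > 0" "real ((Suc k)\<^sup>2) = y\<^sup>2" by (simp_all add: y_def)
        then show ?thesis unfolding y_def[symmetric] by (simp add: field_simps power2_eq_square)
      qed
      finally show "?c * (10 * C * (real (Suc (Suc k)))\<^sup>2) \<le> 40 * C * (1 / (real (Suc k))\<^sup>2)" .
    qed
    finally show ?thesis .
  qed
  have "summable (\<lambda>k. 1 / (real (Suc k))\<^sup>2)"
    using inverse_power_summable[of 2, where 'a=real] 
    by (subst summable_Suc_iff[of "\<lambda>k. 1 / (real k)\<^sup>2"]) (simp add: divide_inverse)
  then have sm: "summable (\<lambda>k. 40 * C * (1 / (real (Suc k))\<^sup>2))" by (rule summable_mult)
  have "(\<integral>\<^sup>+\<omega>. (\<Sum>k. ennreal (e k \<omega>)) \<partial>M) = (\<Sum>k. \<integral>\<^sup>+\<omega>. ennreal (e k \<omega>) \<partial>M)"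
    by (rule nn_integral_suminf) simp
  also have "\<dots> \<le> (\<Sum>k. ennreal (40 * C * (1 / (real (Suc k))\<^sup>2)))"
    by (intro suminf_le ee) auto
  also have "\<dots> = ennreal (\<Sum>k. 40 * C * (1 / (real (Suc k))\<^sup>2))"
    using C by (intro suminf_ennreal2 sm) auto
  also have "\<dots> < \<infinity>" by simp
  finally have "AE \<omega> in M. (\<Sum>k. ennreal (e k \<omega>)) \<noteq> \<infinity>"
    by (intro nn_integral_PInf_AE) auto
  then show ?thesis
  proof eventually_elim
    case (elim \<omega>)
    have "summable (\<lambda>k. e k \<omega>)"
      using elim by (intro summable_suminf_not_top) (auto simp: e_def)
    then have "(\<lambda>k. e k \<omega>) \<longlonglongrightarrow> 0" by (rule summable_LIMSEQ_zero)
    then have "(\<lambda>k. sqrt (e k \<omega>)) \<longlonglongrightarrow> sqrt 0" by (rule tendsto_real_sqrt)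
    moreover have "sqrt (e k \<omega>) = B (Suc k) \<omega> / real ((Suc k)\<^sup>2)" for k
      unfolding e_def using B_nonneg[of "Suc k" \<omega>] by simp
    ultimately have "(\<lambda>k. B (Suc k) \<omega> / real ((Suc k)\<^sup>2)) \<longlonglongrightarrow> 0" by simp
    then have Blim: "(\<lambda>k. B k \<omega> / real (k\<^sup>2)) \<longlonglongrightarrow> 0" by (rule LIMSEQ_imp_Suc)
    have sq: "filterlim floor_sqrt at_top sequentially"
      unfolding filterlim_at_top
    proof
      fix Z :: nat
      show "eventually (\<lambda>n. Z \<le> floor_sqrt n) sequentially"
        using eventually_ge_at_top[of "Z\<^sup>2"]
        by eventually_elim (simp add: le_floor_sqrtI)
    qed
    have lim: "(\<lambda>n. B (floor_sqrt n) \<omega> / real ((floor_sqrt n)\<^sup>2)) \<longlonglongrightarrow> 0"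
      by (rule filterlim_compose[OF Blim sq])
    show ?case
    proof (rule Lim_null_comparison[OF _ lim])
      show "eventually (\<lambda>n. norm (D n \<omega> / real n) \<le> B (floor_sqrt n) \<omega> / real ((floor_sqrt n)\<^sup>2)) sequentially"
        using eventually_gt_at_top[of 0]
      proof eventually_elim
        case (elim n)
        define k where "k = floor_sqrt n"
        define l where "l = n - k\<^sup>2"
        have k1: "k\<^sup>2 \<le> n" unfolding k_def by simp
        have "n < (Suc k)\<^sup>2" unfolding k_def by (rule Suc_floor_sqrt_power2_gt)
        then have l: "n = k\<^sup>2 + l" "l \<le> 2 * k + 1" unfolding l_def using k1 
          by (auto simp: power2_eq_square)
        have k0: "k > 0" unfolding k_def using elim by simp
        have "\<bar>D n \<omega>\<bar> \<le> \<bar>D (k\<^sup>2) \<omega>\<bar> + (\<Sum>i<l. \<bar>D (Suc (k\<^sup>2+i)) \<omega> - D (k\<^sup>2+i) \<omega>\<bar>)"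
          unfolding l(1) by (rule abs_sum_increments)
        also have "\<dots> \<le> B k \<omega>"
          unfolding B_def by (intro add_left_mono sum_mono2) (use l in auto)
        finally have "\<bar>D n \<omega>\<bar> / real n \<le> B k \<omega> / real (k\<^sup>2)"
          by (intro frac_le) (use k0 k1 in auto)
        then show ?case unfolding k_def by simp
      qed
    qed
  qed
qed

section \<open>Words and renewal cycles\<close>

fun first_hit :: "'a \<Rightarrow> 'a list \<Rightarrow> bool" where
  "first_hit s [] = False"
| "first_hit s (a # w) = (if a = s then w = [] else first_hit s w)"

lemma first_hitE:
  assumes "first_hit s w"
  obtains u where "w = u @ [s]" "s \<notin> set u"
  using assms
proof (induction w arbitrary: thesis)
  case (Cons a w)
  show ?case
  proof (cases "a = s")
    case True
    then show ?thesis using Cons.prems(1)[of "[]"] Cons.prems(2) by simp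
  next
    case False
    then have "first_hit s w" using Cons.prems(2) by simp
    then obtain u where "w = u @ [s]" "s \<notin> set u" using Cons.IH by blast
    then show ?thesis using Cons.prems(1)[of "a # u"] False by simp
  qed
qed simp

lemma first_hit_snoc: "s \<notin> set u \<Longrightarrow> first_hit s (u @ [s])"
  by (induction u) auto

lemma nn_integral_replicate_pmf_Suc:
  "(\<integral>\<^sup>+w. \<phi> w \<partial>replicate_pmf (Suc n) P) = (\<integral>\<^sup>+a. \<integral>\<^sup>+w. \<phi> (a # w) \<partial>replicate_pmf n P \<partial>measure_pmf P)"
  by (simp add: nn_integral_bind_pmf)

lemma nn_integral_replicate_pmf_snoc:
  "(\<integral>\<^sup>+w. \<phi> w \<partial>replicate_pmf (Suc n) P) = (\<integral>\<^sup>+w. \<integral>\<^sup>+a. \<phi> (w @ [a]) \<partial>measure_pmf P \<partial>replicate_pmf n P)"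
proof -
  have "replicate_pmf (Suc n) P = replicate_pmf (n + 1) P" by simp
  also have "\<dots> = do {xs \<leftarrow> replicate_pmf n P; ys \<leftarrow> replicate_pmf 1 P; return_pmf (xs @ ys)}"
    by (rule replicate_pmf_distrib)
  finally show ?thesis
    by (simp add: nn_integral_bind_pmf replicate_pmf_1)
qed

lemma pmf_replicate_pmf:
  "pmf (replicate_pmf n P) w = (if length w = n then \<Prod>a\<leftarrow>w. pmf P a else 0)"
proof (induction n arbitrary: w)
  case 0
  then show ?case by (simp add: pmf_return indicator_def)
next
  case (Suc n)
  have "ennreal (pmf (replicate_pmf (Suc n) P) w) = (\<integral>\<^sup>+u. indicator {w} u \<partial>replicate_pmf (Suc n) P)"
    by (simp add: emeasure_pmf_single del: replicate_pmf.simps)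
  also have "\<dots> = (\<integral>\<^sup>+a. \<integral>\<^sup>+u. indicator {w} (a # u) \<partial>replicate_pmf n P \<partial>measure_pmf P)"
    by (rule nn_integral_replicate_pmf_Suc)
  also have "\<dots> = ennreal (if length w = Suc n then \<Prod>a\<leftarrow>w. pmf P a else 0)"
  proof (cases w)
    case Nil
    then show ?thesis by simp
  next
    case (Cons b v)
    have *: "indicator {w} (a # u) = (indicator {b} a * indicator {v} u :: ennreal)" for a u
      by (auto simp: Cons indicator_def)
    show ?thesis
      unfolding * by (simp add: nn_integral_cmult nn_integral_multc emeasure_pmf_single Suc Cons ennreal_mult'[symmetric] mult.commute)
  qed
  finally show ?case
    by (subst (asm) ennreal_inj) (auto intro!: prod_list_nonneg simp del: replicate_pmf.simps)
qed

text \<open>A word has positive mass at most under the law of its own length, so summing over all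
  lengths counts each word once.\<close>

lemma nn_integral_words:
  fixes P :: "'a::finite pmf" and \<phi> :: "'a list \<Rightarrow> ennreal"
  shows "(\<integral>\<^sup>+w. ennreal (\<Prod>a\<leftarrow>w. pmf P a) * \<phi> w \<partial>count_space UNIV)
    = (\<Sum>n. \<integral>\<^sup>+w. \<phi> w \<partial>replicate_pmf n P)"
proof -
  have "(\<Sum>n. \<integral>\<^sup>+w. \<phi> w \<partial>replicate_pmf n P)
      = (\<Sum>n. \<integral>\<^sup>+w. ennreal (pmf (replicate_pmf n P) w) * \<phi> w \<partial>count_space UNIV)"
    by (simp add: nn_integral_measure_pmf)
  also have "\<dots> = (\<integral>\<^sup>+w. (\<Sum>n. ennreal (pmf (replicate_pmf n P) w) * \<phi> w) \<partial>count_space UNIV)"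
    by (rule nn_integral_suminf[symmetric]) simp
  also have "\<dots> = (\<integral>\<^sup>+w. ennreal (\<Prod>a\<leftarrow>w. pmf P a) * \<phi> w \<partial>count_space UNIV)"
  proof (rule nn_integral_cong)
    fix w
    show "(\<Sum>n. ennreal (pmf (replicate_pmf n P) w) * \<phi> w) = ennreal (\<Prod>a\<leftarrow>w. pmf P a) * \<phi> w"
      by (subst suminf_finite[of "{length w}"]) (auto simp: pmf_replicate_pmf)
  qed
  finally show ?thesis by simp
qed

text \<open>The unfinished cycle at the end of a word: the counterpart, as a word, of the age in
  renewal theory.\<close>

definition resid :: "'a \<Rightarrow> 'a list \<Rightarrow> 'a list" where
  "resid s w = rev (takeWhile (\<lambda>a. a \<noteq> s) (rev w))"

lemma resid_Nil [simp]: "resid s [] = []"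
  by (simp add: resid_def)

lemma resid_snoc: "resid s (w @ [a]) = (if a = s then [] else resid s w @ [a])"
  by (simp add: resid_def)

lemma resid_id: "s \<notin> set u \<Longrightarrow> resid s u = u"
  by (induction u rule: rev_induct) (auto simp: resid_snoc)

lemma notin_resid: "s \<notin> set (resid s w)"
  unfolding resid_def by (auto dest: set_takeWhileD)

lemma resid_append: "resid s (w @ s # u) = resid s u"
proof (induction u rule: rev_induct)
  case Nil
  show ?case by (simp add: resid_snoc)
next
  case (snoc a u)
  have "resid s ((w @ s # u) @ [a]) = resid s (u @ [a])"
    unfolding resid_snoc using snoc by simp
  then show ?case by simp
qed

lemma resid_append_first_hit: "first_hit s c \<Longrightarrow> resid s (c @ u) = resid s u"
  by (erule first_hitE) (simp add: resid_append)

text \<open>The point is uniformity in \<open>n\<close>: an estimate that is summable over all words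
  avoiding \<open>s\<close> bounds the unfinished cycle at every time. A new letter either resets
  the residue or extends it, which is the induction step.\<close>

lemma nn_integral_resid_le:
  "(\<integral>\<^sup>+w. \<phi> (resid s w) \<partial>replicate_pmf n P)
    \<le> (\<Sum>k\<le>n. \<integral>\<^sup>+w. \<phi> w * indicator {w. s \<notin> set w} w \<partial>replicate_pmf k P)"
proof (induction n arbitrary: \<phi>)
  case 0
  then show ?case by simp
next
  case (Suc n)
  define \<psi> where "\<psi> u = (\<integral>\<^sup>+a. \<phi> (u @ [a]) * indicator (-{s}) a \<partial>measure_pmf P)" for u
  have "(\<integral>\<^sup>+w. \<phi> (resid s w) \<partial>replicate_pmf (Suc n) P)
      = (\<integral>\<^sup>+w. \<integral>\<^sup>+a. \<phi> (resid s (w @ [a])) \<partial>measure_pmf P \<partial>replicate_pmf n P)"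
    by (rule nn_integral_replicate_pmf_snoc)
  \<comment> \<open>A reset is charged with the full \<open>\<phi> []\<close> instead of its
    probability; this supplies the term \<open>k = 0\<close> of the sum.\<close>
  also have "\<dots> \<le> (\<integral>\<^sup>+w. \<integral>\<^sup>+a. \<phi> [] + \<phi> (resid s w @ [a]) * indicator (-{s}) a \<partial>measure_pmf P \<partial>replicate_pmf n P)"
    by (intro nn_integral_mono) (auto simp: resid_snoc)
  also have "\<dots> = \<phi> [] + (\<integral>\<^sup>+w. \<psi> (resid s w) \<partial>replicate_pmf n P)"
    by (simp add: nn_integral_add \<psi>_def)
  also have "\<dots> \<le> \<phi> [] + (\<Sum>k\<le>n. \<integral>\<^sup>+w. \<psi> w * indicator {w. s \<notin> set w} w \<partial>replicate_pmf k P)"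
    by (intro add_left_mono Suc.IH)
  also have "(\<Sum>k\<le>n. \<integral>\<^sup>+w. \<psi> w * indicator {w. s \<notin> set w} w \<partial>replicate_pmf k P)
     = (\<Sum>k\<le>n. \<integral>\<^sup>+w. \<phi> w * indicator {w. s \<notin> set w} w \<partial>replicate_pmf (Suc k) P)"
  proof (rule sum.cong[OF refl])
    fix k
    have "(\<integral>\<^sup>+w. \<phi> w * indicator {w. s \<notin> set w} w \<partial>replicate_pmf (Suc k) P)
       = (\<integral>\<^sup>+w. \<integral>\<^sup>+a. \<phi> (w @ [a]) * indicator {w. s \<notin> set w} (w @ [a]) \<partial>measure_pmf P \<partial>replicate_pmf k P)"
      by (rule nn_integral_replicate_pmf_snoc)
    also have "\<dots> = (\<integral>\<^sup>+w. \<psi> w * indicator {w. s \<notin> set w} w \<partial>replicate_pmf k P)"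
      unfolding \<psi>_def
      by (intro nn_integral_cong, subst nn_integral_multc[symmetric], simp, intro nn_integral_cong)
         (auto simp: indicator_def)
    finally show "(\<integral>\<^sup>+w. \<psi> w * indicator {w. s \<notin> set w} w \<partial>replicate_pmf k P)
      = (\<integral>\<^sup>+w. \<phi> w * indicator {w. s \<notin> set w} w \<partial>replicate_pmf (Suc k) P)" by simp
  qed
  also have "\<phi> [] + (\<Sum>k\<le>n. \<integral>\<^sup>+w. \<phi> w * indicator {w. s \<notin> set w} w \<partial>replicate_pmf (Suc k) P)
     = (\<Sum>k\<le>Suc n. \<integral>\<^sup>+w. \<phi> w * indicator {w. s \<notin> set w} w \<partial>replicate_pmf k P)"
    by (subst sum.atMost_Suc_shift) (simp only: replicate_pmf.simps(1) nn_integral_return_pmf, simp)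
  finally show ?case .
qed

lemma measurable_count_space_binary:
  fixes f :: "'x \<Rightarrow> 'b::countable" and g :: "'x \<Rightarrow> 'c::countable"
  assumes f: "f \<in> measurable M (count_space UNIV)" and g: "g \<in> measurable M (count_space UNIV)"
  shows "(\<lambda>x. h (f x) (g x)) \<in> measurable M (count_space UNIV)"
  by (rule measurable_compose_countable[OF _ f]) (rule measurable_compose[OF g], simp)

section \<open>Law of one cycle, and i.i.d. cycles as a source of i.i.d. letters\<close>

locale letter_renewal =
  fixes P :: "'a::finite pmf" and s :: 'a
  assumes s_pos: "pmf P s > 0"
begin

lemma nn_integral_first_hit_length:
  "(\<integral>\<^sup>+w. indicator {w. first_hit s w} w \<partial>replicate_pmf (Suc n) P) = ennreal (pmf P s * (1 - pmf P s) ^ n)"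
proof (induction n)
  case 0
  have "(\<integral>\<^sup>+w. indicator {w. first_hit s w} w \<partial>replicate_pmf (Suc 0) P) = (\<integral>\<^sup>+a. indicator {s} a \<partial>measure_pmf P)"
    unfolding nn_integral_replicate_pmf_Suc
    by (intro nn_integral_cong) (auto simp: indicator_def)
  then show ?case by (simp add: emeasure_pmf_single)
next
  case (Suc n)
  have "(\<integral>\<^sup>+w. indicator {w. first_hit s w} w \<partial>replicate_pmf (Suc (Suc n)) P)
     = (\<integral>\<^sup>+a. \<integral>\<^sup>+w. indicator {w. first_hit s w} (a # w) \<partial>replicate_pmf (Suc n) P \<partial>measure_pmf P)"
    by (rule nn_integral_replicate_pmf_Suc)
  also have "\<dots> = (\<integral>\<^sup>+a. indicator (-{s}) a * (\<integral>\<^sup>+w. indicator {w. first_hit s w} w \<partial>replicate_pmf (Suc n) P) \<partial>measure_pmf P)"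
  proof (intro nn_integral_cong)
    fix a
    show "(\<integral>\<^sup>+w. indicator {w. first_hit s w} (a # w) \<partial>replicate_pmf (Suc n) P)
       = indicator (-{s}) a * (\<integral>\<^sup>+w. indicator {w. first_hit s w} w \<partial>replicate_pmf (Suc n) P)"
    proof (cases "a = s")
      case True
      have "(\<integral>\<^sup>+w. indicator {w. first_hit s w} (a # w) \<partial>replicate_pmf (Suc n) P) = (\<integral>\<^sup>+w. 0 \<partial>replicate_pmf (Suc n) P)"
        by (rule nn_integral_cong_AE) (auto simp: AE_measure_pmf_iff set_replicate_pmf True indicator_def)
      then show ?thesis using True by simp
    next
      case False
      then show ?thesis by (auto simp: indicator_def simp del: replicate_pmf.simps intro!: nn_integral_cong)
    qed
  qed
  also have "\<dots> = ennreal (1 - pmf P s) * ennreal (pmf P s * (1 - pmf P s) ^ n)"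
  proof -
    have "emeasure (measure_pmf P) (-{s}) = ennreal (1 - pmf P s)"
      using measure_pmf.prob_compl[of "{s}" P] 
      by (simp add: measure_pmf.emeasure_eq_measure measure_pmf_single Compl_eq_Diff_UNIV)
    then show ?thesis unfolding Suc by (simp add: nn_integral_multc)
  qed
  also have "\<dots> = ennreal (pmf P s * (1 - pmf P s) ^ Suc n)"
    by (simp add: ennreal_mult'[symmetric] pmf_le_1 mult_ac)
  finally show ?case .
qed


definition Q :: "'a list pmf" where
  "Q = embed_pmf (\<lambda>w. (\<Prod>a\<leftarrow>w. pmf P a) * indicator {w. first_hit s w} w)"

text \<open>The total mass is the geometric series for the time of the first \<open>s\<close>;
  \<open>s_pos\<close> makes its sum equal to one.\<close>

lemma pmf_Q: "pmf Q w = (\<Prod>a\<leftarrow>w. pmf P a) * indicator {w. first_hit s w} w"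
  unfolding Q_def
proof (rule pmf_embed_pmf)
  show "0 \<le> (\<Prod>a\<leftarrow>w. pmf P a) * indicator {w. first_hit s w} w" for w
    by (auto intro!: mult_nonneg_nonneg prod_list_nonneg)
  have "(\<integral>\<^sup>+w. ennreal ((\<Prod>a\<leftarrow>w. pmf P a) * indicator {w. first_hit s w} w) \<partial>count_space UNIV)
     = (\<integral>\<^sup>+w. ennreal (\<Prod>a\<leftarrow>w. pmf P a) * indicator {w. first_hit s w} w \<partial>count_space UNIV)"
    by (intro nn_integral_cong) (auto simp: indicator_def)
  also have "\<dots> = (\<Sum>n. \<integral>\<^sup>+w. indicator {w. first_hit s w} w \<partial>replicate_pmf n P)"
    by (rule nn_integral_words)
  also have "\<dots> = (\<Sum>n. \<integral>\<^sup>+w. indicator {w. first_hit s w} w \<partial>replicate_pmf (Suc n) P)"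
    by (subst suminf_offset[of _ 1]) (auto simp: indicator_def)
  also have "\<dots> = (\<Sum>n. ennreal (pmf P s * (1 - pmf P s) ^ n))"
    unfolding nn_integral_first_hit_length ..
  also have "\<dots> = ennreal (\<Sum>n. pmf P s * (1 - pmf P s) ^ n)"
    using s_pos by (intro suminf_ennreal2) (auto simp: pmf_le_1 intro!: summable_mult summable_geometric)
  also have "(\<Sum>n. pmf P s * (1 - pmf P s) ^ n) = 1"
    using s_pos pmf_le_1[of P s] by (subst suminf_mult) (auto simp: suminf_geometric intro!: summable_geometric)
  finally show "(\<integral>\<^sup>+w. ennreal ((\<Prod>a\<leftarrow>w. pmf P a) * indicator {w. first_hit s w} w) \<partial>count_space UNIV) = 1"
    by simp
qed

lemma nn_integral_Q:
  "(\<integral>\<^sup>+w. \<phi> w \<partial>Q) = (\<Sum>n. \<integral>\<^sup>+w. indicator {w. first_hit s w} w * \<phi> w \<partial>replicate_pmf n P)"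
proof -
  have "(\<integral>\<^sup>+w. \<phi> w \<partial>Q) = (\<integral>\<^sup>+w. ennreal (\<Prod>a\<leftarrow>w. pmf P a) * (indicator {w. first_hit s w} w * \<phi> w) \<partial>count_space UNIV)"
    unfolding nn_integral_measure_pmf by (intro nn_integral_cong) (auto simp: pmf_Q indicator_def)
  then show ?thesis by (simp add: nn_integral_words)
qed

lemma AE_Q: "AE w in Q. first_hit s w"
  by (auto simp: AE_measure_pmf_iff set_pmf_iff pmf_Q indicator_def)

text \<open>Memorylessness: a cycle whose first letter is not \<open>s\<close> continues as a fresh
  cycle of law \<open>Q\<close>.\<close>

lemma nn_integral_Q_unfold:
  "(\<integral>\<^sup>+w. \<psi> w \<partial>Q) = (\<integral>\<^sup>+a. (if a = s then \<psi> [s] else \<integral>\<^sup>+y. \<psi> (a # y) \<partial>Q) \<partial>measure_pmf P)"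
proof -
  have "(\<integral>\<^sup>+w. \<psi> w \<partial>Q) = (\<Sum>n. \<integral>\<^sup>+w. indicator {w. first_hit s w} w * \<psi> w \<partial>replicate_pmf (Suc n) P)"
    unfolding nn_integral_Q by (subst suminf_offset[of _ 1]) (auto simp: indicator_def)
  also have "\<dots> = (\<Sum>n. \<integral>\<^sup>+a. \<integral>\<^sup>+w. indicator {w. first_hit s w} (a # w) * \<psi> (a # w) \<partial>replicate_pmf n P \<partial>measure_pmf P)"
    unfolding nn_integral_replicate_pmf_Suc ..
  also have "\<dots> = (\<integral>\<^sup>+a. (\<Sum>n. \<integral>\<^sup>+w. indicator {w. first_hit s w} (a # w) * \<psi> (a # w) \<partial>replicate_pmf n P) \<partial>measure_pmf P)"
    by (rule nn_integral_suminf[symmetric]) simp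
  also have "\<dots> = (\<integral>\<^sup>+a. (if a = s then \<psi> [s] else \<integral>\<^sup>+y. \<psi> (a # y) \<partial>Q) \<partial>measure_pmf P)"
  proof (intro nn_integral_cong)
    fix a
    show "(\<Sum>n. \<integral>\<^sup>+w. indicator {w. first_hit s w} (a # w) * \<psi> (a # w) \<partial>replicate_pmf n P)
       = (if a = s then \<psi> [s] else \<integral>\<^sup>+y. \<psi> (a # y) \<partial>Q)"
    proof (cases "a = s")
      case True
      have "(\<integral>\<^sup>+w. indicator {w. first_hit s w} (a # w) * \<psi> (a # w) \<partial>replicate_pmf n P) = 0" if "n \<noteq> 0" for n
      proof -
        have "(\<integral>\<^sup>+w. indicator {w. first_hit s w} (a # w) * \<psi> (a # w) \<partial>replicate_pmf n P) = (\<integral>\<^sup>+w. 0 \<partial>replicate_pmf n P)"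
          by (rule nn_integral_cong_AE, unfold AE_measure_pmf_iff) (use that in \<open>auto simp: set_replicate_pmf True indicator_def\<close>)
        then show ?thesis by simp
      qed
      then show ?thesis by (subst suminf_finite[of "{0}"]) (auto simp: True)
    next
      case False
      then show ?thesis unfolding nn_integral_Q by (auto simp: indicator_def intro!: suminf_cong nn_integral_cong)
    qed
  qed
  finally show ?thesis .
qed

definition \<Omega> :: "(nat \<Rightarrow> 'a list) measure" where
  "\<Omega> = PiM UNIV (\<lambda>_. measure_pmf Q)"

sublocale \<Omega>: sequence_space "measure_pmf Q"
  by unfold_locales

lemma prob_space_\<Omega>: "prob_space \<Omega>"
  unfolding \<Omega>_def by (rule \<Omega>.P.prob_space_axioms)

lemma component_measurable [measurable]: "(\<lambda>x. x i) \<in> measurable \<Omega> (count_space UNIV)"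
proof -
  have "(\<lambda>x. x i) \<in> measurable \<Omega> (measure_pmf Q)"
    unfolding \<Omega>_def by (rule measurable_component_singleton) simp
  then show ?thesis by (simp add: measurable_cong_sets[OF refl sets_measure_pmf_count_space])
qed

text \<open>Cycles are almost surely nonempty, so \<open>n\<close> of them contain the first
  \<open>n\<close> letters.\<close>

definition pre :: "nat \<Rightarrow> (nat \<Rightarrow> 'a list) \<Rightarrow> 'a list" where
  "pre n x = take n (concat (map x [0..<n]))"

lemma concat_measurable: "(\<lambda>x. concat (map x [0..<k])) \<in> measurable \<Omega> (count_space UNIV)"
proof (induction k)
  case (Suc k)
  have "(\<lambda>x. concat (map x [0..<k]) @ x k) \<in> measurable \<Omega> (count_space UNIV)"
    by (rule measurable_count_space_binary[OF Suc]) simp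
  then show ?case by simp
qed simp

lemma pre_measurable [measurable]: "pre n \<in> measurable \<Omega> (count_space UNIV)"
  unfolding pre_def by (rule measurable_compose[OF concat_measurable]) simp

lemma AE_\<Omega>: "AE x in \<Omega>. \<forall>i. first_hit s (x i)"
proof -
  have "AE x in \<Omega>. first_hit s (x i)" for i
  proof -
    have "AE w in distr \<Omega> (measure_pmf Q) (\<lambda>x. x i). first_hit s w"
      unfolding \<Omega>_def by (subst \<Omega>.PiM_component) (use AE_Q in simp_all)
    then show ?thesis
      by (subst (asm) AE_distr_iff) (auto simp: component_measurable measurable_cong_sets[OF refl sets_measure_pmf_count_space])
  qed
  then show ?thesis by (simp add: AE_all_countable)
qed

lemma length_concat_ge: "(\<And>i. x i \<noteq> []) \<Longrightarrow> m \<le> length (concat (map x [0..<m]))"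
proof (induction m)
  case (Suc m)
  then have "m \<le> length (concat (map x [0..<m]))" by simp
  moreover have "length (x m) \<ge> 1" using Suc.prems[of m] by (simp add: Suc_leI)
  ultimately show ?case by simp
qed simp

lemma pre_extend:
  assumes "\<And>i. x i \<noteq> []" "n \<le> m"
  shows "take n (concat (map x [0..<m])) = pre n x"
proof -
  have "[0..<m] = [0..<n] @ [n..<m]" using assms(2) upt_add_eq_append[of 0 n "m - n"] by simp
  then show ?thesis using length_concat_ge[of x n] assms by (simp add: pre_def)
qed

lemma pre_case_nat:
  assumes "c \<noteq> []" "\<And>i. x i \<noteq> []" "n \<le> Suc m"
  shows "pre n (case_nat c x) = take n (c @ concat (map x [0..<m]))"
proof -
  have *: "map (case_nat c x) [0..<Suc m] = c # map x [0..<m]"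
    by (subst upt_conv_Cons) (auto simp: map_Suc_upt[symmetric] simp del: upt_Suc)
  have "pre n (case_nat c x) = take n (concat (map (case_nat c x) [0..<Suc m]))"
    by (rule pre_extend[symmetric]) (use assms in \<open>auto split: nat.split\<close>)
  then show ?thesis unfolding * by simp
qed

lemma nn_integral_\<Omega>_case_nat:
  assumes [measurable]: "\<phi> \<in> borel_measurable \<Omega>"
  shows "(\<integral>\<^sup>+x. \<phi> x \<partial>\<Omega>) = (\<integral>\<^sup>+c. \<integral>\<^sup>+x. \<phi> (case_nat c x) \<partial>\<Omega> \<partial>Q)"
proof -
  have m: "(\<lambda>(c, x). case_nat c x) \<in> measurable (measure_pmf Q \<Otimes>\<^sub>M \<Omega>) \<Omega>"
    unfolding \<Omega>_def by measurable
  interpret O: prob_space \<Omega> by (rule prob_space_\<Omega>)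
  have "(\<integral>\<^sup>+x. \<phi> x \<partial>\<Omega>) = (\<integral>\<^sup>+x. \<phi> x \<partial>(distr (measure_pmf Q \<Otimes>\<^sub>M \<Omega>) \<Omega> (\<lambda>(c, x). case_nat c x)))"
    using \<Omega>.PiM_iter unfolding \<Omega>_def by simp
  also have "\<dots> = (\<integral>\<^sup>+z. \<phi> (case z of (c, x) \<Rightarrow> case_nat c x) \<partial>(measure_pmf Q \<Otimes>\<^sub>M \<Omega>))"
    by (rule nn_integral_distr[OF m]) simp
  also have "\<dots> = (\<integral>\<^sup>+c. \<integral>\<^sup>+x. \<phi> (case (c, x) of (c, x) \<Rightarrow> case_nat c x) \<partial>\<Omega> \<partial>Q)"
    by (rule O.nn_integral_fst[symmetric]) (rule measurable_compose[OF m], simp)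
  finally show ?thesis by simp
qed

text \<open>Concatenated i.i.d. cycles have i.i.d. letters. Removing the first letter uses up the
  first cycle, if the letter is \<open>s\<close>, or leaves a fresh cycle by
  \<open>nn_integral_Q_unfold\<close>. In both cases what remains again has the law
  \<open>\<Omega>\<close>, so the induction goes through.\<close>

lemma nn_integral_pre: "(\<integral>\<^sup>+x. \<phi> (pre n x) \<partial>\<Omega>) = (\<integral>\<^sup>+w. \<phi> w \<partial>replicate_pmf n P)"
proof (induction n arbitrary: \<phi>)
  case 0
  interpret O: prob_space \<Omega> by (rule prob_space_\<Omega>)
  show ?case by (simp add: pre_def O.emeasure_space_1)
next
  case (Suc n)
  have [measurable]: "(\<lambda>x. \<phi> (pre m x)) \<in> borel_measurable \<Omega>" for m and \<phi> :: "'a list \<Rightarrow> ennreal"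
    by (rule measurable_compose[OF pre_measurable]) simp
  have 1: "(\<integral>\<^sup>+x. \<phi> (pre (Suc n) (case_nat [s] x)) \<partial>\<Omega>) = (\<integral>\<^sup>+w. \<phi> (s # w) \<partial>replicate_pmf n P)"
  proof -
    have "(\<integral>\<^sup>+x. \<phi> (pre (Suc n) (case_nat [s] x)) \<partial>\<Omega>) = (\<integral>\<^sup>+x. \<phi> (s # pre n x) \<partial>\<Omega>)"
    proof (rule nn_integral_cong_AE, use AE_\<Omega> in eventually_elim)
      fix x :: "nat \<Rightarrow> 'a list" assume "\<forall>i. first_hit s (x i)"
      then have "x i \<noteq> []" for i by (metis first_hit.simps(1))
      then have "pre (Suc n) (case_nat [s] x) = take (Suc n) ([s] @ concat (map x [0..<n]))"
        by (intro pre_case_nat) auto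
      then show "\<phi> (pre (Suc n) (case_nat [s] x)) = \<phi> (s # pre n x)" by (simp add: pre_def)
    qed
    then show ?thesis using Suc[of "\<lambda>w. \<phi> (s # w)"] by simp
  qed
  have 2: "(\<integral>\<^sup>+y. \<integral>\<^sup>+x. \<phi> (pre (Suc n) (case_nat (a # y) x)) \<partial>\<Omega> \<partial>Q) = (\<integral>\<^sup>+w. \<phi> (a # w) \<partial>replicate_pmf n P)" for a
  proof -
    have "(\<integral>\<^sup>+y. \<integral>\<^sup>+x. \<phi> (pre (Suc n) (case_nat (a # y) x)) \<partial>\<Omega> \<partial>Q) = (\<integral>\<^sup>+y. \<integral>\<^sup>+x. \<phi> (a # pre n (case_nat y x)) \<partial>\<Omega> \<partial>Q)"
    proof (rule nn_integral_cong_AE, use AE_Q in eventually_elim)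
      fix y assume y: "first_hit s y"
      show "(\<integral>\<^sup>+x. \<phi> (pre (Suc n) (case_nat (a # y) x)) \<partial>\<Omega>) = (\<integral>\<^sup>+x. \<phi> (a # pre n (case_nat y x)) \<partial>\<Omega>)"
      proof (rule nn_integral_cong_AE, use AE_\<Omega> in eventually_elim)
        fix x :: "nat \<Rightarrow> 'a list" assume "\<forall>i. first_hit s (x i)"
        then have x: "x i \<noteq> []" for i by (metis first_hit.simps(1))
        have "pre (Suc n) (case_nat (a # y) x) = take (Suc n) ((a # y) @ concat (map x [0..<n]))"
          by (rule pre_case_nat) (use x in auto)
        moreover have "pre n (case_nat y x) = take n (y @ concat (map x [0..<n]))"
          by (rule pre_case_nat) (use x y in auto)
        ultimately show "\<phi> (pre (Suc n) (case_nat (a # y) x)) = \<phi> (a # pre n (case_nat y x))" by simp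
      qed
    qed
    \<comment> \<open>The rest of the first cycle has law \<open>Q\<close> and is independent of the
      others, so putting it back in front restores \<open>\<Omega>\<close>.\<close>
    also have "\<dots> = (\<integral>\<^sup>+x. \<phi> (a # pre n x) \<partial>\<Omega>)"
      by (rule nn_integral_\<Omega>_case_nat[symmetric]) (rule measurable_compose[OF pre_measurable], simp)
    also have "\<dots> = (\<integral>\<^sup>+w. \<phi> (a # w) \<partial>replicate_pmf n P)" by (rule Suc)
    finally show ?thesis .
  qed
  have "(\<integral>\<^sup>+x. \<phi> (pre (Suc n) x) \<partial>\<Omega>) = (\<integral>\<^sup>+c. \<integral>\<^sup>+x. \<phi> (pre (Suc n) (case_nat c x)) \<partial>\<Omega> \<partial>Q)"
    by (rule nn_integral_\<Omega>_case_nat) simp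
  also have "\<dots> = (\<integral>\<^sup>+a. \<integral>\<^sup>+w. \<phi> (a # w) \<partial>replicate_pmf n P \<partial>measure_pmf P)"
    by (subst nn_integral_Q_unfold) (intro nn_integral_cong, auto simp: 1 2)
  finally show ?case unfolding nn_integral_replicate_pmf_Suc .
qed

lemma distr_pre: "distr \<Omega> (count_space UNIV) (pre n) = measure_pmf (replicate_pmf n P)"
proof (rule measure_eqI)
  fix A assume "A \<in> sets (distr \<Omega> (count_space UNIV) (pre n))"
  have "emeasure (distr \<Omega> (count_space UNIV) (pre n)) A = (\<integral>\<^sup>+w. indicator A w \<partial>(distr \<Omega> (count_space UNIV) (pre n)))"
    by simp
  also have "\<dots> = (\<integral>\<^sup>+x. indicator A (pre n x) \<partial>\<Omega>)" by (rule nn_integral_distr) auto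
  also have "\<dots> = (\<integral>\<^sup>+w. indicator A w \<partial>replicate_pmf n P)" by (rule nn_integral_pre)
  finally show "emeasure (distr \<Omega> (count_space UNIV) (pre n)) A = emeasure (measure_pmf (replicate_pmf n P)) A" by simp
qed simp

end

section \<open>Limit theorems for functionals that are additive over cycles\<close>

lemma finite_set_replicate_pmf: "finite (set_pmf (replicate_pmf n (P :: 'a::finite pmf)))"
proof (rule finite_subset)
  show "set_pmf (replicate_pmf n P) \<subseteq> {xs. set xs \<subseteq> UNIV \<and> length xs = n}"
    by (auto simp: set_replicate_pmf)
qed (rule finite_lists_length_eq, simp)

lemma integrable_replicate_pmf [simp]:
  fixes P :: "'a::finite pmf" and f :: "'a list \<Rightarrow> real"
  shows "integrable (measure_pmf (replicate_pmf n P)) f"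
  by (rule integrable_measure_pmf_finite[OF finite_set_replicate_pmf])

lemma expectation_replicate_pmf_Suc:
  fixes P :: "'a::finite pmf" and f :: "'a list \<Rightarrow> real"
  shows "measure_pmf.expectation (replicate_pmf (Suc n) P) f
    = (\<Sum>a\<in>UNIV. pmf P a * measure_pmf.expectation (replicate_pmf n P) (\<lambda>w. f (a # w)))"
proof -
  have *: "replicate_pmf (Suc n) P = bind_pmf P (\<lambda>a. map_pmf ((#) a) (replicate_pmf n P))"
    by (simp add: map_pmf_def)
  show ?thesis
    unfolding * by (subst pmf_expectation_bind[of UNIV]) (auto simp: finite_set_replicate_pmf)
qed

text \<open>Only the order of the bound matters: the number of visits to \<open>s\<close> stays
  within about \<open>sqrt (real n)\<close> of \<open>real n * pmf P s\<close>, which is negligible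
  against \<open>n\<close>.\<close>

lemma
  fixes P :: "'a::finite pmf" and s :: 'a
  defines "N \<equiv> \<lambda>n w. real (count_list w s) - real n * pmf P s"
  shows variance_count_replicate: "measure_pmf.expectation (replicate_pmf n P) (\<lambda>w. (N n w)\<^sup>2) \<le> real n"
proof -
  define d where "d a = indicator {s} a - pmf P s" for a
  have N_Suc: "N (Suc n) (a # w) = d a + N n w" for n a w
    by (simp add: N_def d_def algebra_simps indicator_def)
  have sum1: "(\<Sum>a\<in>UNIV. pmf P a) = 1" by (rule sum_pmf_eq_1) auto
  have d0: "(\<Sum>a\<in>UNIV. pmf P a * d a) = 0"
    by (simp add: d_def right_diff_distrib sum_subtractf sum_distrib_right[symmetric] sum1 indicator_def)
  have d1: "(\<Sum>a\<in>UNIV. pmf P a * (d a)\<^sup>2) \<le> 1"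
  proof -
    have "\<bar>d a\<bar> \<le> 1" for a by (auto simp: d_def indicator_def pmf_le_1)
    then have "(d a)\<^sup>2 \<le> 1" for a by (simp add: abs_square_le_1)
    then have "(\<Sum>a\<in>UNIV. pmf P a * (d a)\<^sup>2) \<le> (\<Sum>a\<in>UNIV. pmf P a * 1)"
      by (intro sum_mono mult_left_mono) auto
    then show ?thesis by (simp add: sum1)
  qed
  have 1: "measure_pmf.expectation (replicate_pmf n P) (N n) = 0" for n
  proof (induction n)
    case (Suc n)
    have "measure_pmf.expectation (replicate_pmf (Suc n) P) (N (Suc n))
        = (\<Sum>a\<in>UNIV. pmf P a * (d a + measure_pmf.expectation (replicate_pmf n P) (N n)))"
      unfolding expectation_replicate_pmf_Suc N_Suc by simp
    then show ?case by (simp add: Suc d0)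
  qed (simp add: N_def)
  have 2: "measure_pmf.expectation (replicate_pmf n P) (\<lambda>w. (N n w)\<^sup>2) \<le> real n" for n
  proof (induction n)
    case (Suc n)
    have "measure_pmf.expectation (replicate_pmf (Suc n) P) (\<lambda>w. (N (Suc n) w)\<^sup>2)
        = (\<Sum>a\<in>UNIV. pmf P a * ((d a)\<^sup>2 + 2 * d a * measure_pmf.expectation (replicate_pmf n P) (N n)
             + measure_pmf.expectation (replicate_pmf n P) (\<lambda>w. (N n w)\<^sup>2)))"
      unfolding expectation_replicate_pmf_Suc N_Suc by (simp add: power2_sum algebra_simps)
    also have "\<dots> = (\<Sum>a\<in>UNIV. pmf P a * (d a)\<^sup>2) + measure_pmf.expectation (replicate_pmf n P) (\<lambda>w. (N n w)\<^sup>2)"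
      by (simp add: 1 distrib_left sum.distrib sum_distrib_right[symmetric] sum1)
    also have "\<dots> \<le> real (Suc n)" using Suc d1 by simp
    finally show ?case .
  qed (simp add: N_def)
  show "measure_pmf.expectation (replicate_pmf n P) (\<lambda>w. (N n w)\<^sup>2) \<le> real n" by (rule 2)
qed

definition visit_time :: "(nat \<Rightarrow> 'a list) \<Rightarrow> nat \<Rightarrow> nat" where
  "visit_time x j = (\<Sum>i<j. length (x i))"

lemma visit_time_0 [simp]: "visit_time x 0 = 0"
  by (simp add: visit_time_def)

lemma visit_time_Suc: "visit_time x (Suc j) = visit_time x j + length (x j)"
  by (simp add: visit_time_def)

lemma visit_time_Suc_shift: "visit_time x (Suc j) = length (x 0) + visit_time (\<lambda>i. x (Suc i)) j"
  unfolding visit_time_def by (rule sum.lessThan_Suc_shift)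

lemma visit_time_mono: "i \<le> j \<Longrightarrow> visit_time x i \<le> visit_time x j"
  by (induction j rule: dec_induct) (auto simp: visit_time_Suc)

lemma visit_time_ge:
  assumes "\<And>i. x i \<noteq> []" shows "j \<le> visit_time x j"
proof (induction j)
  case (Suc j)
  have "length (x j) \<ge> 1" using assms[of j] by (simp add: Suc_leI)
  with Suc show ?case by (simp add: visit_time_Suc)
qed simp

text \<open>Stated for every additive \<open>G\<close>, because it is applied to \<open>H\<close>
  and also to the number of occurrences of \<open>s\<close>. The induction removes the first cycle,
  and \<open>resid\<close> is blind to a removed complete cycle.\<close>

lemma completed_cycles_sum:
  fixes G :: "'a list \<Rightarrow> real"
  assumes add: "\<And>c u. first_hit s c \<Longrightarrow> G (c @ u) = G c + G u"
    and x: "\<And>i. first_hit s (x i)"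
  shows "(let u = take n (concat (map x [0..<k])) in G u - G (resid s u))
    = (\<Sum>j<k. if visit_time x (Suc j) \<le> n then G (x j) else 0)"
  using x
proof (induction k arbitrary: x n)
  case 0
  then show ?case by simp
next
  case (Suc k)
  have "map x [0..<Suc k] = x 0 # map (\<lambda>i. x (Suc i)) [0..<k]"
    by (subst upt_conv_Cons) (auto simp: map_Suc_upt[symmetric] simp del: upt_Suc)
  then have c: "concat (map x [0..<Suc k]) = x 0 @ concat (map (\<lambda>i. x (Suc i)) [0..<k])"
    by simp
  show ?case
  proof (cases "length (x 0) \<le> n")
    case False
    \<comment> \<open>The prefix ends inside the first cycle, hence contains no \<open>s\<close> and
      is its own residue; no cycle is complete, so both sides vanish.\<close>
    obtain v where v: "x 0 = v @ [s]" "s \<notin> set v" using Suc.prems[of 0] by (rule first_hitE)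
    have "take n (concat (map x [0..<Suc k])) = take n v" unfolding c using False by (simp add: v)
    moreover have "s \<notin> set (take n v)" using v(2) by (auto dest: in_set_takeD)
    moreover have "\<not> visit_time x (Suc j) \<le> n" for j
      using False visit_time_mono[of 1 "Suc j" x] by (simp add: visit_time_def)
    ultimately show ?thesis by (simp add: resid_id)
  next
    case True
    define y where "y = (\<lambda>i. x (Suc i))"
    define u where "u = take (n - length (x 0)) (concat (map y [0..<k]))"
    have u: "take n (concat (map x [0..<Suc k])) = x 0 @ u" unfolding c y_def u_def using True by simp
    have IH: "G u - G (resid s u) = (\<Sum>j<k. if visit_time y (Suc j) \<le> n - length (x 0) then G (y j) else 0)"
      using Suc.IH[of y "n - length (x 0)"] Suc.prems unfolding u_def y_def by (simp add: Let_def)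
    have "(\<Sum>j<Suc k. if visit_time x (Suc j) \<le> n then G (x j) else 0)
        = G (x 0) + (\<Sum>j<k. if visit_time x (Suc (Suc j)) \<le> n then G (x (Suc j)) else 0)"
      unfolding sum.lessThan_Suc_shift using True by (simp add: visit_time_Suc)
    also have "(\<Sum>j<k. if visit_time x (Suc (Suc j)) \<le> n then G (x (Suc j)) else 0)
       = (\<Sum>j<k. if visit_time y (Suc j) \<le> n - length (x 0) then G (y j) else 0)"
      using True unfolding visit_time_Suc_shift[of x] y_def by (intro sum.cong) auto
    finally show ?thesis
      unfolding u Let_def resid_append_first_hit[OF Suc.prems] add[OF Suc.prems] IH[symmetric] by simp
  qed
qed

lemma (in letter_renewal) pre_completed_cycles_sum:
  fixes G :: "'a list \<Rightarrow> real"
  assumes "\<And>c u. first_hit s c \<Longrightarrow> G (c @ u) = G c + G u" "\<And>i. first_hit s (x i)"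
  shows "G (pre n x) - G (resid s (pre n x)) = (\<Sum>j<n. if visit_time x (Suc j) \<le> n then G (x j) else 0)"
  using completed_cycles_sum[of s G x n n, OF assms] unfolding pre_def Let_def .

text \<open>The words that occur here are those that avoid \<open>s\<close>, up to their last letter: complete cycles
  as well as unfinished ones, the latter possibly extended by one letter.\<close>
definition (in letter_renewal) moment :: "('a list \<Rightarrow> real) \<Rightarrow> ennreal" where
  "moment f = (\<Sum>n. \<integral>\<^sup>+w. indicator {w. s \<notin> set (butlast w)} w * ennreal ((f w)\<^sup>2) \<partial>replicate_pmf n P)"

lemma (in letter_renewal)
  fixes f :: "'a list \<Rightarrow> real"
  assumes "moment f < \<top>"
  shows square_integrable_Q_of_moment: "integrable (measure_pmf Q) (\<lambda>w. (f w)\<^sup>2)"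
    and integrable_Q_of_moment: "integrable (measure_pmf Q) f"
proof -
  have "(\<integral>\<^sup>+w. ennreal ((f w)\<^sup>2) \<partial>Q) \<le> moment f"
    unfolding nn_integral_Q moment_def by (intro suminf_le nn_integral_mono) (auto simp: indicator_def elim: first_hitE)
  also have "\<dots> < \<infinity>" using assms by simp
  finally show sq: "integrable (measure_pmf Q) (\<lambda>w. (f w)\<^sup>2)" by (intro integrableI_bounded) auto
  show "integrable (measure_pmf Q) f" by (rule measure_pmf.square_integrable_imp_integrable[OF _ sq]) simp
qed

text \<open>The intended \<open>H\<close> is the logarithmic growth of the restarted vector minus a
  drift proportional to the length; the drift is chosen to make the mean over a cycle zero.
  Additivity is asked for only when the left factor is a complete cycle.\<close>

locale additive_functional = letter_renewal P s
  for P :: "'a::finite pmf" and s :: 'a +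
  fixes H :: "'a list \<Rightarrow> real"
  assumes H_add: "\<And>c u. first_hit s c \<Longrightarrow> H (c @ u) = H c + H u"
    and H_moment: "moment H < \<top>"
    and H_mean: "measure_pmf.expectation Q H = 0"
begin

definition K :: real where
  "K = enn2real (moment H)"

lemma ennreal_K: "ennreal K = moment H"
  unfolding K_def using H_moment by (simp add: less_top)

lemma K_nonneg: "0 \<le> K" by (simp add: K_def)

lemma integrable_H2: "integrable (measure_pmf Q) (\<lambda>w. (H w)\<^sup>2)"
  and integrable_H: "integrable (measure_pmf Q) H"
  by (rule square_integrable_Q_of_moment[OF H_moment], rule integrable_Q_of_moment[OF H_moment])

definition v :: real where "v = measure_pmf.expectation Q (\<lambda>w. (H w)\<^sup>2)"

lemma v_nonneg: "0 \<le> v" by (simp add: v_def)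

lemma nn_integral_resid: "(\<integral>\<^sup>+w. ennreal ((H (resid s w))\<^sup>2) \<partial>replicate_pmf n P) \<le> ennreal K"
proof -
  have "(\<integral>\<^sup>+w. ennreal ((H (resid s w))\<^sup>2) \<partial>replicate_pmf n P)
     \<le> (\<Sum>k\<le>n. \<integral>\<^sup>+w. ennreal ((H w)\<^sup>2) * indicator {w. s \<notin> set w} w \<partial>replicate_pmf k P)"
    by (rule nn_integral_resid_le)
  also have "\<dots> \<le> (\<Sum>k\<le>n. \<integral>\<^sup>+w. indicator {w. s \<notin> set (butlast w)} w * ennreal ((H w)\<^sup>2) \<partial>replicate_pmf k P)"
    by (intro sum_mono nn_integral_mono) (auto simp: indicator_def dest: in_set_butlastD)
  also have "\<dots> \<le> ennreal K"
    unfolding ennreal_K moment_def by (rule sum_le_suminf) auto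
  finally show ?thesis .
qed

lemma nn_integral_resid_snoc:
  "(\<integral>\<^sup>+w. \<integral>\<^sup>+a. ennreal ((H (resid s w @ [a]))\<^sup>2) \<partial>measure_pmf P \<partial>replicate_pmf n P) \<le> ennreal K"
proof -
  let ?f = "\<lambda>n. \<integral>\<^sup>+w. indicator {w. s \<notin> set (butlast w)} w * ennreal ((H w)\<^sup>2) \<partial>replicate_pmf n P"
  have "(\<integral>\<^sup>+w. \<integral>\<^sup>+a. ennreal ((H (resid s w @ [a]))\<^sup>2) \<partial>measure_pmf P \<partial>replicate_pmf n P)
     \<le> (\<Sum>k\<le>n. \<integral>\<^sup>+w. (\<integral>\<^sup>+a. ennreal ((H (w @ [a]))\<^sup>2) \<partial>measure_pmf P) * indicator {w. s \<notin> set w} w \<partial>replicate_pmf k P)"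
    by (rule nn_integral_resid_le)
  also have "\<dots> = (\<Sum>k\<le>n. ?f (Suc k))"
    unfolding nn_integral_replicate_pmf_snoc
    by (intro sum.cong refl nn_integral_cong, subst nn_integral_multc[symmetric], simp, intro nn_integral_cong)
       (auto simp: indicator_def)
  also have "\<dots> \<le> ?f 0 + (\<Sum>k\<le>n. ?f (Suc k))" by simp
  also have "\<dots> = (\<Sum>k\<le>Suc n. ?f k)" by (rule sum.atMost_Suc_shift[symmetric])
  also have "\<dots> \<le> ennreal K"
    unfolding ennreal_K moment_def by (rule sum_le_suminf) auto
  finally show ?thesis .
qed

text \<open>Everything up to the last \<open>s\<close> contributes a summand that does not see the
  continuation. Hence the increment caused by one more letter is a function of the unfinished cycle
  and that letter.\<close>

lemma H_split: "\<exists>h. \<forall>u. H (w @ u) = h + H (resid s w @ u)"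
proof (induction w rule: rev_induct)
  case Nil
  show ?case by (rule exI[of _ 0]) simp
next
  case (snoc a w)
  then obtain h where h: "\<And>u. H (w @ u) = h + H (resid s w @ u)" by blast
  show ?case
  proof (cases "a = s")
    case False
    have "H ((w @ [a]) @ u) = h + H (resid s (w @ [a]) @ u)" for u
      using h[of "a # u"] False by (simp add: resid_snoc)
    then show ?thesis by blast
  next
    case True
    have fh: "first_hit s (resid s w @ [s])" by (rule first_hit_snoc[OF notin_resid])
    have "H ((w @ [a]) @ u) = h + H (resid s w @ [s]) + H (resid s (w @ [a]) @ u)" for u
      using h[of "s # u"] H_add[OF fh, of u] by (simp add: True resid_snoc)
    then show ?thesis by blast
  qed
qed

lemma H_incr: "H (w @ [a]) - H w = H (resid s w @ [a]) - H (resid s w)"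
proof -
  obtain h where h: "\<And>u. H (w @ u) = h + H (resid s w @ u)" using H_split by blast
  have "H (w @ [a]) = h + H (resid s w @ [a])" by (rule h)
  moreover have "H w = h + H (resid s w)" using h[of "[]"] by (simp only: append_Nil2)
  ultimately show ?thesis by simp
qed

lemma second_moment_incr:
  "(\<integral>\<^sup>+w. ennreal ((H w - H (butlast w))\<^sup>2) \<partial>replicate_pmf (Suc n) P) \<le> ennreal (4 * K)"
proof -
  have "(\<integral>\<^sup>+w. ennreal ((H w - H (butlast w))\<^sup>2) \<partial>replicate_pmf (Suc n) P)
     = (\<integral>\<^sup>+w. \<integral>\<^sup>+a. ennreal ((H (resid s w @ [a]) - H (resid s w))\<^sup>2) \<partial>measure_pmf P \<partial>replicate_pmf n P)"
    unfolding nn_integral_replicate_pmf_snoc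
    by (intro nn_integral_cong, unfold butlast_snoc, subst H_incr, rule refl)
  also have "\<dots> \<le> (\<integral>\<^sup>+w. \<integral>\<^sup>+a. 2 * ennreal ((H (resid s w @ [a]))\<^sup>2) + 2 * ennreal ((H (resid s w))\<^sup>2) \<partial>measure_pmf P \<partial>replicate_pmf n P)"
  proof (intro nn_integral_mono)
    fix w a
    have "(H (resid s w @ [a]) - H (resid s w))\<^sup>2 \<le> 2 * (H (resid s w @ [a]))\<^sup>2 + 2 * (H (resid s w))\<^sup>2"
      using sum_squares_bound[of "H (resid s w @ [a])" "- H (resid s w)"] by (simp add: power2_diff)
    then have "ennreal ((H (resid s w @ [a]) - H (resid s w))\<^sup>2) \<le> ennreal (2 * (H (resid s w @ [a]))\<^sup>2 + 2 * (H (resid s w))\<^sup>2)"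
      by (rule ennreal_leI)
    then show "ennreal ((H (resid s w @ [a]) - H (resid s w))\<^sup>2) \<le> 2 * ennreal ((H (resid s w @ [a]))\<^sup>2) + 2 * ennreal ((H (resid s w))\<^sup>2)"
      by (simp add: ennreal_mult)
  qed
  also have "\<dots> = 2 * (\<integral>\<^sup>+w. \<integral>\<^sup>+a. ennreal ((H (resid s w @ [a]))\<^sup>2) \<partial>measure_pmf P \<partial>replicate_pmf n P)
      + 2 * (\<integral>\<^sup>+w. ennreal ((H (resid s w))\<^sup>2) \<partial>replicate_pmf n P)"
    by (simp add: nn_integral_add nn_integral_cmult)
  also have "\<dots> \<le> 2 * ennreal K + 2 * ennreal K"
    by (intro add_mono mult_left_mono nn_integral_resid nn_integral_resid_snoc) auto
  also have "\<dots> = ennreal (4 * K)"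
    using K_nonneg by (simp add: ennreal_mult distrib_right[symmetric])
  finally show ?thesis .
qed

interpretation O: prob_space \<Omega> by (rule prob_space_\<Omega>)

lemma space_\<Omega> [simp]: "space \<Omega> = UNIV"
  by (simp add: \<Omega>_def space_PiM)

lemma indep_components: "O.indep_vars (\<lambda>_. measure_pmf Q) (\<lambda>i x. x i) UNIV"
proof (subst O.indep_vars_iff_distr_eq_PiM)
  show "(UNIV :: nat set) \<noteq> {}" by simp
  show "(\<lambda>x. x i) \<in> measurable \<Omega> (measure_pmf Q)" for i
    unfolding \<Omega>_def by (rule measurable_component_singleton) simp
  have "distr \<Omega> (measure_pmf Q) (\<lambda>x. x i) = measure_pmf Q" for i
    unfolding \<Omega>_def by (rule \<Omega>.PiM_component) simp
  then show "distr \<Omega> (PiM UNIV (\<lambda>i. measure_pmf Q)) (\<lambda>x. \<lambda>i\<in>UNIV. x i) = PiM UNIV (\<lambda>i. distr \<Omega> (measure_pmf Q) (\<lambda>x. x i))"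
    unfolding \<Omega>_def by (simp add: restrict_UNIV distr_id2)
qed

lemma distr_component: "distr \<Omega> (measure_pmf Q) (\<lambda>x. x i) = measure_pmf Q"
  unfolding \<Omega>_def by (rule \<Omega>.PiM_component) simp

lemma comp_meas [measurable]: "(\<lambda>x. x i) \<in> measurable \<Omega> (measure_pmf Q)"
  unfolding \<Omega>_def by (rule measurable_component_singleton) simp

lemma H_comp_meas [measurable]: "(\<lambda>x. H (x i)) \<in> borel_measurable \<Omega>"
  by (rule measurable_compose[OF comp_meas]) simp

lemma fun_pre_meas: "(\<lambda>x. g (pre n x)) \<in> borel_measurable \<Omega>" for g :: "'a list \<Rightarrow> 'b::topological_space"
  by (rule measurable_compose[OF pre_measurable]) simp

lemma
  fixes g :: "'a list \<Rightarrow> real"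
  shows integral_component: "(\<integral>x. g (x i) \<partial>\<Omega>) = measure_pmf.expectation Q g"
    and integrable_component: "integrable \<Omega> (\<lambda>x. g (x i)) \<longleftrightarrow> integrable (measure_pmf Q) g"
    and integral_prefix: "(\<integral>x. g (pre n x) \<partial>\<Omega>) = measure_pmf.expectation (replicate_pmf n P) g"
    and integrable_prefix: "integrable \<Omega> (\<lambda>x. g (pre n x))"
proof -
  show "(\<integral>x. g (x i) \<partial>\<Omega>) = measure_pmf.expectation Q g"
    using integral_distr[OF comp_meas[of i], of g] by (simp add: distr_component)
  show "integrable \<Omega> (\<lambda>x. g (x i)) \<longleftrightarrow> integrable (measure_pmf Q) g"
    using integrable_distr_eq[OF comp_meas[of i], of g] by (simp add: distr_component)
  show "(\<integral>x. g (pre n x) \<partial>\<Omega>) = measure_pmf.expectation (replicate_pmf n P) g"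
    using integral_distr[OF pre_measurable, of g n] by (simp add: distr_pre)
  have "integrable (distr \<Omega> (count_space UNIV) (pre n)) g" unfolding distr_pre by simp
  then show "integrable \<Omega> (\<lambda>x. g (pre n x))"
    by (subst (asm) integrable_distr_eq) auto
qed

lemma
  assumes f [measurable]: "f \<in> borel_measurable \<Omega>" and dep: "\<And>x y. (\<And>i. i < j \<Longrightarrow> x i = y i) \<Longrightarrow> f x = f y"
    and int: "integrable \<Omega> f" and g: "integrable (measure_pmf Q) g"
  shows integral_past_mult: "(\<integral>x. f x * g (x j) \<partial>\<Omega>) = (\<integral>x. f x \<partial>\<Omega>) * measure_pmf.expectation Q (g :: 'a list \<Rightarrow> real)"
    and integrable_past_mult: "integrable \<Omega> (\<lambda>x. f x * g (x j))"
proof -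
  let ?M = "\<lambda>_::nat. measure_pmf Q"
  have "O.indep_var (PiM {..<j} ?M) (\<lambda>x. restrict (\<lambda>i. x i) {..<j}) (PiM {j} ?M) (\<lambda>x. restrict (\<lambda>i. x i) {j})"
    by (rule O.indep_var_restrict[OF indep_components]) auto
  \<comment> \<open>The function \<open>f\<close> is recovered from the first \<open>j\<close>
    cycles by filling the unseen coordinates with \<open>[]\<close>; \<open>dep\<close> guarantees
    that the value does not change.\<close>
  moreover have "(\<lambda>y. f (\<lambda>i. if i < j then y i else [])) \<in> borel_measurable (PiM {..<j} ?M)"
  proof (rule measurable_compose[OF _ f])
    have "(\<lambda>y i. if i < j then y i else []) \<in> measurable (PiM {..<j} ?M) (PiM UNIV ?M)"
    proof (rule measurable_PiM_single')
      show "(\<lambda>y. if i < j then y i else []) \<in> measurable (PiM {..<j} ?M) (measure_pmf Q)" for i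
      proof (cases "i < j")
        case True
        then show ?thesis using measurable_component_singleton[of i "{..<j}" ?M] by (simp only: if_True lessThan_iff)
      qed simp
    qed (simp add: space_PiM)
    then show "(\<lambda>y i. if i < j then y i else []) \<in> measurable (PiM {..<j} ?M) \<Omega>"
      unfolding \<Omega>_def .
  qed
  moreover have "(\<lambda>y. g (y j)) \<in> borel_measurable (PiM {j} ?M)"
  proof (rule measurable_compose[where N="measure_pmf Q"])
    show "(\<lambda>y. y j) \<in> measurable (PiM {j} ?M) (measure_pmf Q)" by (rule measurable_component_singleton) simp
  qed simp
  ultimately have "O.indep_var borel ((\<lambda>y. f (\<lambda>i. if i < j then y i else [])) \<circ> (\<lambda>x. restrict (\<lambda>i. x i) {..<j}))
      borel ((\<lambda>y. g (y j)) \<circ> (\<lambda>x. restrict (\<lambda>i. x i) {j}))"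
    by (rule O.indep_var_compose)
  moreover have "(\<lambda>y. f (\<lambda>i. if i < j then y i else [])) \<circ> (\<lambda>x. restrict (\<lambda>i. x i) {..<j}) = f"
    by (auto simp: fun_eq_iff intro!: dep)
  moreover have "(\<lambda>y. g (y j)) \<circ> (\<lambda>x. restrict (\<lambda>i. x i) {j}) = (\<lambda>x. g (x j))"
    by (auto simp: fun_eq_iff)
  ultimately have ind: "O.indep_var borel f borel (\<lambda>x. g (x j))" by simp
  have g': "integrable \<Omega> (\<lambda>x. g (x j))" using g by (simp add: integrable_component)
  show "(\<integral>x. f x * g (x j) \<partial>\<Omega>) = (\<integral>x. f x \<partial>\<Omega>) * measure_pmf.expectation Q g"
    using O.indep_var_lebesgue_integral[OF ind int g'] by (simp add: integral_component)
  show "integrable \<Omega> (\<lambda>x. f x * g (x j))" by (rule O.indep_var_integrable[OF ind int g'])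
qed

text \<open>Wald's second identity: a cycle is independent of the past, so the mixed terms vanish.\<close>
lemma
  fixes \<epsilon> :: "nat \<Rightarrow> (nat \<Rightarrow> 'a list) \<Rightarrow> real"
  assumes e [measurable]: "\<And>j. \<epsilon> j \<in> borel_measurable \<Omega>"
    and dep: "\<And>j x y. (\<And>i. i < j \<Longrightarrow> x i = y i) \<Longrightarrow> \<epsilon> j x = \<epsilon> j y"
    and bd: "\<And>j x. \<bar>\<epsilon> j x\<bar> \<le> 1"
  shows integrable_wald: "integrable \<Omega> (\<lambda>x. (\<Sum>j<k. \<epsilon> j x * H (x j))\<^sup>2)"
    and integral_wald: "(\<integral>x. (\<Sum>j<k. \<epsilon> j x * H (x j))\<^sup>2 \<partial>\<Omega>) = v * (\<integral>x. (\<Sum>j<k. (\<epsilon> j x)\<^sup>2) \<partial>\<Omega>)"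
proof -
  have bd2: "(\<epsilon> j x)\<^sup>2 \<le> 1" for j x using bd[of j x] by (simp add: abs_square_le_1)
  have ie2: "integrable \<Omega> (\<lambda>x. (\<epsilon> j x)\<^sup>2)" for j
    by (rule O.integrable_const_bound[where B=1]) (auto simp: bd2)
  have "integrable \<Omega> (\<lambda>x. (\<Sum>j<k. \<epsilon> j x * H (x j))\<^sup>2) \<and>
    (\<integral>x. (\<Sum>j<k. \<epsilon> j x * H (x j))\<^sup>2 \<partial>\<Omega>) = v * (\<integral>x. (\<Sum>j<k. (\<epsilon> j x)\<^sup>2) \<partial>\<Omega>)" for k
  proof (induction k)
    case 0
    then show ?case by simp
  next
    case (Suc k)
    define D where "D x = (\<Sum>j<k. \<epsilon> j x * H (x j))" for x
    have Dm [measurable]: "D \<in> borel_measurable \<Omega>" unfolding D_def by measurable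
    have D2: "integrable \<Omega> (\<lambda>x. (D x)\<^sup>2)" using Suc by (simp add: D_def)
    have D1: "integrable \<Omega> D" by (rule O.square_integrable_imp_integrable[OF Dm D2])
    have De: "integrable \<Omega> (\<lambda>x. D x * \<epsilon> k x)"
      by (rule Bochner_Integration.integrable_bound[OF D1])
         (auto simp: abs_mult intro!: AE_I2 mult_left_le bd)
    have Ddep: "D x * \<epsilon> k x = D y * \<epsilon> k y" if "\<And>i. i < k \<Longrightarrow> x i = y i" for x y
    proof -
      have "D x = D y" unfolding D_def
      proof (rule sum.cong[OF refl])
        fix j assume j: "j \<in> {..<k}"
        have "\<epsilon> j x = \<epsilon> j y" by (rule dep) (use j that in auto)
        then show "\<epsilon> j x * H (x j) = \<epsilon> j y * H (y j)" using j that by simp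
      qed
      moreover have "\<epsilon> k x = \<epsilon> k y" by (rule dep) (use that in auto)
      ultimately show ?thesis by simp
    qed
    have i1: "integrable \<Omega> (\<lambda>x. (D x * \<epsilon> k x) * H (x k))"
      by (rule integrable_past_mult[OF _ Ddep De integrable_H]) auto
    have e1: "(\<integral>x. (D x * \<epsilon> k x) * H (x k) \<partial>\<Omega>) = 0"
      by (subst integral_past_mult[OF _ Ddep De integrable_H]) (auto simp: H_mean)
    have edep: "(\<epsilon> k x)\<^sup>2 = (\<epsilon> k y)\<^sup>2" if "\<And>i. i < k \<Longrightarrow> x i = y i" for x y
      using dep[of k x y] that by simp
    have i2: "integrable \<Omega> (\<lambda>x. (\<epsilon> k x)\<^sup>2 * (H (x k))\<^sup>2)"
      by (rule integrable_past_mult[OF _ edep ie2 integrable_H2]) auto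
    have e2: "(\<integral>x. (\<epsilon> k x)\<^sup>2 * (H (x k))\<^sup>2 \<partial>\<Omega>) = (\<integral>x. (\<epsilon> k x)\<^sup>2 \<partial>\<Omega>) * v"
      unfolding v_def by (subst integral_past_mult[OF _ edep ie2 integrable_H2]) auto
    have eq: "(\<Sum>j<Suc k. \<epsilon> j x * H (x j))\<^sup>2 = (D x)\<^sup>2 + 2 * ((D x * \<epsilon> k x) * H (x k)) + (\<epsilon> k x)\<^sup>2 * (H (x k))\<^sup>2" for x
      by (simp add: D_def power2_sum power_mult_distrib)
    show ?case
    proof
      show "integrable \<Omega> (\<lambda>x. (\<Sum>j<Suc k. \<epsilon> j x * H (x j))\<^sup>2)"
        unfolding eq by (intro Bochner_Integration.integrable_add D2 i1 i2 integrable_mult_right)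
      have "(\<integral>x. (\<Sum>j<Suc k. \<epsilon> j x * H (x j))\<^sup>2 \<partial>\<Omega>)
          = (\<integral>x. (D x)\<^sup>2 \<partial>\<Omega>) + 2 * (\<integral>x. (D x * \<epsilon> k x) * H (x k) \<partial>\<Omega>) + (\<integral>x. (\<epsilon> k x)\<^sup>2 * (H (x k))\<^sup>2 \<partial>\<Omega>)"
        unfolding eq
        by (simp only: Bochner_Integration.integral_add Bochner_Integration.integrable_add D2 i1 i2 integrable_mult_right integral_mult_right_zero)
      also have "\<dots> = v * (\<integral>x. (\<Sum>j<k. (\<epsilon> j x)\<^sup>2) \<partial>\<Omega>) + v * (\<integral>x. (\<epsilon> k x)\<^sup>2 \<partial>\<Omega>)"
        using Suc e1 e2 by (simp add: D_def)
      also have "\<dots> = v * (\<integral>x. (\<Sum>j<Suc k. (\<epsilon> j x)\<^sup>2) \<partial>\<Omega>)"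
        using ie2 by (simp add: algebra_simps)
      finally show "(\<integral>x. (\<Sum>j<Suc k. \<epsilon> j x * H (x j))\<^sup>2 \<partial>\<Omega>) = v * (\<integral>x. (\<Sum>j<Suc k. (\<epsilon> j x)\<^sup>2) \<partial>\<Omega>)" .
    qed
  qed
  then show "integrable \<Omega> (\<lambda>x. (\<Sum>j<k. \<epsilon> j x * H (x j))\<^sup>2)"
    "(\<integral>x. (\<Sum>j<k. \<epsilon> j x * H (x j))\<^sup>2 \<partial>\<Omega>) = v * (\<integral>x. (\<Sum>j<k. (\<epsilon> j x)\<^sup>2) \<partial>\<Omega>)" by blast+
qed

end

section \<open>Random versus deterministic number of cycles\<close>

lemma square_add3_le:
  fixes a b c :: real
  shows "(a + b + c)\<^sup>2 \<le> 3 * (a\<^sup>2 + b\<^sup>2 + c\<^sup>2)"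
proof -
  have "3 * (a\<^sup>2 + b\<^sup>2 + c\<^sup>2) - (a + b + c)\<^sup>2 = (a - b)\<^sup>2 + (b - c)\<^sup>2 + (a - c)\<^sup>2"
    by (simp add: power2_eq_square algebra_simps)
  also have "\<dots> \<ge> 0" by simp
  finally show ?thesis by linarith
qed

context additive_functional
begin

interpretation O: prob_space \<Omega> by (rule prob_space_\<Omega>)

lemma measure_\<Omega>_UNIV [simp]: "measure \<Omega> UNIV = 1"
  using O.prob_space by simp

text \<open>Whether cycle \<open>j\<close> has begun by time \<open>n\<close> is decided by the
  cycles before it, as Wald's identity demands. The index stops at \<open>n\<close> because nonempty
  cycles give \<open>visit_time x (Suc n) > n\<close>.\<close>

definition started :: "nat \<Rightarrow> (nat \<Rightarrow> 'a list) \<Rightarrow> real" where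
  "started n x = (\<Sum>j<Suc n. if visit_time x j \<le> n then H (x j) else 0)"

text \<open>The full value of the cycle in progress at time \<open>n\<close>, including its letters
  beyond \<open>n\<close>; exactly one index contributes when all cycles are nonempty.\<close>

definition current :: "nat \<Rightarrow> (nat \<Rightarrow> 'a list) \<Rightarrow> real" where
  "current n x = (\<Sum>j<Suc n. if visit_time x j \<le> n \<and> n < visit_time x (Suc j) then H (x j) else 0)"

lemma visit_time_meas [measurable]: "(\<lambda>x. visit_time x j) \<in> measurable \<Omega> (count_space UNIV)"
proof (induction j)
  case (Suc j)
  show ?case
    unfolding visit_time_Suc
    by (rule measurable_count_space_binary[OF Suc]) (rule measurable_compose[OF component_measurable], simp)
qed simp

lemma current_meas [measurable]: "current n \<in> borel_measurable \<Omega>"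
  unfolding current_def by measurable

lemma H_pre_meas [measurable]: "(\<lambda>x. H (pre n x)) \<in> borel_measurable \<Omega>"
  and H_resid_meas [measurable]: "(\<lambda>x. H (resid s (pre n x))) \<in> borel_measurable \<Omega>"
  by (rule fun_pre_meas)+

lemma H_pre_eq:
  assumes x: "\<And>i. first_hit s (x i)"
  shows "H (pre n x) = started n x - current n x + H (resid s (pre n x))"
proof -
  have "x i \<noteq> []" for i using x[of i] by auto
  \<comment> \<open>So the term \<open>j = n\<close> of the completed cycles is zero, and the range
    shrinks to the one in \<open>pre_completed_cycles_sum\<close>.\<close>
  then have "Suc n \<le> visit_time x (Suc n)" by (rule visit_time_ge)
  then have gt: "\<not> visit_time x (Suc n) \<le> n" by simp
  have "started n x - current n x = (\<Sum>j<Suc n. if visit_time x (Suc j) \<le> n then H (x j) else 0)"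
    unfolding started_def current_def sum_subtractf[symmetric]
    using visit_time_mono[of _ "Suc _" x] by (intro sum.cong) (auto simp: visit_time_Suc)
  also have "\<dots> = (\<Sum>j<n. if visit_time x (Suc j) \<le> n then H (x j) else 0)"
    using gt by simp
  also have "\<dots> = H (pre n x) - H (resid s (pre n x))"
    by (rule pre_completed_cycles_sum[symmetric]) (use H_add x in auto)
  finally show ?thesis by simp
qed

text \<open>The cycle in progress is biased towards long cycles, so its law is not \<open>Q\<close>.
  Replacing the large values by a sum over all \<open>Suc n\<close> candidates avoids its law: each
  candidate does have the law \<open>Q\<close>.\<close>

lemma current_bound:
  assumes "0 \<le> c"
  shows "(current n x)\<^sup>2 \<le> c\<^sup>2 + (\<Sum>j<Suc n. (H (x j))\<^sup>2 * indicator {w. \<bar>H w\<bar> > c} (x j))"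
proof (cases "\<exists>j<Suc n. visit_time x j \<le> n \<and> n < visit_time x (Suc j)")
  case False
  then have "current n x = 0" unfolding current_def by (intro sum.neutral) auto
  then show ?thesis by (simp add: sum_nonneg)
next
  case True
  then obtain k where k: "k < Suc n" "visit_time x k \<le> n" "n < visit_time x (Suc k)" by blast
  have uniq: "j = k" if "visit_time x j \<le> n" "n < visit_time x (Suc j)" for j
  proof (rule ccontr)
    assume "j \<noteq> k"
    then consider "Suc j \<le> k" | "Suc k \<le> j" by linarith
    then show False using visit_time_mono[of "Suc j" k x] visit_time_mono[of "Suc k" j x] that k by cases auto
  qed
  have "current n x = (\<Sum>j<Suc n. if j = k then H (x j) else 0)"
    unfolding current_def
  proof (rule sum.cong[OF refl])
    fix j
    show "(if visit_time x j \<le> n \<and> n < visit_time x (Suc j) then H (x j) else 0) = (if j = k then H (x j) else 0)"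
      using uniq[of j] k by (cases "j = k") auto
  qed
  then have c: "current n x = H (x k)" using k(1) by simp
  have nn: "0 \<le> (\<Sum>j<Suc n. (H (x j))\<^sup>2 * indicator {w. \<bar>H w\<bar> > c} (x j))" by (intro sum_nonneg) auto
  show ?thesis
  proof (cases "\<bar>H (x k)\<bar> > c")
    case True
    have "(H (x k))\<^sup>2 * indicator {w. \<bar>H w\<bar> > c} (x k) \<le> (\<Sum>j<Suc n. (H (x j))\<^sup>2 * indicator {w. \<bar>H w\<bar> > c} (x j))"
      by (rule member_le_sum) (use k(1) in auto)
    moreover have "indicator {w. \<bar>H w\<bar> > c} (x k) = (1 :: real)" using True by simp
    ultimately have "(H (x k))\<^sup>2 \<le> (\<Sum>j<Suc n. (H (x j))\<^sup>2 * indicator {w. \<bar>H w\<bar> > c} (x j))"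
      by (simp only: mult_1_right)
    then show ?thesis unfolding c using zero_le_power2[of c] by linarith
  next
    case False
    then have "(H (x k))\<^sup>2 \<le> c\<^sup>2" by (intro abs_le_square_iff[THEN iffD1]) (use assms in auto)
    then show ?thesis using nn by (simp add: c)
  qed
qed

definition tail :: "real \<Rightarrow> real" where
  "tail c = measure_pmf.expectation Q (\<lambda>w. (H w)\<^sup>2 * indicator {w. \<bar>H w\<bar> > c} w)"

lemma integrable_tail: "integrable (measure_pmf Q) (\<lambda>w. (H w)\<^sup>2 * indicator {w. \<bar>H w\<bar> > c} w)"
  by (rule Bochner_Integration.integrable_bound[OF integrable_H2]) (auto simp: indicator_def)

lemma tail_tendsto: "(\<lambda>k. tail (real k)) \<longlonglongrightarrow> 0"
proof -
  have "(\<lambda>k. tail (real k)) \<longlonglongrightarrow> measure_pmf.expectation Q (\<lambda>w. 0)"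
    unfolding tail_def
  proof (rule integral_dominated_convergence[OF _ _ integrable_H2])
    show "AE w in Q. (\<lambda>k. (H w)\<^sup>2 * indicator {w. \<bar>H w\<bar> > real k} w) \<longlonglongrightarrow> 0"
    proof (rule AE_I2)
      fix w
      have "eventually (\<lambda>k. (H w)\<^sup>2 * indicator {w. \<bar>H w\<bar> > real k} w = 0) sequentially"
        using eventually_ge_at_top[of "nat \<lceil>\<bar>H w\<bar>\<rceil>"]
      proof eventually_elim
        case (elim k)
        then have "\<not> \<bar>H w\<bar> > real k" by linarith
        then show ?case by simp
      qed
      then show "(\<lambda>k. (H w)\<^sup>2 * indicator {w. \<bar>H w\<bar> > real k} w) \<longlonglongrightarrow> 0"
        by (rule tendsto_eventually)
    qed
  qed (auto simp: indicator_def)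
  then show ?thesis by simp
qed

lemma
  shows integrable_current: "integrable \<Omega> (\<lambda>x. (current n x)\<^sup>2)"
    and integral_current: "0 \<le> c \<Longrightarrow> (\<integral>x. (current n x)\<^sup>2 \<partial>\<Omega>) \<le> c\<^sup>2 + real (Suc n) * tail c"
proof -
  have i: "integrable \<Omega> (\<lambda>x. c\<^sup>2 + (\<Sum>j<Suc n. (H (x j))\<^sup>2 * indicator {w. \<bar>H w\<bar> > c} (x j)))" for c
    by (intro Bochner_Integration.integrable_add Bochner_Integration.integrable_sum
        integrable_component[THEN iffD2] integrable_tail) simp
  show i': "integrable \<Omega> (\<lambda>x. (current n x)\<^sup>2)"
    by (rule Bochner_Integration.integrable_bound[OF i[of 0]])
       (use current_bound[of 0] in \<open>auto intro!: AE_I2 intro: order_trans[OF _ abs_ge_self]\<close>)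
  show "(\<integral>x. (current n x)\<^sup>2 \<partial>\<Omega>) \<le> c\<^sup>2 + real (Suc n) * tail c" if c: "0 \<le> c"
  proof -
    have ic: "integrable \<Omega> (\<lambda>x. (H (x j))\<^sup>2 * indicator {w. \<bar>H w\<bar> > c} (x j))" for j
      by (intro integrable_component[THEN iffD2] integrable_tail)
    have "(\<integral>x. (current n x)\<^sup>2 \<partial>\<Omega>) \<le> (\<integral>x. c\<^sup>2 + (\<Sum>j<Suc n. (H (x j))\<^sup>2 * indicator {w. \<bar>H w\<bar> > c} (x j)) \<partial>\<Omega>)"
      by (rule integral_mono[OF i' i]) (rule current_bound[OF c])
    also have "\<dots> = c\<^sup>2 + (\<Sum>j<Suc n. \<integral>x. (H (x j))\<^sup>2 * indicator {w. \<bar>H w\<bar> > c} (x j) \<partial>\<Omega>)"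
      by (subst Bochner_Integration.integral_add[OF _ Bochner_Integration.integrable_sum[OF ic]], simp,
          subst Bochner_Integration.integral_sum[OF ic], simp)
    also have "\<dots> = c\<^sup>2 + real (Suc n) * tail c"
      using integral_component[of "\<lambda>w. (H w)\<^sup>2 * indicator {w. \<bar>H w\<bar> > c} w"] by (simp add: tail_def del: sum.lessThan_Suc)
    finally show ?thesis .
  qed
qed

lemma integral_resid: "(\<integral>x. (H (resid s (pre n x)))\<^sup>2 \<partial>\<Omega>) \<le> K"
proof -
  have "ennreal (\<integral>x. (H (resid s (pre n x)))\<^sup>2 \<partial>\<Omega>) = (\<integral>\<^sup>+x. ennreal ((H (resid s (pre n x)))\<^sup>2) \<partial>\<Omega>)"
    by (rule nn_integral_eq_integral[symmetric]) (auto intro: integrable_prefix)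
  also have "\<dots> = (\<integral>\<^sup>+w. ennreal ((H (resid s w))\<^sup>2) \<partial>replicate_pmf n P)"
    by (rule nn_integral_pre)
  also have "\<dots> \<le> ennreal K" by (rule nn_integral_resid)
  finally show ?thesis using K_nonneg by simp
qed

text \<open>The exchange of the random number of started cycles for the fixed number
  \<open>m\<close>, written as coefficients that depend on the past only.\<close>

definition weight :: "nat \<Rightarrow> nat \<Rightarrow> nat \<Rightarrow> (nat \<Rightarrow> 'a list) \<Rightarrow> real" where
  "weight n m j x = (if visit_time x j \<le> n then 1 else 0) - (if j < m then 1 else 0)"

lemma weight_meas [measurable]: "weight n m j \<in> borel_measurable \<Omega>"
  unfolding weight_def by measurable

lemma weight_past: "(\<And>i. i < j \<Longrightarrow> x i = y i) \<Longrightarrow> weight n m j x = weight n m j y"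
  unfolding weight_def visit_time_def by simp

lemma weight_bound: "\<bar>weight n m j x\<bar> \<le> 1"
  unfolding weight_def by simp

lemma sum_weight: "m \<le> Suc n \<Longrightarrow> (\<Sum>j<Suc n. weight n m j x * H (x j)) = started n x - (\<Sum>j<m. H (x j))"
proof -
  assume m: "m \<le> Suc n"
  have "(\<Sum>j<Suc n. weight n m j x * H (x j)) = started n x - (\<Sum>j<Suc n. if j < m then H (x j) else 0)"
    unfolding started_def sum_subtractf[symmetric] weight_def by (intro sum.cong) auto
  also have "(\<Sum>j<Suc n. if j < m then H (x j) else 0) = (\<Sum>j<m. H (x j))"
    using m by (intro sum.mono_neutral_cong_right) auto
  finally show ?thesis .
qed

text \<open>Visit times are monotone, so for a given \<open>x\<close> all weights have the same
  sign. Since they lie in {-1, 0, 1}, the sum of squares is the absolute value of the plain sum,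
  which counts visits to \<open>s\<close>.\<close>

lemma sum_weight_square:
  assumes x: "\<And>i. first_hit s (x i)" and m: "m \<le> Suc n"
  shows "(\<Sum>j<Suc n. (weight n m j x)\<^sup>2) \<le> \<bar>1 + real (count_list (pre n x) s) - real m\<bar>"
proof -
  have "(\<Sum>j<Suc n. weight n m j x) = (\<Sum>j<Suc n. if visit_time x j \<le> n then 1 else 0) - (\<Sum>j<Suc n. if j < m then 1 else 0)"
    unfolding weight_def sum_subtractf by simp
  also have "(\<Sum>j<Suc n. if j < m then 1 else 0) = real m"
  proof -
    have "(\<Sum>j<Suc n. if j < m then 1 else 0) = (\<Sum>j<m. 1::real)"
      using m by (intro sum.mono_neutral_cong_right) auto
    then show ?thesis by simp
  qed
  \<comment> \<open>The summand 1 is cycle 0, which has always started at time 0.\<close>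
  also have "(\<Sum>j<Suc n. if visit_time x j \<le> n then 1 else 0::real) = 1 + (\<Sum>j<n. if visit_time x (Suc j) \<le> n then 1 else 0)"
    unfolding sum.lessThan_Suc_shift by simp
  also have "(\<Sum>j<n. if visit_time x (Suc j) \<le> n then 1 else 0) = real (count_list (pre n x) s)"
  proof -
    have c1: "count_list c s = 1" if "first_hit s c" for c
      using that by (rule first_hitE) (simp add: count_notin)
    have c0: "count_list (resid s w) s = 0" for w
      by (rule count_notin[OF notin_resid])
    have "real (count_list (pre n x) s) = (\<Sum>j<n. if visit_time x (Suc j) \<le> n then real (count_list (x j) s) else 0)"
      using pre_completed_cycles_sum[of "\<lambda>w. real (count_list w s)" x n] x by (simp add: c0)
    also have "\<dots> = (\<Sum>j<n. if visit_time x (Suc j) \<le> n then 1 else 0)"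
      by (intro sum.cong) (auto simp: c1[OF x])
    finally show ?thesis by simp
  qed
  finally have tot: "(\<Sum>j<Suc n. weight n m j x) = 1 + real (count_list (pre n x) s) - real m" .
  show ?thesis
  proof (cases "\<exists>j. m \<le> j \<and> visit_time x j \<le> n")
    case True
    then obtain k where k: "m \<le> k" "visit_time x k \<le> n" by blast
    have "visit_time x j \<le> n" if "j < m" for j
      using visit_time_mono[of j k x] that k by simp
    then have "(weight n m j x)\<^sup>2 = weight n m j x" for j by (simp add: weight_def)
    then show ?thesis using tot by simp
  next
    case False
    then have "(weight n m j x)\<^sup>2 = - weight n m j x" for j by (auto simp: weight_def)
    then show ?thesis using tot by (simp only: sum_negf)
  qed
qed

text \<open>With \<open>m\<close> within bounded distance of \<open>real n * pmf P s\<close> this is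
  of order \<open>sqrt (real n)\<close>, while the variance of the whole sum is of order
  \<open>n\<close>.\<close>

lemma integral_weight_square:
  assumes m: "m \<le> Suc n"
  shows "(\<integral>x. (\<Sum>j<Suc n. (weight n m j x)\<^sup>2) \<partial>\<Omega>) \<le> sqrt (real n) + 1 + \<bar>real n * pmf P s - real m\<bar>"
proof -
  define c where "c w = real (count_list w s) - real n * pmf P s" for w
  have ip: "integrable \<Omega> (\<lambda>x. \<bar>c (pre n x)\<bar> + (1 + \<bar>real n * pmf P s - real m\<bar>))"
    by (rule integrable_prefix[of "\<lambda>w. \<bar>c w\<bar> + (1 + \<bar>real n * pmf P s - real m\<bar>)"])
  have iw: "integrable \<Omega> (\<lambda>x. (weight n m j x)\<^sup>2)" for j
    by (rule O.integrable_const_bound[where B=1]) (use weight_bound[of n m j] in \<open>auto simp: abs_square_le_1\<close>)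
  have "(\<integral>x. (\<Sum>j<Suc n. (weight n m j x)\<^sup>2) \<partial>\<Omega>) \<le> (\<integral>x. \<bar>c (pre n x)\<bar> + (1 + \<bar>real n * pmf P s - real m\<bar>) \<partial>\<Omega>)"
  proof (rule integral_mono_AE)
    show "integrable \<Omega> (\<lambda>x. \<Sum>j<Suc n. (weight n m j x)\<^sup>2)" by (intro Bochner_Integration.integrable_sum iw)
    show "AE x in \<Omega>. (\<Sum>j<Suc n. (weight n m j x)\<^sup>2) \<le> \<bar>c (pre n x)\<bar> + (1 + \<bar>real n * pmf P s - real m\<bar>)"
      using AE_\<Omega>
    proof eventually_elim
      case (elim x)
      have "(\<Sum>j<Suc n. (weight n m j x)\<^sup>2) \<le> \<bar>1 + real (count_list (pre n x) s) - real m\<bar>"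
        by (rule sum_weight_square) (use elim m in auto)
      then show ?case unfolding c_def by linarith
    qed
  qed (rule ip)
  also have "\<dots> = (\<integral>x. \<bar>c (pre n x)\<bar> \<partial>\<Omega>) + (1 + \<bar>real n * pmf P s - real m\<bar>)"
    using integrable_prefix[of "\<lambda>w. \<bar>c w\<bar>" n] by (subst Bochner_Integration.integral_add) (auto simp: O.prob_space)
  also have "(\<integral>x. \<bar>c (pre n x)\<bar> \<partial>\<Omega>) = measure_pmf.expectation (replicate_pmf n P) (\<lambda>w. \<bar>c w\<bar>)"
    by (rule integral_prefix)
  also have "\<dots> \<le> sqrt (measure_pmf.expectation (replicate_pmf n P) (\<lambda>w. (c w)\<^sup>2))"
    by (rule measure_pmf.expectation_abs_le_sqrt) auto
  also have "\<dots> \<le> sqrt (real n)"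
    unfolding c_def by (intro real_sqrt_le_mono variance_count_replicate)
  finally show ?thesis by simp
qed

lemma
  shows integrable_started: "integrable \<Omega> (\<lambda>x. (started n x)\<^sup>2)"
    and integral_started: "(\<integral>x. (started n x)\<^sup>2 \<partial>\<Omega>) \<le> v * real (Suc n)"
proof -
  \<comment> \<open>For \<open>m = 0\<close> the weights are the indicators of having started, so
    Wald's identity applies to \<open>started\<close> itself.\<close>
  have s: "started n x = (\<Sum>j<Suc n. weight n 0 j x * H (x j))" for x
    using sum_weight[of 0 n x] by simp
  show "integrable \<Omega> (\<lambda>x. (started n x)\<^sup>2)"
    unfolding s by (rule integrable_wald) (auto intro: weight_past weight_bound)
  have "(\<integral>x. (started n x)\<^sup>2 \<partial>\<Omega>) = v * (\<integral>x. (\<Sum>j<Suc n. (weight n 0 j x)\<^sup>2) \<partial>\<Omega>)"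
    unfolding s by (rule integral_wald) (auto intro: weight_past weight_bound)
  also have "\<dots> \<le> v * (\<integral>x. real (Suc n) \<partial>\<Omega>)"
  proof (intro mult_left_mono v_nonneg integral_mono_AE')
    have "(weight n 0 j x)\<^sup>2 \<le> 1" for j x using weight_bound[of n 0 j x] by (simp add: abs_square_le_1)
    then have "(\<Sum>j<Suc n. (weight n 0 j x)\<^sup>2) \<le> (\<Sum>j<Suc n. 1)" for x by (intro sum_mono)
    then show "AE x in \<Omega>. (\<Sum>j<Suc n. (weight n 0 j x)\<^sup>2) \<le> real (Suc n)" by simp
  qed (auto intro!: AE_I2 sum_nonneg)
  also have "\<dots> = v * real (Suc n)" by (simp add: O.prob_space)
  finally show "(\<integral>x. (started n x)\<^sup>2 \<partial>\<Omega>) \<le> v * real (Suc n)" .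
qed

lemma second_moment_growth:
  "measure_pmf.expectation (replicate_pmf n P) (\<lambda>w. (H w)\<^sup>2) \<le> (6 * v + 3 * K) * real (Suc n)"
proof -
  have ir: "integrable \<Omega> (\<lambda>x. (H (resid s (pre n x)))\<^sup>2)"
    by (rule integrable_prefix[of "\<lambda>w. (H (resid s w))\<^sup>2"])
  have "measure_pmf.expectation (replicate_pmf n P) (\<lambda>w. (H w)\<^sup>2) = (\<integral>x. (H (pre n x))\<^sup>2 \<partial>\<Omega>)"
    by (rule integral_prefix[symmetric])
  also have "\<dots> \<le> (\<integral>x. 3 * ((started n x)\<^sup>2 + (current n x)\<^sup>2 + (H (resid s (pre n x)))\<^sup>2) \<partial>\<Omega>)"
  proof (rule integral_mono_AE)
    show "integrable \<Omega> (\<lambda>x. (H (pre n x))\<^sup>2)" by (rule integrable_prefix[of "\<lambda>w. (H w)\<^sup>2"])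
    show "AE x in \<Omega>. (H (pre n x))\<^sup>2 \<le> 3 * ((started n x)\<^sup>2 + (current n x)\<^sup>2 + (H (resid s (pre n x)))\<^sup>2)"
      using AE_\<Omega>
    proof eventually_elim
      case (elim x)
      then have "H (pre n x) = started n x + - current n x + H (resid s (pre n x))"
        by (subst H_pre_eq) auto
      then show ?case using square_add3_le[of "started n x" "- current n x" "H (resid s (pre n x))"] by simp
    qed
  qed (intro integrable_mult_right Bochner_Integration.integrable_add integrable_started integrable_current ir)
  also have "\<dots> = 3 * ((\<integral>x. (started n x)\<^sup>2 \<partial>\<Omega>) + (\<integral>x. (current n x)\<^sup>2 \<partial>\<Omega>) + (\<integral>x. (H (resid s (pre n x)))\<^sup>2 \<partial>\<Omega>))"
    by (simp add: integrable_started integrable_current ir)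
  also have "\<dots> \<le> 3 * (v * real (Suc n) + real (Suc n) * v + K)"
  proof -
    \<comment> \<open>For linear growth the crude truncation level 0 will do.\<close>
    have "tail 0 \<le> v"
      unfolding tail_def v_def by (rule integral_mono[OF integrable_tail integrable_H2]) (auto simp: indicator_def)
    then have "real (Suc n) * tail 0 \<le> real (Suc n) * v" by (rule mult_left_mono) simp
    moreover have "(\<integral>x. (current n x)\<^sup>2 \<partial>\<Omega>) \<le> real (Suc n) * tail 0"
      using integral_current[of 0 n] by (simp del: of_nat_Suc)
    ultimately have "(\<integral>x. (current n x)\<^sup>2 \<partial>\<Omega>) \<le> real (Suc n) * v"
      by linarith
    then show ?thesis using integral_started[of n] integral_resid[of n]
      by (intro mult_left_mono add_mono) auto
  qed
  also have "\<dots> \<le> (6 * v + 3 * K) * real (Suc n)"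
    using K_nonneg by (simp add: algebra_simps)
  finally show ?thesis .
qed

lemma clt_cycles:
  assumes "v > 0"
  shows "weak_conv_m (\<lambda>n. distr \<Omega> borel (\<lambda>x. (\<Sum>j<n. H (x j)) / sqrt (real n * v))) std_normal_distribution"
proof -
  have "O.indep_vars (\<lambda>_. borel) (\<lambda>j x. H (x j)) UNIV"
    by (rule O.indep_vars_compose2[OF indep_components]) simp
  moreover have "distr \<Omega> borel (\<lambda>x. H (x j)) = distr (measure_pmf Q) borel H" for j
    using distr_distr[of H "measure_pmf Q" borel "\<lambda>x. x j" \<Omega>] comp_meas by (simp add: distr_component comp_def)
  ultimately show ?thesis
    using O.central_limit_theorem_zero_mean[of "\<lambda>j x. H (x j)" "sqrt v" "distr (measure_pmf Q) borel H"] assms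
    by (simp add: integral_component integrable_component integrable_H2 integrable_H H_mean v_def[symmetric]
        integral_component[of "\<lambda>w. (H w)\<^sup>2"] integrable_component[of "\<lambda>w. (H w)\<^sup>2"])
qed

lemma integral_deviation:
  assumes m: "m \<le> Suc n"
  shows "integrable \<Omega> (\<lambda>x. (started n x - (\<Sum>j<m. H (x j)))\<^sup>2)"
    and "(\<integral>x. (started n x - (\<Sum>j<m. H (x j)))\<^sup>2 \<partial>\<Omega>) \<le> v * (sqrt (real n) + 1 + \<bar>real n * pmf P s - real m\<bar>)"
proof -
  have s: "started n x - (\<Sum>j<m. H (x j)) = (\<Sum>j<Suc n. weight n m j x * H (x j))" for x
    using sum_weight[OF m, of x] by simp
  show "integrable \<Omega> (\<lambda>x. (started n x - (\<Sum>j<m. H (x j)))\<^sup>2)"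
    unfolding s by (rule integrable_wald) (auto intro: weight_past weight_bound)
  have "(\<integral>x. (started n x - (\<Sum>j<m. H (x j)))\<^sup>2 \<partial>\<Omega>) = v * (\<integral>x. (\<Sum>j<Suc n. (weight n m j x)\<^sup>2) \<partial>\<Omega>)"
    unfolding s by (rule integral_wald) (auto intro: weight_past weight_bound)
  also have "\<dots> \<le> v * (sqrt (real n) + 1 + \<bar>real n * pmf P s - real m\<bar>)"
    by (intro mult_left_mono integral_weight_square m v_nonneg)
  finally show "(\<integral>x. (started n x - (\<Sum>j<m. H (x j)))\<^sup>2 \<partial>\<Omega>) \<le> v * (sqrt (real n) + 1 + \<bar>real n * pmf P s - real m\<bar>)" .
qed

lemma
  shows integrable_cycles: "integrable \<Omega> (\<lambda>x. (\<Sum>j<m. H (x j))\<^sup>2)"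
    and integral_cycles: "(\<integral>x. (\<Sum>j<m. H (x j))\<^sup>2 \<partial>\<Omega>) = v * real m"
  using integrable_wald[of "\<lambda>_ _. 1" m] integral_wald[of "\<lambda>_ _. 1" m] by (simp_all add: O.prob_space)

text \<open>The truncation level is fixed before \<open>n\<close> grows, so its square becomes
  negligible against \<open>n\<close>, and only the small tail of the second moment is multiplied by
  \<open>n\<close>.\<close>

lemma integral_current_div: "(\<lambda>n. (\<integral>x. (current n x)\<^sup>2 \<partial>\<Omega>) / real n) \<longlonglongrightarrow> 0"
proof (rule LIMSEQ_I)
  fix e :: real assume e: "0 < e"
  obtain k where k: "tail (real k) < e / 4"
    \<comment> \<open>A quarter of \<open>e\<close> is right because
      \<open>real (Suc n) \<le> 2 * real n\<close>: the tail takes at most half of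
      \<open>e * real n\<close>, and the square of \<open>k\<close> gets the other half.\<close>
    using order_tendstoD(2)[OF tail_tendsto, of "e / 4"] e by (auto simp: eventually_sequentially)
  have t0: "0 \<le> tail c" for c unfolding tail_def by (intro integral_nonneg_AE) auto
  obtain n0 where n0: "real n0 > 2 * (real k)\<^sup>2 / e" using reals_Archimedean2 by blast
  show "\<exists>N. \<forall>n\<ge>N. norm ((\<integral>x. (current n x)\<^sup>2 \<partial>\<Omega>) / real n - 0) < e"
  proof (intro exI[of _ "Suc n0"] allI impI)
    fix n assume n: "Suc n0 \<le> n"
    then have pos: "real n > 0" by simp
    have "2 * (real k)\<^sup>2 / e < real n" using n0 n by linarith
    then have "(real k)\<^sup>2 < e / 2 * real n" using e by (simp add: field_simps)
    moreover have "real (Suc n) * tail (real k) \<le> (2 * real n) * (e / 4)"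
      using k t0 n by (intro mult_mono) auto
    moreover have "(\<integral>x. (current n x)\<^sup>2 \<partial>\<Omega>) \<le> (real k)\<^sup>2 + real (Suc n) * tail (real k)"
      by (rule integral_current) simp
    ultimately have "(\<integral>x. (current n x)\<^sup>2 \<partial>\<Omega>) < e * real n" by (simp add: algebra_simps)
    then show "norm ((\<integral>x. (current n x)\<^sup>2 \<partial>\<Omega>) / real n - 0) < e"
      using pos by (simp add: field_simps)
  qed
qed

text \<open>In \<open>n\<close> letters about \<open>real n * pmf P s\<close> cycles are completed,
  each of variance \<open>v\<close>; this is the origin of the variance \<open>pmf P s * v\<close>
  per letter.\<close>

theorem clt_prefix:
  assumes v: "v > 0"
  shows "weak_conv_m (\<lambda>n. distr (measure_pmf (replicate_pmf n P)) borel (\<lambda>w. H w / (sqrt (pmf P s * v) * sqrt (real n))))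
    std_normal_distribution"
proof -
  define p where "p = pmf P s"
  have p: "0 < p" "p \<le> 1" using s_pos by (simp_all add: p_def pmf_le_1)
  \<comment> \<open>The deterministic number of cycles that stands in for the number of visits;
    rounding costs at most 1.\<close>
  define m where "m n = nat \<lfloor>real n * p\<rfloor>" for n
  have m_le: "real (m n) \<le> real n * p" and m_ge: "real n * p - 1 \<le> real (m n)" for n
    unfolding m_def using p by (auto simp: of_nat_nat)
  have m_Suc: "m n \<le> Suc n" for n
  proof -
    have "real n * p \<le> real n" using p by (simp add: mult_left_le)
    then have "real (m n) \<le> real n" using m_le[of n] by linarith
    then show ?thesis by simp
  qed
  have m_div: "(\<lambda>n. real (m n) / (real n * p)) \<longlonglongrightarrow> 1"
  proof (rule tendsto_sandwich)
    show "\<forall>\<^sub>F n in sequentially. 1 - 1 / (real n * p) \<le> real (m n) / (real n * p)"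
      using eventually_gt_at_top[of 0]
    proof eventually_elim
      case (elim n)
      then have "0 < real n * p" using p by simp
      then have "(real n * p - 1) / (real n * p) \<le> real (m n) / (real n * p)"
        using m_ge[of n] by (intro divide_right_mono) auto
      then show ?case using p elim by (simp add: diff_divide_distrib)
    qed
    show "\<forall>\<^sub>F n in sequentially. real (m n) / (real n * p) \<le> 1"
      using eventually_gt_at_top[of 0]
    proof eventually_elim
      case (elim n)
      then have "0 < real n * p" using p by simp
      then show ?case using m_le[of n] by (simp add: field_simps)
    qed
    have "(\<lambda>n. 1 - (1 / p) * (1 / real n)) \<longlonglongrightarrow> 1 - (1 / p) * 0"
      by (intro tendsto_intros lim_1_over_n)
    then show "(\<lambda>n. 1 - 1 / (real n * p)) \<longlonglongrightarrow> 1" by (simp add: mult.commute)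
  qed simp
  have m_top: "filterlim m at_top sequentially"
  proof -
    have "filterlim (\<lambda>n. real n * p - 1) at_top sequentially"
      using p by real_asymp
    then have "filterlim (\<lambda>n. real (m n)) at_top sequentially"
      by (rule filterlim_at_top_mono) (use m_ge in auto)
    then have "\<forall>\<^sub>F n in sequentially. real Z \<le> real (m n)" for Z :: nat
      by (simp only: filterlim_at_top)
    then show ?thesis by (simp add: filterlim_at_top)
  qed
  define U where "U n x = (\<Sum>j<n. H (x j)) / sqrt (real n * v)" for n x
  have U_clt: "weak_conv_m (\<lambda>n. distr \<Omega> borel (U n)) std_normal_distribution"
    unfolding U_def using clt_cycles[OF v] .
  have Um_clt: "weak_conv_m (\<lambda>n. distr \<Omega> borel (U (m n))) std_normal_distribution"
    using U_clt unfolding weak_conv_m_def weak_conv_def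
    by (auto intro: filterlim_compose[OF _ m_top])
  have U_meas [measurable]: "U n \<in> borel_measurable \<Omega>" for n unfolding U_def by measurable
  define q where "q n = sqrt (p * v) * sqrt (real n)" for n
  define Y where "Y n x = H (pre n x) / q n" for n x
  have Y_meas [measurable]: "Y n \<in> borel_measurable \<Omega>" for n unfolding Y_def by measurable
  \<comment> \<open>Mismatch of the normalisations for \<open>n\<close> letters and for
    \<open>m n\<close> cycles.\<close>
  define d where "d n = 1 / q n - 1 / sqrt (real (m n) * v)" for n
  \<comment> \<open>There are four errors: the number of cycles, the cycle in progress, the
    unfinished cycle and the normalisation. The factor 4 comes from squaring a sum of four
    terms.\<close>
  define B where "B n x = 4 / (q n)\<^sup>2 * ((started n x - (\<Sum>j<m n. H (x j)))\<^sup>2 + (current n x)\<^sup>2 + (H (resid s (pre n x)))\<^sup>2)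
      + 4 * (d n)\<^sup>2 * (\<Sum>j<m n. H (x j))\<^sup>2" for n x
  have ir: "integrable \<Omega> (\<lambda>x. (H (resid s (pre n x)))\<^sup>2)" for n
    by (rule integrable_prefix[of "\<lambda>w. (H (resid s w))\<^sup>2"])
  have B_int: "integrable \<Omega> (B n)" for n
    unfolding B_def
    by (intro Bochner_Integration.integrable_add integrable_mult_right integral_deviation m_Suc
        integrable_current ir integrable_cycles)
  have le: "AE x in \<Omega>. (Y n x - U (m n) x)\<^sup>2 \<le> B n x" for n
    using AE_\<Omega>
  proof eventually_elim
    case (elim x)
    define w where "w = (\<Sum>j<m n. H (x j))"
    define a where "a = started n x - w"
    define b where "b = current n x"
    define r where "r = H (resid s (pre n x))"
    have hp: "H (pre n x) = a - b + r + w"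
      using elim unfolding a_def b_def r_def by (subst H_pre_eq) auto
    have eq: "Y n x - U (m n) x = a / q n + (- b) / q n + r / q n + d n * w"
      unfolding Y_def U_def d_def w_def[symmetric] hp
      by (simp add: algebra_simps add_divide_distrib diff_divide_distrib)
    have 4: "(a1 + a2 + a3 + a4)\<^sup>2 \<le> 4 * (a1\<^sup>2 + a2\<^sup>2 + a3\<^sup>2 + a4\<^sup>2)" for a1 a2 a3 a4 :: real
    proof -
      have "4 * (a1\<^sup>2 + a2\<^sup>2 + a3\<^sup>2 + a4\<^sup>2) - (a1 + a2 + a3 + a4)\<^sup>2
        = (a1 - a2)\<^sup>2 + (a1 - a3)\<^sup>2 + (a1 - a4)\<^sup>2 + (a2 - a3)\<^sup>2 + (a2 - a4)\<^sup>2 + (a3 - a4)\<^sup>2"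
        by (simp add: power2_eq_square algebra_simps)
      also have "\<dots> \<ge> 0" by simp
      finally show ?thesis by linarith
    qed
    show ?case
      unfolding eq B_def w_def[symmetric] a_def[symmetric] b_def[symmetric] r_def[symmetric]
      by (rule order_trans[OF 4]) (simp add: power_divide power_mult_distrib algebra_simps add_divide_distrib)
  qed
  have i2: "integrable \<Omega> (\<lambda>x. (Y n x - U (m n) x)\<^sup>2)" for n
    by (rule Bochner_Integration.integrable_bound[OF B_int[of n]])
       (use le[of n] in \<open>auto elim!: eventually_mono\<close>)
  define E where "E n = 4 / (p * v) * ((v * (sqrt (real n) + 2) + K) / real n + (\<integral>x. (current n x)\<^sup>2 \<partial>\<Omega>) / real n)
     + 4 * (sqrt (real (m n) / (real n * p)) - 1)\<^sup>2" for n
  have lim0: "(\<lambda>n. \<integral>x. (Y n x - U (m n) x)\<^sup>2 \<partial>\<Omega>) \<longlonglongrightarrow> 0"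
  proof (rule tendsto_sandwich[where f="\<lambda>_. 0" and h=E])
    show "\<forall>\<^sub>F n in sequentially. (\<integral>x. (Y n x - U (m n) x)\<^sup>2 \<partial>\<Omega>) \<le> E n"
      using eventually_gt_at_top[of 0] eventually_compose_filterlim[OF eventually_gt_at_top[of 0] m_top]
    proof eventually_elim
      case (elim n)
      have q2: "(q n)\<^sup>2 = p * v * real n" unfolding q_def using p v by (simp add: power_mult_distrib)
      have "(\<integral>x. (Y n x - U (m n) x)\<^sup>2 \<partial>\<Omega>) \<le> (\<integral>x. B n x \<partial>\<Omega>)"
        by (rule integral_mono_AE[OF i2 B_int le])
      also have "\<dots> = 4 / (q n)\<^sup>2 * ((\<integral>x. (started n x - (\<Sum>j<m n. H (x j)))\<^sup>2 \<partial>\<Omega>) + (\<integral>x. (current n x)\<^sup>2 \<partial>\<Omega>)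
          + (\<integral>x. (H (resid s (pre n x)))\<^sup>2 \<partial>\<Omega>)) + 4 * (d n)\<^sup>2 * (v * real (m n))"
        unfolding B_def integral_cycles[symmetric]
        by (simp only: Bochner_Integration.integral_add integral_mult_right_zero Bochner_Integration.integrable_add
            integrable_mult_right integral_deviation(1)[OF m_Suc] integrable_current ir integrable_cycles)
      also have "\<dots> \<le> 4 / (q n)\<^sup>2 * (v * (sqrt (real n) + 2) + (\<integral>x. (current n x)\<^sup>2 \<partial>\<Omega>) + K) + 4 * (d n)\<^sup>2 * (v * real (m n))"
      proof (intro add_right_mono mult_left_mono add_mono integral_resid order_refl)
        have "\<bar>real n * pmf P s - real (m n)\<bar> \<le> 1" using m_le[of n] m_ge[of n] unfolding p_def by linarith
        then have "v * (sqrt (real n) + 1 + \<bar>real n * pmf P s - real (m n)\<bar>) \<le> v * (sqrt (real n) + 2)"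
          using v by (intro mult_left_mono) auto
        then show "(\<integral>x. (started n x - (\<Sum>j<m n. H (x j)))\<^sup>2 \<partial>\<Omega>) \<le> v * (sqrt (real n) + 2)"
          using integral_deviation(2)[OF m_Suc, of n] by linarith
      qed simp
      also have "4 / (q n)\<^sup>2 * (v * (sqrt (real n) + 2) + (\<integral>x. (current n x)\<^sup>2 \<partial>\<Omega>) + K)
         = 4 / (p * v) * ((v * (sqrt (real n) + 2) + K) / real n + (\<integral>x. (current n x)\<^sup>2 \<partial>\<Omega>) / real n)"
        unfolding q2 using p v elim by (simp add: field_simps)
      also have "4 * (d n)\<^sup>2 * (v * real (m n)) = 4 * (sqrt (real (m n) / (real n * p)) - 1)\<^sup>2"
      proof -
        \<comment> \<open>By Wald's identity the sum of \<open>m n\<close> cycles has size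
          \<open>sqrt (v * real (m n))\<close>; on this scale the mismatch is a ratio tending to 1,
          minus 1.\<close>
        have "d n * sqrt (v * real (m n)) = sqrt (real (m n) / (real n * p)) - 1"
          unfolding d_def q_def using p v elim
          by (simp add: left_diff_distrib real_sqrt_mult real_sqrt_divide field_simps)
        then have "(d n * sqrt (v * real (m n)))\<^sup>2 = (sqrt (real (m n) / (real n * p)) - 1)\<^sup>2" by simp
        moreover have "(d n * sqrt (v * real (m n)))\<^sup>2 = (d n)\<^sup>2 * (v * real (m n))"
          using v by (simp add: power_mult_distrib)
        ultimately show ?thesis by simp
      qed
      finally show ?case unfolding E_def .
    qed
    have "(\<lambda>n. (b * (sqrt (real n) + 2) + c) / real n) \<longlonglongrightarrow> 0" for b c :: real
      by real_asymp
    moreover have "(\<lambda>n. sqrt (real (m n) / (real n * p)) - 1) \<longlonglongrightarrow> sqrt 1 - 1"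
      by (intro tendsto_diff tendsto_real_sqrt m_div tendsto_const)
    ultimately have "E \<longlonglongrightarrow> 4 / (p * v) * (0 + 0) + 4 * (sqrt 1 - 1)\<^sup>2"
      unfolding E_def by (intro tendsto_add tendsto_mult tendsto_power tendsto_const integral_current_div)
    then show "E \<longlonglongrightarrow> 0" by simp
  qed (auto intro!: always_eventually)
  have "weak_conv_m (\<lambda>n. distr \<Omega> borel (Y n)) std_normal_distribution"
    by (rule O.weak_conv_perturb_L2[OF U_meas Y_meas _ Um_clt i2 lim0])
       (rule real_dist_normal_dist)
  moreover have "distr \<Omega> borel (Y n) = distr (measure_pmf (replicate_pmf n P)) borel (\<lambda>w. H w / q n)" for n
    unfolding distr_pre[symmetric] Y_def by (subst distr_distr) (auto simp: comp_def)
  ultimately show ?thesis unfolding q_def p_def by simp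
qed

end

section \<open>Transfer to the two-sided Bernoulli measure\<close>

definition word :: "nat \<Rightarrow> (int \<Rightarrow> 'a) \<Rightarrow> 'a list" where
  "word n \<omega> = map (\<lambda>i. \<omega> (int (Suc i))) [0..<n]"

lemma length_word [simp]: "length (word n \<omega>) = n"
  by (simp add: word_def)

lemma word_Suc: "word (Suc n) \<omega> = word n \<omega> @ [\<omega> (int (Suc n))]"
  by (simp add: word_def)

lemma word_add: "word (n + k) \<omega> = word n \<omega> @ map (\<lambda>i. \<omega> (int (Suc i))) [n..<n+k]"
  by (simp add: word_def upt_add_eq_append[of 0 n k] del: upt_Suc)

lemma wordmat_append: "wordmat B (u @ w) = wordmat B w ** wordmat B u"
  by (induction u) (simp_all add: matrix_mul_assoc)

lemma prodA_eq_wordmat: "prodA B \<omega> n = wordmat B (word n \<omega>)"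
proof (induction n)
  case (Suc n)
  then show ?case by (simp add: word_Suc wordmat_append)
qed (simp add: word_def)

lemma prob_space_bernoulli: "prob_space (bernoulli P)"
  unfolding bernoulli_def by (rule prob_space_PiM) (rule measure_pmf.prob_space_axioms)

lemma space_bernoulli [simp]: "space (bernoulli P) = UNIV"
  by (simp add: bernoulli_def space_PiM)

lemma letter_measurable: "(\<lambda>\<omega>. \<omega> i) \<in> measurable (bernoulli P) (count_space UNIV)"
proof -
  have "(\<lambda>\<omega>. \<omega> i) \<in> measurable (bernoulli P) (measure_pmf P)"
    unfolding bernoulli_def by (rule measurable_component_singleton) simp
  then show ?thesis by (simp add: measurable_cong_sets[OF refl sets_measure_pmf_count_space])
qed

lemma word_measurable [measurable]: "word n \<in> measurable (bernoulli (P :: 'a::finite pmf)) (count_space UNIV)"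
proof (induction n)
  case 0
  have "word 0 = (\<lambda>_. [] :: 'a list)" by (simp add: word_def fun_eq_iff)
  then show ?case by simp
next
  case (Suc n)
  have "(\<lambda>\<omega>. word n \<omega> @ [\<omega> (int (Suc n))]) \<in> measurable (bernoulli P) (count_space UNIV)"
    by (rule measurable_count_space_binary[OF Suc letter_measurable])
  then show ?case by (simp add: word_Suc[abs_def])
qed

lemma distr_word:
  fixes P :: "'a::finite pmf"
  shows "distr (bernoulli P) (count_space UNIV) (word n) = measure_pmf (replicate_pmf n P)"
proof (rule measure_eqI_countable[of _ UNIV])
  fix u :: "'a list"
  have eq: "emeasure (distr (bernoulli P) (count_space UNIV) (word n)) {u} = emeasure (bernoulli P) {\<omega>. word n \<omega> = u}"
    by (subst emeasure_distr) (auto simp: vimage_def)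
  show "emeasure (distr (bernoulli P) (count_space UNIV) (word n)) {u} = emeasure (measure_pmf (replicate_pmf n P)) {u}"
  proof (cases "length u = n")
    case False
    then have "{\<omega>. word n \<omega> = u} = {}" by auto
    then show ?thesis unfolding eq using False by (simp add: emeasure_pmf_single pmf_replicate_pmf)
  next
    case True
    interpret product_prob_space "\<lambda>_. measure_pmf P" "UNIV :: int set" by unfold_locales
    have "{\<omega>. word n \<omega> = u} = {\<omega>\<in>space (PiM UNIV (\<lambda>_. measure_pmf P)). \<forall>i\<in>(\<lambda>i. int (Suc i)) ` {..<n}. \<omega> i \<in> {u ! nat (i - 1)}}"
      using True by (auto simp: word_def list_eq_iff_nth_eq space_PiM)
    then have "emeasure (bernoulli P) {\<omega>. word n \<omega> = u} = (\<Prod>i\<in>(\<lambda>i. int (Suc i)) ` {..<n}. emeasure (measure_pmf P) {u ! nat (i - 1)})"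
      unfolding bernoulli_def by (simp only:) (rule emeasure_PiM_Collect, auto)
    also have "\<dots> = (\<Prod>i<n. emeasure (measure_pmf P) {u ! i})"
      by (subst prod.reindex) (auto simp: inj_on_def)
    also have "\<dots> = ennreal (\<Prod>i<n. pmf P (u ! i))"
      by (simp add: emeasure_pmf_single prod_ennreal)
    also have "(\<Prod>i<n. pmf P (u ! i)) = (\<Prod>a\<leftarrow>u. pmf P a)"
      using prod.list_conv_set_nth[of "map (pmf P) u"] True by (simp add: atLeast0LessThan)
    finally show ?thesis unfolding eq using True by (simp add: emeasure_pmf_single pmf_replicate_pmf)
  qed
qed (auto simp: countable_subset)

lemma nn_integral_word:
  fixes P :: "'a::finite pmf"
  shows "(\<integral>\<^sup>+\<omega>. f (word n \<omega>) \<partial>bernoulli P) = (\<integral>\<^sup>+w. f w \<partial>replicate_pmf n P)"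
  unfolding distr_word[symmetric] by (rule nn_integral_distr[symmetric]) auto

lemma distr_fun_word:
  fixes P :: "'a::finite pmf" and f :: "'a list \<Rightarrow> real"
  shows "distr (bernoulli P) borel (\<lambda>\<omega>. f (word n \<omega>)) = distr (measure_pmf (replicate_pmf n P)) borel f"
  unfolding distr_word[symmetric] by (subst distr_distr) (auto simp: comp_def)

lemma fun_word_meas:
  fixes P :: "'a::finite pmf" and f :: "'a list \<Rightarrow> 'b::topological_space"
  shows "(\<lambda>\<omega>. f (word n \<omega>)) \<in> borel_measurable (bernoulli P)"
  by (rule measurable_compose[OF word_measurable]) simp

lemma nn_integral_avoiding:
  "(\<integral>\<^sup>+w. indicator {w. s \<notin> set w} w \<partial>replicate_pmf n P) = ennreal ((1 - pmf P s) ^ n)"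
proof (induction n)
  case (Suc n)
  have "(\<integral>\<^sup>+w. indicator {w. s \<notin> set w} w \<partial>replicate_pmf (Suc n) P)
     = (\<integral>\<^sup>+a. indicator (-{s}) a * (\<integral>\<^sup>+w. indicator {w. s \<notin> set w} w \<partial>replicate_pmf n P) \<partial>measure_pmf P)"
    unfolding nn_integral_replicate_pmf_Suc
    by (intro nn_integral_cong, subst nn_integral_cmult[symmetric], simp, intro nn_integral_cong) (auto simp: indicator_def)
  also have "\<dots> = ennreal (1 - pmf P s) * ennreal ((1 - pmf P s) ^ n)"
  proof -
    have "emeasure (measure_pmf P) (-{s}) = ennreal (1 - pmf P s)"
      using measure_pmf.prob_compl[of "{s}" P]
      by (simp add: measure_pmf.emeasure_eq_measure measure_pmf_single Compl_eq_Diff_UNIV)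
    then show ?thesis unfolding Suc by (simp add: nn_integral_multc)
  qed
  finally show ?case by (simp add: ennreal_mult'[symmetric] pmf_le_1)
qed simp

lemma AE_letter_occurs:
  fixes P :: "'a::finite pmf"
  assumes "pmf P s > 0"
  shows "AE \<omega> in bernoulli P. \<exists>n. s \<in> set (word n \<omega>)"
proof -
  let ?f = "\<lambda>n \<omega>. indicator {w. s \<notin> set w} (word n \<omega>) :: ennreal"
  have m: "?f n \<in> borel_measurable (bernoulli P)" for n by (rule fun_word_meas)
  have "(\<integral>\<^sup>+\<omega>. (INF n. ?f n \<omega>) \<partial>bernoulli P) \<le> ennreal ((1 - pmf P s) ^ n)" for n
  proof -
    have "(\<integral>\<^sup>+\<omega>. (INF n. ?f n \<omega>) \<partial>bernoulli P) \<le> (\<integral>\<^sup>+\<omega>. ?f n \<omega> \<partial>bernoulli P)"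
      by (intro nn_integral_mono INF_lower) simp
    then show ?thesis unfolding nn_integral_word nn_integral_avoiding .
  qed
  moreover have "(\<lambda>n. ennreal ((1 - pmf P s) ^ n)) \<longlonglongrightarrow> ennreal 0"
    using assms by (intro tendsto_ennrealI LIMSEQ_realpow_zero) (auto simp: pmf_le_1)
  ultimately have "(\<integral>\<^sup>+\<omega>. (INF n. ?f n \<omega>) \<partial>bernoulli P) \<le> ennreal 0"
    by (intro LIMSEQ_le_const[of _ "ennreal 0"]) auto
  then have "(\<integral>\<^sup>+\<omega>. (INF n. ?f n \<omega>) \<partial>bernoulli P) = 0" by simp
  then have "AE \<omega> in bernoulli P. (INF n. ?f n \<omega>) = 0"
    using m by (subst (asm) nn_integral_0_iff_AE) auto
  then show ?thesis
  proof eventually_elim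
    case (elim \<omega>)
    show ?case
    proof (rule ccontr)
      assume "\<nexists>n. s \<in> set (word n \<omega>)"
      then have "?f n \<omega> = 1" for n by simp
      then show False using elim by simp
    qed
  qed
qed

context additive_functional
begin

text \<open>The hypothesis on \<open>F\<close> covers vector norms and the operator norm at once:
  all dependence on the initial data sits in \<open>Z\<close>, which is evaluated only at the
  letters before the first \<open>s\<close>.\<close>

lemma AE_eventually_shift:
  assumes F: "\<And>w u. s \<notin> set w \<Longrightarrow> F (w @ s # u) = Z w + H u"
  shows "AE \<omega> in bernoulli P. \<exists>c. \<forall>\<^sub>F n in sequentially. F (word n \<omega>) = H (word n \<omega>) + c"
  using AE_letter_occurs[OF s_pos]
proof eventually_elim
  case (elim \<omega>)
  then obtain n where "s \<in> set (word n \<omega>)" by blast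
  then obtain w u where w: "word n \<omega> = w @ s # u" "s \<notin> set w" by (meson split_list_first)
  have H: "H (w @ s # u') = H (w @ [s]) + H u'" for u'
    using H_add[OF first_hit_snoc[OF w(2)], of u'] by simp
  have "F (word k \<omega>) = H (word k \<omega>) + (Z w - H (w @ [s]))" if nk: "n \<le> k" for k
  proof -
    obtain u' where "word k \<omega> = w @ s # u'"
      using word_add[of n "k - n" \<omega>] nk w(1) by (simp del: of_nat_Suc)
    then show ?thesis using F[OF w(2), of u'] H[of u'] by simp
  qed
  then show ?case unfolding eventually_sequentially by blast
qed

text \<open>\<open>L1\<close> is characterised by an almost sure limit, which convergence in
  distribution does not provide. Linear growth of the second moments and bounded moments of the
  increments give it.\<close>

theorem AE_sublinear:
  assumes F: "\<And>w u. s \<notin> set w \<Longrightarrow> F (w @ s # u) = Z w + H u"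
  shows "AE \<omega> in bernoulli P. (\<lambda>n. F (word n \<omega>) / real n) \<longlonglongrightarrow> 0"
proof -
  interpret B: prob_space "bernoulli P" by (rule prob_space_bernoulli)
  have "AE \<omega> in bernoulli P. (\<lambda>n. H (word n \<omega>) / real n) \<longlonglongrightarrow> 0"
  proof (rule B.AE_sublinear_of_second_moments[where C="(6 * v + 3 * K) + 4 * K"])
    show "(\<lambda>\<omega>. H (word n \<omega>)) \<in> borel_measurable (bernoulli P)" for n by (rule fun_word_meas)
    show "0 \<le> (6 * v + 3 * K) + 4 * K" using v_nonneg K_nonneg by simp
    show "(\<integral>\<^sup>+\<omega>. ennreal ((H (word n \<omega>))\<^sup>2) \<partial>bernoulli P) \<le> ennreal (((6 * v + 3 * K) + 4 * K) * real (Suc n))" for n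
    proof -
      have "(\<integral>\<^sup>+\<omega>. ennreal ((H (word n \<omega>))\<^sup>2) \<partial>bernoulli P) = (\<integral>\<^sup>+w. ennreal ((H w)\<^sup>2) \<partial>replicate_pmf n P)"
        by (rule nn_integral_word)
      also have "\<dots> = ennreal (measure_pmf.expectation (replicate_pmf n P) (\<lambda>w. (H w)\<^sup>2))"
        by (rule nn_integral_eq_integral) auto
      also have "\<dots> \<le> ennreal (((6 * v + 3 * K) + 4 * K) * real (Suc n))"
      proof (rule ennreal_leI)
        have "0 \<le> 4 * K * real (Suc n)" using K_nonneg by simp
        then show "measure_pmf.expectation (replicate_pmf n P) (\<lambda>w. (H w)\<^sup>2) \<le> ((6 * v + 3 * K) + 4 * K) * real (Suc n)"
          using second_moment_growth[of n] unfolding distrib_right[of "6 * v + 3 * K"] by linarith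
      qed
      finally show ?thesis .
    qed
    show "(\<integral>\<^sup>+\<omega>. ennreal ((H (word (Suc n) \<omega>) - H (word n \<omega>))\<^sup>2) \<partial>bernoulli P) \<le> ennreal ((6 * v + 3 * K) + 4 * K)" for n
    proof -
      have "(\<integral>\<^sup>+\<omega>. ennreal ((H (word (Suc n) \<omega>) - H (word n \<omega>))\<^sup>2) \<partial>bernoulli P)
        = (\<integral>\<^sup>+\<omega>. ennreal ((H (word (Suc n) \<omega>) - H (butlast (word (Suc n) \<omega>)))\<^sup>2) \<partial>bernoulli P)"
        by (simp add: word_Suc)
      also have "\<dots> = (\<integral>\<^sup>+w. ennreal ((H w - H (butlast w))\<^sup>2) \<partial>replicate_pmf (Suc n) P)"
        by (rule nn_integral_word)
      also have "\<dots> \<le> ennreal (4 * K)" by (rule second_moment_incr)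
      also have "\<dots> \<le> ennreal ((6 * v + 3 * K) + 4 * K)"
        by (rule ennreal_leI) (use v_nonneg K_nonneg in simp)
      finally show ?thesis .
    qed
  qed
  moreover have "AE \<omega> in bernoulli P. \<exists>c. \<forall>\<^sub>F n in sequentially. F (word n \<omega>) = H (word n \<omega>) + c"
    by (rule AE_eventually_shift) (rule F)
  ultimately show ?thesis
  proof eventually_elim
    case (elim \<omega>)
    then obtain c where c: "\<forall>\<^sub>F n in sequentially. F (word n \<omega>) = H (word n \<omega>) + c" by blast
    have "(\<lambda>n. H (word n \<omega>) / real n + c * (1 / real n)) \<longlonglongrightarrow> 0 + c * 0"
      by (intro tendsto_intros elim lim_1_over_n)
    then have "(\<lambda>n. H (word n \<omega>) / real n + c * (1 / real n)) \<longlonglongrightarrow> 0" by simp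
    then show ?case
      by (rule Lim_transform_eventually) (use c in \<open>auto elim!: eventually_mono simp: add_divide_distrib\<close>)
  qed
qed

theorem clt_bernoulli:
  assumes v: "v > 0" and F: "\<And>w u. s \<notin> set w \<Longrightarrow> F (w @ s # u) = Z w + H u"
  shows "weak_conv_m (\<lambda>n. distr (bernoulli P) borel (\<lambda>\<omega>. F (word n \<omega>) / (sqrt (pmf P s * v) * sqrt (real n))))
    std_normal_distribution"
proof -
  interpret B: prob_space "bernoulli P" by (rule prob_space_bernoulli)
  define q where "q n = sqrt (pmf P s * v) * sqrt (real n)" for n
  have shift: "AE \<omega> in bernoulli P. \<exists>c. \<forall>\<^sub>F n in sequentially. F (word n \<omega>) = H (word n \<omega>) + c"
    by (rule AE_eventually_shift) (rule F)
  have lim: "(\<lambda>n. c / q n) \<longlonglongrightarrow> 0" for c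
  proof -
    have "0 < sqrt (pmf P s * v)" using v s_pos by simp
    then have "(\<lambda>n. c / (b * sqrt (real n))) \<longlonglongrightarrow> 0" if "b > 0" for b :: real
      using that by real_asymp
    then show ?thesis unfolding q_def using v s_pos by simp
  qed
  have "weak_conv_m (\<lambda>n. distr (bernoulli P) borel (\<lambda>\<omega>. F (word n \<omega>) / q n)) std_normal_distribution"
  proof (rule B.weak_conv_perturb_AE[where X="\<lambda>n \<omega>. H (word n \<omega>) / q n"])
    show "(\<lambda>\<omega>. H (word n \<omega>) / q n) \<in> borel_measurable (bernoulli P)"
      "(\<lambda>\<omega>. F (word n \<omega>) / q n) \<in> borel_measurable (bernoulli P)" for n by (rule fun_word_meas)+
    show "weak_conv_m (\<lambda>n. distr (bernoulli P) borel (\<lambda>\<omega>. H (word n \<omega>) / q n)) std_normal_distribution"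
    proof -
      have "distr (bernoulli P) borel (\<lambda>\<omega>. H (word n \<omega>) / q n)
          = distr (measure_pmf (replicate_pmf n P)) borel (\<lambda>w. H w / q n)" for n
        by (rule distr_fun_word)
      then show ?thesis using clt_prefix[OF v] unfolding q_def by simp
    qed
    show "AE \<omega> in bernoulli P. (\<lambda>n. F (word n \<omega>) / q n - H (word n \<omega>) / q n) \<longlonglongrightarrow> 0"
      using shift
    proof eventually_elim
      case (elim \<omega>)
      then obtain c where c: "\<forall>\<^sub>F n in sequentially. F (word n \<omega>) = H (word n \<omega>) + c" by blast
      show ?case
        by (rule Lim_transform_eventually[OF lim[of c]])
           (use c in \<open>auto elim!: eventually_mono simp: add_divide_distrib\<close>)
    qed
  qed (rule real_dist_normal_dist)
  then show ?thesis unfolding q_def .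
qed

end

section \<open>Small values of rotating curves\<close>

lemma bounded_bilinear_mv: "bounded_bilinear (\<lambda>(M::real^2^2) x. M *v x)"
  unfolding bilinear_conv_bounded_bilinear[symmetric] bilinear_def
  by (auto intro!: linearI simp: matrix_vector_right_distrib matrix_vector_mult_add_rdistrib
      scaleR_matrix_vector_assoc matrix_vector_mult_scaleR)

lemma wedge2_mult: "wedge2 (M *v x) (M *v y) = det M * wedge2 x y"
  by (simp add: wedge2_def det_2 matrix_vector_mult_def sum_2 algebra_simps)

lemma abs_wedge2_le: "\<bar>wedge2 x y\<bar> \<le> norm x * norm y"
proof -
  have "(wedge2 x y)\<^sup>2 + (x \<bullet> y)\<^sup>2 = (x \<bullet> x) * (y \<bullet> y)"
    by (simp add: wedge2_def inner_vec_def sum_2 power2_eq_square algebra_simps)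
  then have "(wedge2 x y)\<^sup>2 \<le> (norm x * norm y)\<^sup>2"
    by (simp add: power_mult_distrib power2_norm_eq_inner) (metis le_add_same_cancel1 zero_le_power2)
  then show ?thesis by (simp add: power2_le_iff_abs_le)
qed

text \<open>The linear relation among three vectors of the plane. For a curve \<open>y\<close> with
  derivative \<open>z\<close> and a unit vector \<open>u\<close> it shows that
  \<open>wedge2 y u\<close> and \<open>wedge2 z u\<close> cannot both be small while
  \<open>wedge2 y z\<close> is large.\<close>

lemma wedge2_identity: "wedge2 y z *\<^sub>R u = wedge2 u z *\<^sub>R y - wedge2 u y *\<^sub>R z"
  by (simp add: vec_eq_iff forall_2 wedge2_def algebra_simps)

lemma wedge2_eq_0D:
  assumes "wedge2 x y = 0" "x \<noteq> 0"
  shows "\<exists>k. y = k *\<^sub>R x"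
proof -
  have "(x \<bullet> x) *\<^sub>R y = (x \<bullet> y) *\<^sub>R x + wedge2 x y *\<^sub>R vector [- x$2, x$1]"
    by (simp add: vec_eq_iff forall_2 wedge2_def inner_vec_def sum_2 algebra_simps)
  then have "y = ((x \<bullet> y) / (x \<bullet> x)) *\<^sub>R x"
    using assms by (simp add: eq_vector_fraction_iff)
  then show ?thesis ..
qed

lemma bounded_bilinear_wedge2: "bounded_bilinear wedge2"
proof (rule bounded_bilinear.intro)
  show "\<exists>K. \<forall>x y. norm (wedge2 x y) \<le> norm x * norm y * K"
    by (rule exI[of _ 1]) (simp add: abs_wedge2_le)
qed (auto simp: wedge2_def algebra_simps)

text \<open>The location of \<open>z\<close> matters as much as its existence: close to
  \<open>s\<close> the function is still known to be small, so the lower bound on its derivative is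
  available at \<open>z\<close>.\<close>

lemma mean_value_between:
  fixes f f' :: "real \<Rightarrow> real"
  assumes d: "\<And>t. t \<in> {a..b} \<Longrightarrow> (f has_real_derivative f' t) (at t within {a..b})"
    and s: "s \<in> {a..b}" and t: "t \<in> {a..b}"
  shows "\<exists>z\<in>{a..b}. \<bar>z - s\<bar> \<le> \<bar>t - s\<bar> \<and> f t - f s = f' z * (t - s)"
proof -
  have lt: "\<exists>z\<in>{x..y}. f y - f x = f' z * (y - x)" if "x < y" "x \<in> {a..b}" "y \<in> {a..b}" for x y
  proof -
    have "(f has_derivative (*) (f' z)) (at z within {x..y})" if "x \<le> z" "z \<le> y" for z
      using has_field_derivative_subset[OF d[of z], of "{x..y}"] \<open>x \<in> {a..b}\<close> \<open>y \<in> {a..b}\<close> that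
      by (auto simp: has_field_derivative_def)
    from mvt_simple[OF \<open>x < y\<close> this] show ?thesis by (auto intro: less_imp_le)
  qed
  consider "s = t" | "s < t" | "t < s" by linarith
  then show ?thesis
  proof cases
    case 1
    then show ?thesis using s by auto
  next
    case 2
    then obtain z where "z \<in> {s..t}" "f t - f s = f' z * (t - s)" using lt[of s t] s t by blast
    then show ?thesis using s t by (intro bexI[of _ z]) auto
  next
    case 3
    then obtain z where z: "z \<in> {t..s}" "f s - f t = f' z * (s - t)" using lt[of t s] s t by blast
    have "f t - f s = f' z * (t - s)" using z(2) by (simp add: algebra_simps)
    then show ?thesis using s t z(1) by (intro bexI[of _ z]) auto
  qed
qed

text \<open>The interval is cut into pieces so short that on a piece meeting the set one has
  \<^term>\<open>\<bar>f t\<bar> \<le> \<delta>\<close> throughout, hence a large derivative.\<close>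
lemma emeasure_small_values:
  fixes f f' :: "real \<Rightarrow> real"
  assumes d: "\<And>t. t \<in> {a..a+1} \<Longrightarrow> (f has_real_derivative f' t) (at t within {a..a+1})"
    and up: "\<And>t. t \<in> {a..a+1} \<Longrightarrow> \<bar>f' t\<bar> \<le> B"
    and low: "\<And>t. t \<in> {a..a+1} \<Longrightarrow> \<bar>f t\<bar> \<le> \<delta> \<Longrightarrow> \<beta> \<le> \<bar>f' t\<bar>"
    and pos: "0 < \<beta>" "0 < \<delta>" "0 \<le> B" "0 < \<epsilon>"
  shows "emeasure lborel {t\<in>{a..a+1}. \<bar>f t\<bar> \<le> \<epsilon>} \<le> ennreal ((2 / \<delta> + (2 * B / \<delta> + 1) * (4 / \<beta>)) * \<epsilon>)"
proof (cases "\<epsilon> \<le> \<delta> / 2")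
  case False
  have "emeasure lborel {t\<in>{a..a+1}. \<bar>f t\<bar> \<le> \<epsilon>} \<le> emeasure lborel {a..a+1}"
    by (rule emeasure_mono) auto
  also have "\<dots> = ennreal 1" by simp
  also have "\<dots> \<le> ennreal ((2 / \<delta> + (2 * B / \<delta> + 1) * (4 / \<beta>)) * \<epsilon>)"
  proof (rule ennreal_leI)
    \<comment> \<open>For large \<open>\<epsilon>\<close> the summand \<open>2 / \<delta>\<close>
      alone already beats the length 1 of the interval.\<close>
    have "1 \<le> 2 / \<delta> * \<epsilon>" using False pos by (simp add: field_simps)
    moreover have "0 \<le> (2 * B / \<delta> + 1) * (4 / \<beta>) * \<epsilon>" using pos by simp
    ultimately show "1 \<le> (2 / \<delta> + (2 * B / \<delta> + 1) * (4 / \<beta>)) * \<epsilon>"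
      unfolding distrib_right[of "2 / \<delta>"] by linarith
  qed
  finally show ?thesis .
next
  case True
  \<comment> \<open>On a piece of length \<open>1 / real k\<close> the function moves by at most
    \<open>\<delta> / 2\<close>; together with \<open>\<epsilon> \<le> \<delta> / 2\<close> this
    keeps it below \<open>\<delta>\<close> between two points of \<open>S\<close> in that
    piece.\<close>
  define k where "k = Suc (nat \<lfloor>2 * B / \<delta>\<rfloor>)"
  have k0: "0 \<le> 2 * B / \<delta>" using pos by simp
  have k1: "2 * B / \<delta> \<le> real k" "real k \<le> 2 * B / \<delta> + 1" unfolding k_def using k0 by linarith+
  have kpos: "0 < real k" by (simp add: k_def)
  define I where "I i = {a + real i / real k .. a + real (Suc i) / real k}" for i
  define S where "S = {t\<in>{a..a+1}. \<bar>f t\<bar> \<le> \<epsilon>}"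
  have piece: "\<exists>c. S \<inter> I i \<subseteq> {c - 2 * \<epsilon> / \<beta> .. c + 2 * \<epsilon> / \<beta>}" for i
  proof (cases "S \<inter> I i = {}")
    case False
    then obtain c where c: "c \<in> S" "c \<in> I i" by blast
    have "t \<in> {c - 2 * \<epsilon> / \<beta> .. c + 2 * \<epsilon> / \<beta>}" if t: "t \<in> S" "t \<in> I i" for t
    proof -
      have tc: "\<bar>t - c\<bar> \<le> 1 / real k"
        using t(2) c(2) unfolding I_def by (auto simp: add_divide_distrib)
      have "t \<in> {a..a+1}" "c \<in> {a..a+1}" using t c by (auto simp: S_def)
      then obtain z where z: "z \<in> {a..a+1}" "\<bar>z - c\<bar> \<le> \<bar>t - c\<bar>" "f t - f c = f' z * (t - c)"
        using mean_value_between[OF d, of c t] by blast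
      obtain y where y: "y \<in> {a..a+1}" "f z - f c = f' y * (z - c)"
        using mean_value_between[OF d, of c z] z(1) \<open>c \<in> {a..a+1}\<close> by blast
      have "\<bar>f z - f c\<bar> \<le> B * (1 / real k)"
        unfolding y(2) abs_mult using up[OF y(1)] z(2) tc pos by (intro mult_mono) auto
      also have "\<dots> \<le> \<delta> / 2" using k1(1) kpos pos by (simp add: field_simps)
      finally have "\<bar>f z - f c\<bar> \<le> \<delta> / 2" .
      moreover have "\<bar>f c\<bar> \<le> \<epsilon>" using c(1) by (simp add: S_def)
      ultimately have "\<bar>f z\<bar> \<le> \<delta>" using True by linarith
      then have "\<beta> \<le> \<bar>f' z\<bar>" by (rule low[OF z(1)])
      then have "\<beta> * \<bar>t - c\<bar> \<le> \<bar>f t - f c\<bar>" unfolding z(3) abs_mult by (intro mult_right_mono) auto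
      also have "\<dots> \<le> 2 * \<epsilon>" using t(1) c(1) unfolding S_def by auto
      finally have "\<bar>t - c\<bar> \<le> 2 * \<epsilon> / \<beta>" using pos by (simp add: field_simps)
      then show ?thesis by auto
    qed
    then show ?thesis by blast
  qed auto
  have Sub: "S \<subseteq> (\<Union>i<k. S \<inter> I i)"
  proof
    fix t assume t: "t \<in> S"
    then have t01: "0 \<le> t - a" "t - a \<le> 1" by (auto simp: S_def)
    show "t \<in> (\<Union>i<k. S \<inter> I i)"
    proof (cases "t = a + 1")
      case True
      \<comment> \<open>For the right end point the floor used in the other case would give the
        index \<open>k\<close>, which is out of range.\<close>
      have "t \<in> I (k - 1)" unfolding I_def True using kpos by (auto simp: k_def field_simps)
      then show ?thesis using t kpos by (intro UN_I[of "k - 1"]) auto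
    next
      case False
      define i where "i = nat \<lfloor>(t - a) * real k\<rfloor>"
      have nn: "0 \<le> (t - a) * real k" using t01 kpos by simp
      have i1: "real i \<le> (t - a) * real k" "(t - a) * real k \<le> real (Suc i)"
        unfolding i_def using nn by linarith+
      have "(t - a) * real k < 1 * real k" using False t01 kpos by (intro mult_strict_right_mono) auto
      then have "i < k" using i1 by linarith
      moreover have "t \<in> I i" unfolding I_def using i1 kpos by (auto simp: field_simps)
      ultimately show ?thesis using t by blast
    qed
  qed
  obtain c where c: "\<And>i. S \<inter> I i \<subseteq> {c i - 2 * \<epsilon> / \<beta> .. c i + 2 * \<epsilon> / \<beta>}" using piece by metis
  \<comment> \<open>Each piece meets \<open>S\<close> inside an interval of length
    \<open>4 * \<epsilon> / \<beta>\<close>. Monotonicity asks for measurability of these intervals,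
    not of \<open>S\<close>.\<close>
  have "emeasure lborel S \<le> emeasure lborel (\<Union>i<k. {c i - 2 * \<epsilon> / \<beta> .. c i + 2 * \<epsilon> / \<beta>})"
    by (intro emeasure_mono order_trans[OF Sub UN_mono] sets.finite_UN c) auto
  also have "\<dots> \<le> (\<Sum>i<k. emeasure lborel {c i - 2 * \<epsilon> / \<beta> .. c i + 2 * \<epsilon> / \<beta>})"
    by (rule emeasure_subadditive_finite) auto
  also have "\<dots> = (\<Sum>i<k. ennreal (4 * \<epsilon> / \<beta>))"
    using pos by (intro sum.cong refl) (subst emeasure_lborel_Icc, auto simp: field_simps)
  also have "\<dots> = ennreal (real k * (4 * \<epsilon> / \<beta>))"
    using pos by (subst sum_ennreal) auto
  also have "\<dots> \<le> ennreal ((2 / \<delta> + (2 * B / \<delta> + 1) * (4 / \<beta>)) * \<epsilon>)"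
  proof (rule ennreal_leI)
    have "real k * (4 * \<epsilon> / \<beta>) \<le> (2 * B / \<delta> + 1) * (4 * \<epsilon> / \<beta>)"
      using k1 pos by (intro mult_right_mono) auto
    moreover have "0 \<le> 2 / \<delta> * \<epsilon>" using pos by simp
    moreover have "(u + x * (4 / \<beta>)) * \<epsilon> = u * \<epsilon> + x * (4 * \<epsilon> / \<beta>)" for u x
      by (simp add: distrib_right)
    note this[of "2 / \<delta>" "2 * B / \<delta> + 1"]
    ultimately show "real k * (4 * \<epsilon> / \<beta>) \<le> (2 / \<delta> + (2 * B / \<delta> + 1) * (4 / \<beta>)) * \<epsilon>"
      by linarith
  qed
  finally show ?thesis unfolding S_def .
qed

text \<open>The layers begin at height \<open>exp (- b)\<close>, where the assumed bound has used up
  its constant: layer \<open>m\<close> has measure at most \<open>exp (- real m)\<close>. So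
  \<open>b\<close> enters only through the logarithm and costs a square instead of an exponential.
  \<open>C\<close> comes first because it has to serve words of all lengths.\<close>

lemma log_square_moment:
  shows "\<exists>C\<ge>0. \<forall>(f :: real \<Rightarrow> real) b a. f \<in> borel_measurable (restrict_space borel {a..a+1}) \<longrightarrow> 0 \<le> b \<longrightarrow>
    (\<forall>t\<in>{a..a+1}. \<bar>f t\<bar> \<le> exp b) \<longrightarrow>
    (\<forall>\<epsilon>>0. emeasure lborel {t\<in>{a..a+1}. \<bar>f t\<bar> \<le> \<epsilon>} \<le> ennreal (exp b * \<epsilon>)) \<longrightarrow>
    (\<integral>\<^sup>+t. ennreal ((ln \<bar>f t\<bar>)\<^sup>2) * indicator {a..a+1} t \<partial>lborel) \<le> ennreal (C * (1 + b)\<^sup>2)"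
proof -
  define c where "c m = (real m + 1)\<^sup>2 * exp (- real m)" for m
  have sc: "summable c"
  proof (rule summable_comparison_test_bigo)
    have "summable (\<lambda>n. exp (- 1 / 2 :: real) ^ n)" by (rule summable_geometric) simp
    then show "summable (\<lambda>n. norm (exp (- real n / 2)))" by (simp add: exp_of_nat_mult[symmetric])
    show "c \<in> O(\<lambda>n. exp (- real n / 2))" unfolding c_def by real_asymp
  qed
  have c0: "0 \<le> c m" for m by (simp add: c_def)
  show ?thesis
  proof (intro exI[of _ "1 + suminf c"] conjI allI impI)
    show "0 \<le> 1 + suminf c" using suminf_nonneg[OF sc] c0 by simp
    fix f :: "real \<Rightarrow> real" and b a
    assume fm: "f \<in> borel_measurable (restrict_space borel {a..a+1})" and b: "0 \<le> b"
      and up: "\<forall>t\<in>{a..a+1}. \<bar>f t\<bar> \<le> exp b"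
      and sm: "\<forall>\<epsilon>>0. emeasure lborel {t\<in>{a..a+1}. \<bar>f t\<bar> \<le> \<epsilon>} \<le> ennreal (exp b * \<epsilon>)"
    define S where "S m = {t\<in>{a..a+1}. \<bar>f t\<bar> \<le> exp (- b - real m)}" for m :: nat
    have Sm [measurable]: "S m \<in> sets lborel" for m
    proof -
      have "{t \<in> space (restrict_space borel {a..a+1}). \<bar>f t\<bar> \<le> exp (- b - real m)} \<in> sets (restrict_space borel {a..a+1})"
        using fm by measurable
      then have "S m \<in> sets (restrict_space borel {a..a+1})" by (simp add: S_def space_restrict_space)
      then show ?thesis by (simp add: sets_restrict_space_iff)
    qed
    have "(\<integral>\<^sup>+t. ennreal ((ln \<bar>f t\<bar>)\<^sup>2) * indicator {a..a+1} t \<partial>lborel)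
      \<le> (\<integral>\<^sup>+t. ennreal (b\<^sup>2) * indicator {a..a+1} t + (\<Sum>m. ennreal ((b + real m + 1)\<^sup>2) * indicator (S m) t) \<partial>lborel)"
    proof (rule nn_integral_mono)
      fix t
      show "ennreal ((ln \<bar>f t\<bar>)\<^sup>2) * indicator {a..a+1} t
        \<le> ennreal (b\<^sup>2) * indicator {a..a+1} t + (\<Sum>m. ennreal ((b + real m + 1)\<^sup>2) * indicator (S m) t)"
      proof (cases "t \<in> {a..a+1}")
        case t: True
        show ?thesis
        \<comment> \<open>Since \<open>ln 0 = 0\<close>, zeros of \<open>f\<close> fall into the
          case of a bounded logarithm.\<close>
        proof (cases "f t = 0 \<or> - b \<le> ln \<bar>f t\<bar>")
          case True
          have "(ln \<bar>f t\<bar>)\<^sup>2 \<le> b\<^sup>2"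
          proof (cases "f t = 0")
            case False
            then have "ln \<bar>f t\<bar> \<le> ln (exp b)" using up t by (subst ln_le_cancel_iff) auto
            then have "\<bar>ln \<bar>f t\<bar>\<bar> \<le> \<bar>b\<bar>" using True False b by auto
            then show ?thesis by (simp add: abs_le_square_iff)
          qed simp
          then show ?thesis using t by (auto intro!: add_increasing2 ennreal_leI)
        next
          case False
          define m where "m = nat \<lfloor>- ln \<bar>f t\<bar> - b\<rfloor>"
          have m: "real m \<le> - ln \<bar>f t\<bar> - b" "- ln \<bar>f t\<bar> - b \<le> real m + 1"
            unfolding m_def using False by linarith+
          have "\<bar>f t\<bar> = exp (ln \<bar>f t\<bar>)" using False by simp
          also have "\<dots> \<le> exp (- b - real m)" using m by simp
          finally have tS: "t \<in> S m" using t by (simp add: S_def)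
          have "\<bar>ln \<bar>f t\<bar>\<bar> \<le> \<bar>b + real m + 1\<bar>" using m b False by auto
          then have "(ln \<bar>f t\<bar>)\<^sup>2 \<le> (b + real m + 1)\<^sup>2" by (simp add: abs_le_square_iff)
          then have "ennreal ((ln \<bar>f t\<bar>)\<^sup>2) * indicator {a..a+1} t \<le> ennreal ((b + real m + 1)\<^sup>2) * indicator (S m) t"
            using t tS by (simp add: ennreal_leI)
          also have "\<dots> \<le> (\<Sum>m. ennreal ((b + real m + 1)\<^sup>2) * indicator (S m) t)"
          proof -
            have "(\<Sum>k\<in>{m}. g k) \<le> (\<Sum>k. g k)" for g :: "nat \<Rightarrow> ennreal" by (rule sum_le_suminf) auto
            then have "g m \<le> (\<Sum>k. g k)" for g :: "nat \<Rightarrow> ennreal" by simp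
            then show ?thesis .
          qed
          finally show ?thesis by (rule order_trans) simp
        qed
      qed simp
    qed
    also have "\<dots> = ennreal (b\<^sup>2) * emeasure lborel {a..a+1} + (\<Sum>m. ennreal ((b + real m + 1)\<^sup>2) * emeasure lborel (S m))"
      by (simp add: nn_integral_add nn_integral_suminf nn_integral_cmult_indicator Sm[simplified])
    also have "\<dots> \<le> ennreal ((1 + b)\<^sup>2) + (\<Sum>m. ennreal ((1 + b)\<^sup>2 * c m))"
    proof (intro add_mono suminf_le)
      show "ennreal (b\<^sup>2) * emeasure lborel {a..a+1} \<le> ennreal ((1 + b)\<^sup>2)"
        using b by (auto intro!: ennreal_leI power_mono)
      fix m
      have "ennreal ((b + real m + 1)\<^sup>2) * emeasure lborel (S m) \<le> ennreal (((1 + b) * (real m + 1))\<^sup>2) * ennreal (exp (- real m))"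
      proof (intro mult_mono ennreal_leI power_mono)
        have "emeasure lborel (S m) \<le> ennreal (exp b * exp (- b - real m))"
          unfolding S_def using sm by auto
        also have "exp b * exp (- b - real m) = exp (- real m)" by (simp add: exp_add[symmetric])
        finally show "emeasure lborel (S m) \<le> ennreal (exp (- real m))" .
        \<comment> \<open>This separates \<open>b\<close> from \<open>m\<close> and leaves the fixed
          series \<open>c\<close>.\<close>
        show "b + real m + 1 \<le> (1 + b) * (real m + 1)" using b by (simp add: algebra_simps)
      qed (use b in auto)
      also have "\<dots> = ennreal ((1 + b)\<^sup>2 * c m)"
        by (simp add: ennreal_mult[symmetric] c_def power_mult_distrib)
      finally show "ennreal ((b + real m + 1)\<^sup>2) * emeasure lborel (S m) \<le> ennreal ((1 + b)\<^sup>2 * c m)" .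
    qed auto
    also have "(\<Sum>m. ennreal ((1 + b)\<^sup>2 * c m)) = ennreal (\<Sum>m. (1 + b)\<^sup>2 * c m)"
      by (intro suminf_ennreal2 summable_mult sc) (simp add: c0)
    also have "(\<Sum>m. (1 + b)\<^sup>2 * c m) = (1 + b)\<^sup>2 * suminf c" by (rule suminf_mult[OF sc])
    also have "ennreal ((1 + b)\<^sup>2) + ennreal ((1 + b)\<^sup>2 * suminf c) = ennreal ((1 + suminf c) * (1 + b)\<^sup>2)"
      using suminf_nonneg[OF sc c0] by (subst ennreal_plus[symmetric]) (auto simp: algebra_simps)
    finally show "(\<integral>\<^sup>+t. ennreal ((ln \<bar>f t\<bar>)\<^sup>2) * indicator {a..a+1} t \<partial>lborel) \<le> ennreal ((1 + suminf c) * (1 + b)\<^sup>2)" .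
  qed
qed

section \<open>Rotating families of matrices\<close>

lemma rank_one_matrix:
  fixes M :: "real^2^2"
  assumes "rank M = 1"
  shows "\<exists>r c. norm r = 1 \<and> c \<noteq> 0 \<and> (\<forall>x. M *v x = (c \<bullet> x) *\<^sub>R r)"
proof -
  have sub: "subspace (mrange M)"
    unfolding mrange_def by (intro linear_subspace_image) (auto simp: subspace_UNIV)
  have dim: "dim (mrange M) = 1" using assms unfolding mrange_def rank_dim_range .
  obtain B where B: "B \<subseteq> mrange M" "independent B" "mrange M \<subseteq> span B" "card B = dim (mrange M)"
    by (rule basis_exists)
  then obtain b where b: "B = {b}" using dim by (auto simp: card_1_singleton_iff)
  have b0: "b \<noteq> 0" using B(2) b by (auto simp: dependent_zero)
  define r where "r = (1 / norm b) *\<^sub>R b"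
  have r: "norm r = 1" using b0 by (simp add: r_def)
  have par: "M *v x = ((M *v x) \<bullet> r) *\<^sub>R r" for x
  proof -
    have "M *v x \<in> span {b}" using B(3) b unfolding mrange_def by auto
    then obtain k where "M *v x = k *\<^sub>R b" by (auto simp: span_singleton)
    then have "M *v x = (k * norm b) *\<^sub>R r" using b0 by (simp add: r_def)
    moreover have "r \<bullet> r = 1" using r by (simp add: dot_square_norm)
    ultimately show ?thesis by simp
  qed
  define c where "c = transpose M *v r"
  have c: "M *v x = (c \<bullet> x) *\<^sub>R r" for x
  proof -
    have "(M *v x) \<bullet> r = c \<bullet> x"
      unfolding c_def transpose_matrix_vector dot_lmul_matrix by (rule inner_commute)
    then show ?thesis using par[of x] by simp
  qed
  have "c \<noteq> 0"
  proof
    assume "c = 0"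
    then have "mrange M \<subseteq> {0}" using c unfolding mrange_def by auto
    then have "dim (mrange M) = 0" by (simp add: dim_eq_0)
    then show False using dim by simp
  qed
  then show ?thesis using r c by blast
qed

text \<open>A quarter turn, so for nonzero \<open>c\<close> a spanning vector of the kernel of the
  functional with coefficient vector \<open>c\<close>.\<close>

definition perp :: "real^2 \<Rightarrow> real^2" where
  "perp c = vector [- c$2, c$1]"

lemma inner_eq_wedge2_perp: "c \<bullet> y = wedge2 y (perp c)"
  by (simp add: perp_def wedge2_def inner_vec_def sum_2)

lemma perp_nonzero: "c \<noteq> 0 \<Longrightarrow> perp c \<noteq> 0"
  by (auto simp: perp_def vec_eq_iff forall_2)

lemma inner_perp: "c \<bullet> perp c = 0"
  by (simp add: perp_def inner_vec_def sum_2)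

text \<open>Cauchy-Schwarz with weights. The weights will be the lengths of two parts of a word;
  with equal weights each splitting could cost a factor, and a word may be split many times.\<close>

lemma weighted_square_le:
  fixes x y \<alpha> \<beta> :: real
  assumes "0 < \<alpha>" "0 < \<beta>"
  shows "(x + y)\<^sup>2 \<le> (\<alpha> + \<beta>) * (x\<^sup>2 / \<alpha> + y\<^sup>2 / \<beta>)"
proof -
  have "(\<alpha> + \<beta>) * (x\<^sup>2 / \<alpha> + y\<^sup>2 / \<beta>) - (x + y)\<^sup>2 = (\<beta> * x - \<alpha> * y)\<^sup>2 / (\<alpha> * \<beta>)"
    using assms by (simp add: field_simps power2_eq_square)
  also have "\<dots> \<ge> 0" using assms by simp
  finally show ?thesis by linarith
qed

lemma AE_nonzero_of_small_values:
  fixes f :: "real \<Rightarrow> real"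
  assumes "\<And>\<epsilon>. \<epsilon> > 0 \<Longrightarrow> emeasure lborel {t\<in>T. \<bar>f t\<bar> \<le> \<epsilon>} \<le> ennreal (C * \<epsilon>)"
    and f: "continuous_on T f" and T: "closed T"
  shows "AE t in lborel. t \<in> T \<longrightarrow> f t \<noteq> 0"
proof -
  have sets: "{t\<in>T. \<bar>f t\<bar> \<le> \<epsilon>} \<in> sets lborel" for \<epsilon>
  proof -
    have "closed {t\<in>T. \<bar>f t\<bar> \<le> \<epsilon>}"
      using continuous_closed_preimage[OF continuous_on_rabs[OF f] T, of "{..\<epsilon>}"] by (simp add: vimage_def Int_def conj_commute)
    then show ?thesis by simp
  qed
  have le: "emeasure lborel {t\<in>T. \<bar>f t\<bar> \<le> 0} \<le> ennreal (C * (1 / real (Suc n)))" for n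
  proof -
    have "emeasure lborel {t\<in>T. \<bar>f t\<bar> \<le> 0} \<le> emeasure lborel {t\<in>T. \<bar>f t\<bar> \<le> 1 / real (Suc n)}"
      by (rule emeasure_mono) (use sets in \<open>auto intro: order_trans\<close>)
    also have "\<dots> \<le> ennreal (C * (1 / real (Suc n)))" by (rule assms(1)) simp
    finally show ?thesis .
  qed
  have "(\<lambda>n. ennreal (C * (1 / real (Suc n)))) \<longlonglongrightarrow> ennreal (C * 0)"
    by (intro tendsto_ennrealI tendsto_intros LIMSEQ_Suc[OF lim_1_over_n])
  then have "emeasure lborel {t\<in>T. \<bar>f t\<bar> \<le> 0} \<le> ennreal (C * 0)"
    by (rule LIMSEQ_le_const) (use le in auto)
  then have "emeasure lborel {t\<in>T. \<bar>f t\<bar> \<le> 0} = 0" by simp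
  then have "{t\<in>T. \<bar>f t\<bar> \<le> 0} \<in> null_sets lborel" using sets[of 0] by (intro null_setsI) auto
  then show ?thesis by (rule AE_I') auto
qed

locale cocycle_family =
  fixes Sg :: "'a::finite set" and A :: "real \<Rightarrow> 'a \<Rightarrow> real^2^2" and a c0 :: real
  assumes smooth: "\<And>i. smooth_on {a..a+1} (\<lambda>t. A t i)"
    and Mstar: "\<And>t. t \<in> {a..a+1} \<Longrightarrow> in_Mstar Sg (A t)"
    and A1: "\<And>t i. t \<in> {a..a+1} \<Longrightarrow> i \<in> Sg \<Longrightarrow> A t i = A a i"
    and c0_pos: "c0 > 0"
    and A2: "\<And>t j v. t \<in> {a..a+1} \<Longrightarrow> j \<notin> Sg \<Longrightarrow> v \<noteq> 0 \<Longrightarrow>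
       wedge2 (A t j *v v) (vector_derivative (\<lambda>s. A s j *v v) (at t within {a..a+1}))
         / (norm (A t j *v v))\<^sup>2 \<ge> c0"
begin

abbreviation \<Lambda> :: "real set" where "\<Lambda> \<equiv> {a..a+1}"

lemma derivative_exists:
  "\<exists>D. (\<forall>t\<in>\<Lambda>. ((\<lambda>t. A t i) has_vector_derivative D t) (at t within \<Lambda>)) \<and> continuous_on \<Lambda> D"
proof -
  obtain D where D: "D 0 = (\<lambda>t. A t i)" "\<And>n t. t \<in> \<Lambda> \<Longrightarrow> (D n has_vector_derivative D (Suc n) t) (at t within \<Lambda>)"
    using smooth[of i] unfolding smooth_on_def by blast
  \<comment> \<open>Continuity of the first derivative comes from the existence of the
    second.\<close>
  have "continuous_on \<Lambda> (D 1)"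
    by (rule continuous_on_vector_derivative) (rule D(2))
  then show ?thesis using D(2)[of _ 0] D(1) by (intro exI[of _ "D 1"]) auto
qed

definition A' :: "'a \<Rightarrow> real \<Rightarrow> real^2^2" where
  "A' i = (SOME D. (\<forall>t\<in>\<Lambda>. ((\<lambda>t. A t i) has_vector_derivative D t) (at t within \<Lambda>)) \<and> continuous_on \<Lambda> D)"

lemma A'_deriv: "t \<in> \<Lambda> \<Longrightarrow> ((\<lambda>t. A t i) has_vector_derivative A' i t) (at t within \<Lambda>)"
  and A'_cont: "continuous_on \<Lambda> (A' i)"
  using someI_ex[OF derivative_exists[of i]] unfolding A'_def by blast+

lemma A_cont: "continuous_on \<Lambda> (\<lambda>t. A t i)"
  by (rule continuous_on_vector_derivative) (rule A'_deriv)

lemma mv_cont: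
  "continuous_on S f \<Longrightarrow> continuous_on S g \<Longrightarrow> continuous_on S (\<lambda>x. f x *v g x)"
  for f :: "'b::topological_space \<Rightarrow> real^2^2"
  by (rule bounded_bilinear.continuous_on[OF bounded_bilinear_mv])

lemma mv_deriv:
  "(f has_vector_derivative f') (at t within S) \<Longrightarrow> (g has_vector_derivative g') (at t within S) \<Longrightarrow>
    ((\<lambda>x. f x *v g x) has_vector_derivative (f t *v g' + f' *v g t)) (at t within S)"
  for f :: "real \<Rightarrow> real^2^2"
  by (rule bounded_bilinear.has_vector_derivative[OF bounded_bilinear_mv])

lemma rotation_speed:
  assumes t: "t \<in> \<Lambda>" and j: "j \<notin> Sg" and v: "v \<noteq> 0"
  shows "c0 * (norm (A t j *v v))\<^sup>2 \<le> wedge2 (A t j *v v) (A' j t *v v)"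
proof -
  have "((\<lambda>s. A s j *v v) has_vector_derivative (A t j *v 0 + A' j t *v v)) (at t within \<Lambda>)"
    by (rule mv_deriv[OF A'_deriv[OF t]]) simp
  then have "vector_derivative (\<lambda>s. A s j *v v) (at t within \<Lambda>) = A' j t *v v"
    using vector_derivative_within_closed_interval[of a "a+1" t] t by simp
  with A2[OF t j v] have le: "c0 \<le> wedge2 (A t j *v v) (A' j t *v v) / (norm (A t j *v v))\<^sup>2" by simp
  \<comment> \<open>If the norm were zero, the quotient in (A2) would be 0 by the convention for
    division, contradicting \<open>c0 > 0\<close>.\<close>
  then have "(norm (A t j *v v))\<^sup>2 > 0" using c0_pos by (cases "norm (A t j *v v) = 0") auto
  with le show ?thesis by (simp add: pos_le_divide_eq)
qed

lemma det_pos: "t \<in> \<Lambda> \<Longrightarrow> j \<notin> Sg \<Longrightarrow> 0 < det (A t j)"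
  using Mstar[of t] by (auto simp: in_Mstar_def)

lemma upper_bound_letter:
  assumes "continuous_on \<Lambda> D"
  shows "\<exists>M. \<forall>t\<in>\<Lambda>. \<forall>x. norm ((D t :: real^2^2) *v x) \<le> M * norm x"
proof -
  obtain K where K: "\<And>(M::real^2^2) x. norm (M *v x) \<le> norm M * norm x * K" "K > 0"
    using bounded_bilinear.pos_bounded[OF bounded_bilinear_mv] by blast
  have "bounded (D ` \<Lambda>)" by (intro compact_imp_bounded compact_continuous_image assms) simp
  then obtain b where b: "\<And>t. t \<in> \<Lambda> \<Longrightarrow> norm (D t) \<le> b" unfolding bounded_iff by (metis imageI)
  have "norm (D t *v x) \<le> (b * K) * norm x" if "t \<in> \<Lambda>" for t x
  proof -
    have "norm (D t *v x) \<le> norm (D t) * norm x * K" by (rule K)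
    also have "\<dots> \<le> b * norm x * K" using b[OF that] K(2) by (intro mult_right_mono) auto
    finally show ?thesis by (simp add: mult_ac)
  qed
  then show ?thesis by blast
qed

lemma lower_bound_letter:
  assumes j: "j \<notin> Sg"
  shows "\<exists>m>0. \<forall>t\<in>\<Lambda>. \<forall>x. m * norm x \<le> norm (A t j *v x)"
proof -
  let ?S = "\<Lambda> \<times> sphere (0::real^2) 1"
  have "continuous_on ?S (\<lambda>p. A (fst p) j *v snd p)"
    by (intro mv_cont continuous_on_compose2[OF A_cont] continuous_intros) auto
  then have cont: "continuous_on ?S (\<lambda>p. norm (A (fst p) j *v snd p))" by (rule continuous_on_norm)
  have comp: "compact ?S" by (intro compact_Times) auto
  have ne: "?S \<noteq> {}"
  proof -
    have "(a, axis 1 1) \<in> ?S" by simp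
    then show ?thesis by blast
  qed
  obtain p where p: "p \<in> ?S" "\<And>q. q \<in> ?S \<Longrightarrow> norm (A (fst p) j *v snd p) \<le> norm (A (fst q) j *v snd q)"
    using continuous_attains_inf[OF comp ne cont] by blast
  have inj: "A t j *v x \<noteq> 0" if "t \<in> \<Lambda>" "x \<noteq> 0" for t x
  proof -
    have "invertible (A t j)" using det_pos[OF that(1) j] by (simp add: invertible_det_nz)
    then obtain B where "B ** A t j = mat 1" unfolding invertible_def by blast
    then have "x = B *v (A t j *v x)" by (simp add: matrix_vector_mul_assoc)
    then show ?thesis using that(2) by (metis matrix_vector_mult_0_right)
  qed
  define m where "m = norm (A (fst p) j *v snd p)"
  have "fst p \<in> \<Lambda>" "norm (snd p) = 1" using p(1) by (auto simp: mem_Times_iff)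
  moreover from this have "snd p \<noteq> 0" by auto
  ultimately have "m > 0" using inj[of "fst p" "snd p"] by (simp add: m_def)
  moreover have "m * norm x \<le> norm (A t j *v x)" if t: "t \<in> \<Lambda>" for t x
  proof (cases "x = 0")
    case False
    have "m \<le> norm (A t j *v ((1 / norm x) *\<^sub>R x))"
      unfolding m_def using p(2)[of "(t, (1 / norm x) *\<^sub>R x)"] t False by simp
    also have "\<dots> = norm (A t j *v x) / norm x" by (simp add: matrix_vector_mult_scaleR)
    finally show ?thesis using False by (simp add: field_simps)
  qed simp
  ultimately show ?thesis by blast
qed

lemma uniform_bounds:
  "\<exists>M m. 1 \<le> M \<and> 0 < m \<and> m \<le> 1 \<and>
    (\<forall>t\<in>\<Lambda>. \<forall>i x. norm (A t i *v x) \<le> M * norm x \<and> norm (A' i t *v x) \<le> M * norm x) \<and>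
    (\<forall>t\<in>\<Lambda>. \<forall>j x. j \<notin> Sg \<longrightarrow> m * norm x \<le> norm (A t j *v x))"
proof -
  obtain M1 where M1: "\<And>i t x. t \<in> \<Lambda> \<Longrightarrow> norm (A t i *v x) \<le> M1 i * norm x"
    using upper_bound_letter[OF A_cont] by metis
  obtain M2 where M2: "\<And>i t x. t \<in> \<Lambda> \<Longrightarrow> norm (A' i t *v x) \<le> M2 i * norm x"
    using upper_bound_letter[OF A'_cont] by metis
  obtain m1 where m1: "\<And>j t x. j \<notin> Sg \<Longrightarrow> m1 j > 0" "\<And>j t x. j \<notin> Sg \<Longrightarrow> t \<in> \<Lambda> \<Longrightarrow> m1 j * norm x \<le> norm (A t j *v x)"
    using lower_bound_letter by metis
  define M where "M = Max (insert 1 (range M1 \<union> range M2))"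
  define m where "m = Min (insert 1 (m1 ` (- Sg)))"
  have M: "1 \<le> M" "M1 i \<le> M" "M2 i \<le> M" for i unfolding M_def by (rule Max_ge; simp)+
  have m: "0 < m" "m \<le> 1" unfolding m_def using m1(1) by auto
  have mj: "m \<le> m1 j" if "j \<notin> Sg" for j unfolding m_def using that by (intro Min_le) auto
  have up: "norm (A t i *v x) \<le> M * norm x" "norm (A' i t *v x) \<le> M * norm x" if t: "t \<in> \<Lambda>" for t i x
  proof -
    show "norm (A t i *v x) \<le> M * norm x"
      by (rule order_trans[OF M1[OF t]]) (intro mult_right_mono M, simp)
    show "norm (A' i t *v x) \<le> M * norm x"
      by (rule order_trans[OF M2[OF t]]) (intro mult_right_mono M, simp)
  qed
  have low: "m * norm x \<le> norm (A t j *v x)" if t: "t \<in> \<Lambda>" and j: "j \<notin> Sg" for t j x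
    by (rule order_trans[OF _ m1(2)[OF j t]]) (intro mult_right_mono mj[OF j], simp)
  show ?thesis
    using M(1) m up low by (intro exI[of _ M] exI[of _ m]) blast
qed

text \<open>By the product rule the rotation of \<open>A t j *v y t\<close> is the earlier rotation
  times \<open>det (A t j)\<close>, plus the rotation caused by the new letter. The determinant is
  positive, so the first part never works against the second, and the speed \<open>c0\<close>
  survives for all lengths. The empty word stands still, hence the separate clause with 0.\<close>

lemma word_curve:
  "\<exists>M m. 1 \<le> M \<and> 0 < m \<and> m \<le> 1 \<and> (\<forall>w v. set w \<subseteq> - Sg \<longrightarrow> v \<noteq> 0 \<longrightarrow>
    (\<exists>y'. \<forall>t\<in>\<Lambda>. ((\<lambda>t. wordmat (A t) w *v v) has_vector_derivative y' t) (at t within \<Lambda>) \<and>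
      norm (y' t) \<le> real (length w) * M ^ length w * norm v \<and>
      m ^ length w * norm v \<le> norm (wordmat (A t) w *v v) \<and>
      norm (wordmat (A t) w *v v) \<le> M ^ length w * norm v \<and>
      0 \<le> wedge2 (wordmat (A t) w *v v) (y' t) \<and>
      (w \<noteq> [] \<longrightarrow> c0 * (norm (wordmat (A t) w *v v))\<^sup>2 \<le> wedge2 (wordmat (A t) w *v v) (y' t))))"
proof -
  obtain M m where M1: "1 \<le> M" and m: "0 < m" "m \<le> 1"
    and up: "\<And>t i x. t \<in> \<Lambda> \<Longrightarrow> norm (A t i *v x) \<le> M * norm x" "\<And>t i x. t \<in> \<Lambda> \<Longrightarrow> norm (A' i t *v x) \<le> M * norm x"
    and low: "\<And>t j x. t \<in> \<Lambda> \<Longrightarrow> j \<notin> Sg \<Longrightarrow> m * norm x \<le> norm (A t j *v x)"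
    using uniform_bounds by blast
  have "\<exists>y'. \<forall>t\<in>\<Lambda>. ((\<lambda>t. wordmat (A t) w *v v) has_vector_derivative y' t) (at t within \<Lambda>) \<and>
      norm (y' t) \<le> real (length w) * M ^ length w * norm v \<and>
      m ^ length w * norm v \<le> norm (wordmat (A t) w *v v) \<and>
      norm (wordmat (A t) w *v v) \<le> M ^ length w * norm v \<and>
      0 \<le> wedge2 (wordmat (A t) w *v v) (y' t) \<and>
      (w \<noteq> [] \<longrightarrow> c0 * (norm (wordmat (A t) w *v v))\<^sup>2 \<le> wedge2 (wordmat (A t) w *v v) (y' t))"
    if "set w \<subseteq> - Sg" "v \<noteq> 0" for w v
    using that(1)
  proof (induction w rule: rev_induct)
    case Nil
    show ?case by (intro exI[of _ "\<lambda>_. 0"]) (simp add: wedge2_def)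
  next
    case (snoc j w)
    have j: "j \<notin> Sg" and w: "set w \<subseteq> - Sg" using snoc.prems by auto
    define y where "y t = wordmat (A t) w *v v" for t
    define n where "n = length w"
    obtain y' where y': "\<And>t. t \<in> \<Lambda> \<Longrightarrow> (y has_vector_derivative y' t) (at t within \<Lambda>)"
      "\<And>t. t \<in> \<Lambda> \<Longrightarrow> norm (y' t) \<le> real n * M ^ n * norm v"
      "\<And>t. t \<in> \<Lambda> \<Longrightarrow> m ^ n * norm v \<le> norm (y t)"
      "\<And>t. t \<in> \<Lambda> \<Longrightarrow> norm (y t) \<le> M ^ n * norm v"
      "\<And>t. t \<in> \<Lambda> \<Longrightarrow> 0 \<le> wedge2 (y t) (y' t)"
      using snoc.IH[OF w] unfolding y_def n_def by blast
    have eq: "wordmat (A t) (w @ [j]) *v v = A t j *v y t" for t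
      by (simp add: wordmat_append y_def matrix_vector_mul_assoc)
    have len: "length (w @ [j]) = Suc n" by (simp add: n_def)
    show ?case unfolding eq len
    proof (intro exI[of _ "\<lambda>t. A t j *v y' t + A' j t *v y t"] ballI)
      fix t assume t: "t \<in> \<Lambda>"
      have pow: "0 \<le> m ^ n * norm v" using m by simp
      have "0 < m ^ n * norm v" using m that(2) by simp
      then have y0: "y t \<noteq> 0" using y'(3)[OF t] by auto
      have d: "((\<lambda>t. A t j *v y t) has_vector_derivative A t j *v y' t + A' j t *v y t) (at t within \<Lambda>)"
        by (rule mv_deriv[OF A'_deriv[OF t] y'(1)[OF t]])
      have "norm (A t j *v y' t + A' j t *v y t) \<le> norm (A t j *v y' t) + norm (A' j t *v y t)" by (rule norm_triangle_ineq)
      also have "\<dots> \<le> M * norm (y' t) + M * norm (y t)" by (intro add_mono up t)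
      also have "\<dots> \<le> M * (real n * M ^ n * norm v) + M * (M ^ n * norm v)"
        using M1 y'(2,4)[OF t] by (intro add_mono mult_left_mono) auto
      also have "\<dots> = real (Suc n) * M ^ Suc n * norm v" by (simp add: algebra_simps)
      finally have n1: "norm (A t j *v y' t + A' j t *v y t) \<le> real (Suc n) * M ^ Suc n * norm v" .
      have "m ^ Suc n * norm v = m * (m ^ n * norm v)" by simp
      also have "\<dots> \<le> m * norm (y t)" using m y'(3)[OF t] by (intro mult_left_mono) auto
      also have "\<dots> \<le> norm (A t j *v y t)" by (rule low[OF t j])
      finally have n2: "m ^ Suc n * norm v \<le> norm (A t j *v y t)" .
      have "norm (A t j *v y t) \<le> M * norm (y t)" by (rule up(1)[OF t])
      also have "\<dots> \<le> M * (M ^ n * norm v)" using M1 y'(4)[OF t] by (intro mult_left_mono) auto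
      finally have n3: "norm (A t j *v y t) \<le> M ^ Suc n * norm v" by simp
      have "wedge2 (A t j *v y t) (A t j *v y' t + A' j t *v y t)
          = det (A t j) * wedge2 (y t) (y' t) + wedge2 (A t j *v y t) (A' j t *v y t)"
        unfolding wedge2_mult[symmetric] by (rule bounded_bilinear.add_right[OF bounded_bilinear_wedge2])
      moreover have "0 \<le> det (A t j) * wedge2 (y t) (y' t)"
        using det_pos[OF t j] y'(5)[OF t] by simp
      ultimately have n4: "c0 * (norm (A t j *v y t))\<^sup>2 \<le> wedge2 (A t j *v y t) (A t j *v y' t + A' j t *v y t)"
        using rotation_speed[OF t j y0] by linarith
      moreover have "0 \<le> c0 * (norm (A t j *v y t))\<^sup>2" using c0_pos by simp
      ultimately show "((\<lambda>t. A t j *v y t) has_vector_derivative A t j *v y' t + A' j t *v y t) (at t within \<Lambda>) \<and>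
        norm (A t j *v y' t + A' j t *v y t) \<le> real (Suc n) * M ^ Suc n * norm v \<and>
        m ^ Suc n * norm v \<le> norm (A t j *v y t) \<and> norm (A t j *v y t) \<le> M ^ Suc n * norm v \<and>
        0 \<le> wedge2 (A t j *v y t) (A t j *v y' t + A' j t *v y t) \<and>
        (w @ [j] \<noteq> [] \<longrightarrow> c0 * (norm (A t j *v y t))\<^sup>2 \<le> wedge2 (A t j *v y t) (A t j *v y' t + A' j t *v y t))"
        using d n1 n2 n3 by (auto intro: order_trans)
    qed
  qed
  then show ?thesis using M1 m by blast
qed

text \<open>A single exponential rate serves norms and small angles alike. The clause on angles
  excludes the empty word, under which \<open>v\<close> does not turn.\<close>

definition growth_rate :: "real \<Rightarrow> bool" where
  "growth_rate b \<longleftrightarrow> 0 \<le> b \<and> (\<forall>w v. set w \<subseteq> - Sg \<longrightarrow> norm v = 1 \<longrightarrow>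
     (\<forall>t\<in>\<Lambda>. wordmat (A t) w *v v \<noteq> 0 \<and> \<bar>ln (norm (wordmat (A t) w *v v))\<bar> \<le> b * real (length w)) \<and>
     (w \<noteq> [] \<longrightarrow> (\<forall>u \<epsilon>. norm u = 1 \<longrightarrow> 0 < \<epsilon> \<longrightarrow>
        emeasure lborel {t\<in>\<Lambda>. \<bar>wedge2 (wordmat (A t) w *v v) u\<bar> \<le> \<epsilon>} \<le> ennreal (exp (b * real (length w)) * \<epsilon>))))"

lemma growth_rate_exists: "\<exists>b. growth_rate b"
proof -
  obtain M m where M1: "1 \<le> M" and m: "0 < m" "m \<le> 1" and curve: "\<And>w v. set w \<subseteq> - Sg \<Longrightarrow> v \<noteq> 0 \<Longrightarrow>
    (\<exists>y'. \<forall>t\<in>\<Lambda>. ((\<lambda>t. wordmat (A t) w *v v) has_vector_derivative y' t) (at t within \<Lambda>) \<and>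
      norm (y' t) \<le> real (length w) * M ^ length w * norm v \<and>
      m ^ length w * norm v \<le> norm (wordmat (A t) w *v v) \<and>
      norm (wordmat (A t) w *v v) \<le> M ^ length w * norm v \<and>
      0 \<le> wedge2 (wordmat (A t) w *v v) (y' t) \<and>
      (w \<noteq> [] \<longrightarrow> c0 * (norm (wordmat (A t) w *v v))\<^sup>2 \<le> wedge2 (wordmat (A t) w *v v) (y' t)))"
    using word_curve by blast
  \<comment> \<open>As \<open>real n \<le> 2 ^ n\<close>, doubling \<open>M\<close> absorbs the
    factor \<open>real n\<close> in the bound of the derivative.\<close>
  define B where "B = 2 * M"
  define r where "r = 1 / m"
  \<comment> \<open>Collects the coefficients \<open>4 / c0\<close>, \<open>8 / c0\<close> and
    \<open>32 / c0\<^sup>2\<close> of \<open>d1\<close> and \<open>d2\<close> below; the 1 ensures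
    that powers of \<open>\<kappa>\<close> increase.\<close>
  define \<kappa> where "\<kappa> = 1 + 12 / c0 + 32 / c0\<^sup>2"
  define b where "b = ln (\<kappa> * (B\<^sup>2 * r ^ 3))"
  have B1: "1 \<le> B" "M \<le> B" using M1 by (auto simp: B_def)
  have r1: "1 \<le> r" using m by (simp add: r_def)
  have k1: "1 \<le> \<kappa>" using c0_pos by (simp add: \<kappa>_def)
  have Br: "1 \<le> B\<^sup>2 * r ^ 3"
    using mult_mono[of 1 "B\<^sup>2" 1 "r ^ 3"] B1 r1 by (simp add: one_le_power)
  have kBr: "1 \<le> \<kappa> * (B\<^sup>2 * r ^ 3)" using mult_mono[of 1 \<kappa> 1 "B\<^sup>2 * r ^ 3"] k1 Br by simp
  have b0: "0 \<le> b" unfolding b_def using kBr by simp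
  have eb: "exp (b * real n) = \<kappa> ^ n * (B\<^sup>2 * r ^ 3) ^ n" for n
  proof -
    have "exp (b * real n) = (exp b) ^ n" by (subst mult.commute) (rule exp_of_nat_mult)
    also have "exp b = \<kappa> * (B\<^sup>2 * r ^ 3)" unfolding b_def using kBr by (intro exp_ln) linarith
    finally show ?thesis by (simp add: power_mult_distrib)
  qed
  have B_le: "B ^ n \<le> exp (b * real n)" and r_le: "r ^ n \<le> exp (b * real n)" for n
  proof -
    have "B \<le> \<kappa> * (B\<^sup>2 * r ^ 3)"
      using mult_mono[of 1 \<kappa> B "B\<^sup>2 * r ^ 3"] mult_mono[of B "B\<^sup>2" 1 "r ^ 3"] k1 B1 r1
      by (simp add: one_le_power power2_eq_square)
    then have "B ^ n \<le> (\<kappa> * (B\<^sup>2 * r ^ 3)) ^ n" using B1 by (intro power_mono) auto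
    then show "B ^ n \<le> exp (b * real n)" unfolding eb by (simp add: power_mult_distrib)
    have "r ^ 1 \<le> r ^ 3" using r1 by (intro power_increasing) auto
    then have "r \<le> \<kappa> * (B\<^sup>2 * r ^ 3)"
      using mult_mono[of 1 \<kappa> r "B\<^sup>2 * r ^ 3"] mult_mono[of 1 "B\<^sup>2" r "r ^ 3"] k1 B1 r1
      by (simp add: one_le_power)
    then have "r ^ n \<le> (\<kappa> * (B\<^sup>2 * r ^ 3)) ^ n" using r1 by (intro power_mono) auto
    then show "r ^ n \<le> exp (b * real n)" unfolding eb by (simp add: power_mult_distrib)
  qed
  show ?thesis
    unfolding growth_rate_def
  proof (intro exI[of _ b] conjI b0 allI impI)
    fix w v assume w: "set w \<subseteq> - Sg" and v: "norm (v :: real^2) = 1"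
    define n where "n = length w"
    define y where "y t = wordmat (A t) w *v v" for t
    obtain y' where y': "\<And>t. t \<in> \<Lambda> \<Longrightarrow> (y has_vector_derivative y' t) (at t within \<Lambda>)"
      "\<And>t. t \<in> \<Lambda> \<Longrightarrow> norm (y' t) \<le> real n * M ^ n"
      "\<And>t. t \<in> \<Lambda> \<Longrightarrow> m ^ n \<le> norm (y t)"
      "\<And>t. t \<in> \<Lambda> \<Longrightarrow> norm (y t) \<le> M ^ n"
      "\<And>t. t \<in> \<Lambda> \<Longrightarrow> w \<noteq> [] \<Longrightarrow> c0 * (norm (y t))\<^sup>2 \<le> wedge2 (y t) (y' t)"
    proof -
      have "v \<noteq> 0" using v by auto
      then show ?thesis using curve[OF w] that v unfolding y_def n_def by fastforce
    qed
    have mn: "0 < m ^ n" using m by simp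
    have MB: "M ^ n \<le> B ^ n" using B1 M1 by (intro power_mono) auto
    have nM: "real n * M ^ n \<le> B ^ n"
    proof -
      have "real n \<le> 2 ^ n" using of_nat_less_two_power[of n, where 'a=real] by linarith
      then show ?thesis unfolding B_def power_mult_distrib using M1 by (intro mult_right_mono) auto
    qed
    have mr: "m ^ n = 1 / r ^ n" by (simp add: r_def power_divide)
    have y0: "y t \<noteq> 0" if "t \<in> \<Lambda>" for t using y'(3)[OF that] mn by auto
    show "\<forall>t\<in>\<Lambda>. wordmat (A t) w *v v \<noteq> 0 \<and> \<bar>ln (norm (wordmat (A t) w *v v))\<bar> \<le> b * real (length w)"
      unfolding y_def[symmetric] n_def[symmetric]
    proof (intro ballI conjI y0)
      fix t assume t: "t \<in> \<Lambda>"
      have pos: "0 < norm (y t)" using y0[OF t] by simp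
      have "norm (y t) \<le> exp (b * real n)" using y'(4)[OF t] MB B_le[of n] by linarith
      then have "ln (norm (y t)) \<le> ln (exp (b * real n))" using pos by (subst ln_le_cancel_iff) auto
      moreover have "ln (exp (- (b * real n))) \<le> ln (norm (y t))"
      proof (subst ln_le_cancel_iff)
        have "exp (- (b * real n)) = 1 / exp (b * real n)" by (simp add: exp_minus field_simps)
        also have "\<dots> \<le> 1 / r ^ n" using r_le[of n] r1 by (intro divide_left_mono) auto
        also have "\<dots> \<le> norm (y t)" using y'(3)[OF t] mr by simp
        finally show "exp (- (b * real n)) \<le> norm (y t)" .
      qed (use pos in auto)
      ultimately show "\<bar>ln (norm (y t))\<bar> \<le> b * real n" by simp
    qed
    fix u :: "real^2" and \<epsilon> :: real
    assume wne: "w \<noteq> []" and u: "norm u = 1" and e: "0 < \<epsilon>"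
    have n1: "1 \<le> n" using wne by (simp add: n_def Suc_leI)
    define f where "f t = wedge2 (y t) u" for t
    define f' where "f' t = wedge2 (y' t) u" for t
    \<comment> \<open>By \<open>wedge2_identity\<close>, \<open>c0 * (norm (y t))\<^sup>2\<close> is
      at most \<open>\<bar>f' t\<bar> * norm (y t) + \<bar>f t\<bar> * norm (y' t)\<close>. The
      choice of \<open>\<delta>\<close> makes the last term at most half of the left side;
      \<open>\<beta>\<close> is what is left for \<open>f'\<close> after dividing by
      \<open>norm (y t)\<close> and inserting the lower bound \<open>m ^ n\<close>.\<close>
    define \<beta> where "\<beta> = c0 * m ^ n / 2"
    define \<delta> where "\<delta> = c0 * (m ^ n)\<^sup>2 / (2 * B ^ n)"
    have Bn: "0 < B ^ n" using B1 by simp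
    have pos1: "0 < \<beta>" using c0_pos mn by (simp add: \<beta>_def)
    have "0 < c0 * (m ^ n)\<^sup>2" using c0_pos zero_less_power[OF mn, of 2] by (rule mult_pos_pos)
    moreover have "0 < 2 * B ^ n" using Bn by simp
    ultimately have "0 < \<delta>" unfolding \<delta>_def by (rule divide_pos_pos)
    note pos = pos1 this
    have d: "(f has_real_derivative f' t) (at t within \<Lambda>)" if "t \<in> \<Lambda>" for t
    proof -
      have "((\<lambda>t. wedge2 (y t) u) has_vector_derivative (wedge2 (y t) 0 + wedge2 (y' t) u)) (at t within \<Lambda>)"
        by (rule bounded_bilinear.has_vector_derivative[OF bounded_bilinear_wedge2 y'(1)[OF that]]) simp
      then show ?thesis unfolding f_def f'_def
        by (simp add: has_real_derivative_iff_has_vector_derivative bounded_bilinear.zero_right[OF bounded_bilinear_wedge2])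
    qed
    have up: "\<bar>f' t\<bar> \<le> B ^ n" if "t \<in> \<Lambda>" for t
      using abs_wedge2_le[of "y' t" u] u y'(2)[OF that] nM unfolding f'_def by simp
    have low: "\<beta> \<le> \<bar>f' t\<bar>" if t: "t \<in> \<Lambda>" and small: "\<bar>f t\<bar> \<le> \<delta>" for t
    proof -
      have yp: "0 < norm (y t)" using y0[OF t] by simp
      have "norm (wedge2 (y t) (y' t) *\<^sub>R u) \<le> norm (wedge2 u (y' t) *\<^sub>R y t) + norm (wedge2 u (y t) *\<^sub>R y' t)"
        unfolding wedge2_identity[of "y t" "y' t" u] by (rule norm_triangle_ineq4)
      then have "\<bar>wedge2 (y t) (y' t)\<bar> \<le> \<bar>f' t\<bar> * norm (y t) + \<bar>f t\<bar> * norm (y' t)"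
        using u unfolding f_def f'_def wedge2_def by (simp add: abs_minus_commute mult.commute)
      moreover have "\<bar>f t\<bar> * norm (y' t) \<le> \<delta> * B ^ n"
        using small y'(2)[OF t] nM pos by (intro mult_mono) auto
      moreover have "\<delta> * B ^ n = c0 * (m ^ n)\<^sup>2 / 2" using B1 by (simp add: \<delta>_def)
      moreover have "c0 * (m ^ n)\<^sup>2 / 2 \<le> c0 * (m ^ n) * norm (y t) / 2"
        using y'(3)[OF t] c0_pos mn by (simp add: power2_eq_square)
      moreover have "c0 * (m ^ n) * norm (y t) \<le> c0 * (norm (y t))\<^sup>2"
        using y'(3)[OF t] c0_pos yp by (simp add: power2_eq_square)
      moreover have "c0 * (norm (y t))\<^sup>2 \<le> \<bar>wedge2 (y t) (y' t)\<bar>" using y'(5)[OF t wne] by linarith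
      ultimately have "c0 * (m ^ n) * norm (y t) / 2 \<le> \<bar>f' t\<bar> * norm (y t)" by linarith
      then have "\<beta> * norm (y t) \<le> \<bar>f' t\<bar> * norm (y t)" by (simp add: \<beta>_def)
      then show ?thesis using yp by simp
    qed
    have "emeasure lborel {t\<in>\<Lambda>. \<bar>f t\<bar> \<le> \<epsilon>} \<le> ennreal ((2 / \<delta> + (2 * B ^ n / \<delta> + 1) * (4 / \<beta>)) * \<epsilon>)"
      by (rule emeasure_small_values[OF d up low]) (use pos Bn e in auto)
    also have "\<dots> \<le> ennreal (exp (b * real n) * \<epsilon>)"
    proof (intro ennreal_leI mult_right_mono)
      \<comment> \<open>The largest monomial that occurs:
        \<open>B ^ n / (\<delta> * \<beta>)\<close> brings two powers of \<open>B ^ n\<close> and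
        three of \<open>1 / m ^ n\<close>.\<close>
      define X where "X = (B\<^sup>2 * r ^ 3) ^ n"
      have rn: "1 \<le> r ^ n" "1 \<le> B ^ n" using r1 B1 by (auto intro: one_le_power)
      have X: "X = (B ^ n)\<^sup>2 * (r ^ n) ^ 3"
        unfolding X_def by (simp add: power_mult_distrib power_mult[symmetric] mult.commute)
      have X1: "B ^ n * (r ^ n)\<^sup>2 \<le> X"
      proof -
        have "1 \<le> B ^ n * r ^ n" using mult_mono[of 1 "B ^ n" 1 "r ^ n"] rn by simp
        then have "(B ^ n * (r ^ n)\<^sup>2) * 1 \<le> (B ^ n * (r ^ n)\<^sup>2) * (B ^ n * r ^ n)"
          by (rule mult_left_mono) (use Bn in simp)
        then show ?thesis unfolding X by (simp add: power2_eq_square power3_eq_cube mult_ac)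
      qed
      have X2: "r ^ n \<le> X"
      proof -
        have "1 * r ^ n \<le> (B ^ n)\<^sup>2 * (r ^ n) ^ 3"
          using rn power_increasing[of 1 3 "r ^ n"] by (intro mult_mono) (auto simp: one_le_power)
        then show ?thesis unfolding X by simp
      qed
      have d1: "2 / \<delta> = 4 / c0 * (B ^ n * (r ^ n)\<^sup>2)"
        unfolding \<delta>_def mr using c0_pos rn by (simp add: field_simps power2_eq_square)
      have d2: "(2 * B ^ n / \<delta> + 1) * (4 / \<beta>) = 32 / c0\<^sup>2 * X + 8 / c0 * r ^ n"
        unfolding \<delta>_def \<beta>_def mr X using c0_pos rn by (simp add: field_simps power2_eq_square power3_eq_cube)
      have "2 / \<delta> + (2 * B ^ n / \<delta> + 1) * (4 / \<beta>) \<le> 4 / c0 * X + (32 / c0\<^sup>2 * X + 8 / c0 * X)"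
        unfolding d1 d2 using c0_pos X1 X2 by (intro add_mono mult_left_mono) auto
      also have "\<dots> = (12 / c0 + 32 / c0\<^sup>2) * X" by (simp add: algebra_simps add_divide_distrib)
      also have "\<dots> \<le> \<kappa> * X"
        using X2 rn unfolding \<kappa>_def by (intro mult_right_mono) auto
      \<comment> \<open>This is where \<open>n \<ge> 1\<close>, that is, a nonempty word,
        enters.\<close>
      also have "\<dots> \<le> \<kappa> ^ n * X"
        using X2 rn power_increasing[of 1 n \<kappa>] n1 k1 by (intro mult_right_mono) auto
      finally show "2 / \<delta> + (2 * B ^ n / \<delta> + 1) * (4 / \<beta>) \<le> exp (b * real n)" unfolding eb X_def .
    qed (use e in simp)
    finally show "emeasure lborel {t\<in>\<Lambda>. \<bar>wedge2 (wordmat (A t) w *v v) u\<bar> \<le> \<epsilon>} \<le> ennreal (exp (b * real (length w)) * \<epsilon>)"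
      unfolding f_def y_def n_def .
  qed
qed

end

lemma norm_perp [simp]: "norm (perp c) = norm c"
  by (simp add: norm_eq_sqrt_inner perp_def inner_vec_def sum_2 add.commute)

lemma wedge2_scale: "wedge2 (k *\<^sub>R x) y = k * wedge2 x y" "wedge2 x (k *\<^sub>R y) = k * wedge2 x y"
  by (simp_all add: wedge2_def algebra_simps)

lemma inner_eq_0_parallel:
  assumes "c \<noteq> 0" "c \<bullet> x = 0" "c \<bullet> y = 0"
  shows "wedge2 x y = 0"
proof -
  have "(c \<bullet> c) * wedge2 x y = (c \<bullet> x) * wedge2 c y - (c \<bullet> y) * wedge2 c x"
    by (simp add: wedge2_def inner_vec_def sum_2 algebra_simps)
  then show ?thesis using assms by simp
qed

lemma cayley_hamilton_2:
  fixes M :: "real^2^2"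
  shows "M *v (M *v x) = (M$1$1 + M$2$2) *\<^sub>R (M *v x) - det M *\<^sub>R x"
  by (simp add: vec_eq_iff forall_2 matrix_vector_mult_def sum_2 det_2 algebra_simps)

text \<open>If the signs of the normalised entries repeat with period two, Cayley--Hamilton forces an invariant
  line through \<^term>\<open>r\<close> or in the kernel of \<^term>\<open>c\<close>; if they alternate, then \<^term>\<open>M ** M\<close> is a multiple of the identity.\<close>
lemma exact_growth_impossible:
  fixes M :: "real^2^2"
  assumes q: "q > 0" and c: "c \<noteq> 0" and det: "det M > 0"
    and x0: "\<bar>c \<bullet> r\<bar> = q" and x1: "\<bar>c \<bullet> (M *v r)\<bar> = q ^ 2"
    and x2: "\<bar>c \<bullet> (M *v (M *v r))\<bar> = q ^ 3" and x3: "\<bar>c \<bullet> (M *v (M *v (M *v r)))\<bar> = q ^ 4"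
    and t1: "wedge2 (M *v r) r \<noteq> 0" and t2: "wedge2 (M *v perp c) (perp c) \<noteq> 0"
    and t3: "wedge2 (M *v (M *v r)) r \<noteq> 0"
  shows False
proof -
  define y0 where "y0 = (c \<bullet> r) / q"
  define y1 where "y1 = (c \<bullet> (M *v r)) / q ^ 2"
  define y2 where "y2 = (c \<bullet> (M *v (M *v r))) / q ^ 3"
  define y3 where "y3 = (c \<bullet> (M *v (M *v (M *v r)))) / q ^ 4"
  have sgn: "\<bar>y0\<bar> = 1" "\<bar>y1\<bar> = 1" "\<bar>y2\<bar> = 1" "\<bar>y3\<bar> = 1"
    using q x0 x1 x2 x3 by (simp_all add: y0_def y1_def y2_def y3_def)
  have sq: "y0 * y0 = 1" "y1 * y1 = 1" using sgn by (auto simp: abs_if split: if_splits)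
  have e0: "c \<bullet> r = q * y0" and e1: "c \<bullet> (M *v r) = q ^ 2 * y1" and e2: "c \<bullet> (M *v (M *v r)) = q ^ 3 * y2"
    using q by (simp_all add: y0_def y1_def y2_def)
  \<comment> \<open>Trace and determinant of \<open>M\<close> divided by \<open>q\<close>: the
    coefficients of the recurrence for the normalised entries.\<close>
  define T where "T = (M$1$1 + M$2$2) / q"
  define D where "D = det M / q ^ 2"
  have D: "D > 0" using det q by (simp add: D_def)
  have r2: "y2 = T * y1 - D * y0"
    unfolding y2_def cayley_hamilton_2[of M r] T_def D_def y1_def y0_def
    using q by (simp add: inner_diff_right inner_add_right inner_scaleR_right field_simps power2_eq_square power3_eq_cube)
  have r3: "y3 = T * y2 - D * y1"
    unfolding y3_def cayley_hamilton_2[of M "M *v r"] T_def D_def y2_def y1_def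
    using q by (simp add: inner_diff_right inner_add_right inner_scaleR_right field_simps power2_eq_square power3_eq_cube power4_eq_xxxx)
  consider "y2 = y0" | "y2 = - y0" using sgn by (auto simp: abs_if split: if_splits)
  then show False
  proof cases
    case 1
    \<comment> \<open>The vector \<open>z\<close> lies in the kernel of \<open>c\<close>, and
      because of \<open>y2 = y0\<close> so does \<open>M *v z\<close>; it is nonzero by
      \<open>t1\<close>. The kernel line would then be invariant, against \<open>t2\<close>.\<close>
    define z where "z = (1 / q) *\<^sub>R (M *v r) - (y0 * y1) *\<^sub>R r"
    have "c \<bullet> z = (1 / q) * (q ^ 2 * y1) - (y0 * y1) * (q * y0)"
      by (simp add: z_def inner_diff_right e0 e1)
    also have "\<dots> = q * y1 * (1 - y0 * y0)" using q by (simp add: power2_eq_square field_simps)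
    finally have z0: "c \<bullet> z = 0" using sq by simp
    have Mz: "M *v z = (1 / q) *\<^sub>R (M *v (M *v r)) - (y0 * y1) *\<^sub>R (M *v r)"
      by (simp add: z_def matrix_vector_mult_diff_distrib matrix_vector_mult_scaleR)
    have "c \<bullet> (M *v z) = (1 / q) * (q ^ 3 * y2) - (y0 * y1) * (q ^ 2 * y1)"
      by (simp add: Mz inner_diff_right e1 e2)
    also have "\<dots> = q ^ 2 * y0 * (1 - y1 * y1)"
      using q 1 by (simp add: power2_eq_square power3_eq_cube field_simps)
    finally have Mz0: "c \<bullet> (M *v z) = 0" using sq by simp
    have "wedge2 z r = (1 / q) * wedge2 (M *v r) r"
      unfolding z_def by (simp add: wedge2_def algebra_simps)
    then have zne: "z \<noteq> 0" using t1 q by (auto simp: wedge2_def)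
    have pne: "perp c \<noteq> 0" by (rule perp_nonzero[OF c])
    have "wedge2 (perp c) z = 0" by (rule inner_eq_0_parallel[OF c inner_perp z0])
    from wedge2_eq_0D[OF this pne] obtain k where k: "z = k *\<^sub>R perp c" ..
    have "wedge2 (M *v z) z = 0" by (rule inner_eq_0_parallel[OF c Mz0 z0])
    then have "k * (k * wedge2 (M *v perp c) (perp c)) = 0"
      unfolding k by (simp add: matrix_vector_mult_scaleR wedge2_scale)
    then show False using t2 zne k by auto
  next
    case 2
    have T: "T = (D - 1) * (y0 * y1)"
    proof -
      have "T * y1 = (D - 1) * y0" using r2 2 by (simp add: algebra_simps)
      then have "(T * y1) * y1 = (D - 1) * y0 * y1" by simp
      then show ?thesis using sq by (simp add: mult.assoc)
    qed
    have "y3 = - (D - 1) * y1 * (y0 * y0) - D * y1" unfolding r3 2 T by (simp add: algebra_simps)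
    then have "y3 = (1 - 2 * D) * y1" using sq by (simp add: algebra_simps)
    \<comment> \<open>The fourth entry decides: the solutions are \<open>D = 0\<close> and
      \<open>D = 1\<close>, and the determinant is positive. The trace is then zero, so
      \<open>M ** M\<close> is scalar, against \<open>t3\<close>.\<close>
    then have "\<bar>1 - 2 * D\<bar> = 1" using sgn by (simp add: abs_mult)
    then have "D = 1" using D by (auto simp: abs_if split: if_splits)
    then have "M$1$1 + M$2$2 = 0" using T q by (simp add: T_def)
    then have "M *v (M *v r) = - det M *\<^sub>R r" unfolding cayley_hamilton_2[of M r] by simp
    then show False using t3 by (simp add: wedge2_def)
  qed
qed

lemma log_square_measurable:
  fixes g :: "real \<Rightarrow> real"
  assumes "continuous_on {a..b} g"
  shows "(\<lambda>t. ennreal ((ln \<bar>g t\<bar>)\<^sup>2) * indicator {a..b} t) \<in> borel_measurable lborel"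
proof -
  have [measurable]: "g \<in> borel_measurable (restrict_space borel {a..b})"
    by (rule borel_measurable_continuous_on_restrict[OF assms])
  have "(\<lambda>t. ennreal ((ln \<bar>g t\<bar>)\<^sup>2)) \<in> borel_measurable (restrict_space borel {a..b})" by measurable
  then show ?thesis by (subst (asm) borel_measurable_restrict_space_iff_ennreal) auto
qed

text \<open>The last letter is free, hence the exponent \<open>n - 1\<close>; truncated subtraction
  gives the correct mass 1 for the empty word.\<close>

lemma nn_integral_avoiding_butlast:
  "(\<integral>\<^sup>+w. indicator {w. s \<notin> set (butlast w)} w \<partial>replicate_pmf n P) = ennreal ((1 - pmf P s) ^ (n - 1))"
proof (cases n)
  case (Suc k)
  have "(\<integral>\<^sup>+w. indicator {w. s \<notin> set (butlast w)} w \<partial>replicate_pmf (Suc k) P)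
     = (\<integral>\<^sup>+w. \<integral>\<^sup>+a. indicator {w. s \<notin> set w} w \<partial>measure_pmf P \<partial>replicate_pmf k P)"
    unfolding nn_integral_replicate_pmf_snoc by (intro nn_integral_cong) (auto simp: indicator_def)
  also have "\<dots> = ennreal ((1 - pmf P s) ^ k)" by (simp add: nn_integral_avoiding)
  finally show ?thesis by (simp add: Suc del: replicate_pmf.simps)
qed simp

lemma polynomial_geometric_sum_finite:
  assumes p: "0 < p" "p \<le> 1" and C: "0 \<le> C"
  shows "(\<Sum>n. ennreal (C * (1 + real n)\<^sup>2) * ennreal ((1 - p) ^ (n - 1))) < \<top>"
proof -
  have s: "summable (\<lambda>n. C * (1 + real n)\<^sup>2 * (1 - p) ^ (n - 1))"
  proof (cases "p = 1")
    case True
    \<comment> \<open>For \<open>p = 1\<close> truncated subtraction and \<open>0 ^ 0 = 1\<close>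
      leave precisely the terms with index 0 and 1.\<close>
    show ?thesis by (rule summable_finite[of "{0, 1}"]) (auto simp: True)
  next
    case False
    define x where "x = 1 - p"
    have x: "0 < x" "x < 1" using p False by (auto simp: x_def)
    have "summable (\<lambda>n. (1 + real (Suc n))\<^sup>2 * x ^ n)"
    proof (rule summable_comparison_test_bigo)
      define z where "z = (1 + x) / 2"
      have z: "0 < z" "z < 1" "x < z" using x by (auto simp: z_def)
      show "summable (\<lambda>n. norm (z ^ n))" using z by (simp add: power_abs summable_geometric)
      show "(\<lambda>n. (1 + real (Suc n))\<^sup>2 * x ^ n) \<in> O(\<lambda>n. z ^ n)" using x z by real_asymp
    qed
    then have "summable (\<lambda>n. C * ((1 + real (Suc n))\<^sup>2 * x ^ n))" by (rule summable_mult)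
    then have "summable (\<lambda>n. C * (1 + real (Suc n))\<^sup>2 * (1 - p) ^ (Suc n - 1))" by (simp add: x_def mult.assoc)
    then show ?thesis by (subst summable_Suc_iff[symmetric])
  qed
  have "(\<Sum>n. ennreal (C * (1 + real n)\<^sup>2) * ennreal ((1 - p) ^ (n - 1))) = (\<Sum>n. ennreal (C * (1 + real n)\<^sup>2 * (1 - p) ^ (n - 1)))"
    using p C by (intro suminf_cong) (simp add: ennreal_mult)
  also have "\<dots> = ennreal (\<Sum>n. C * (1 + real n)\<^sup>2 * (1 - p) ^ (n - 1))"
    by (rule suminf_ennreal2[OF _ s]) (use p C in simp)
  finally show ?thesis by simp
qed

section \<open>Logarithmic moments and nonvanishing for almost every parameter\<close>

context cocycle_family
begin

text \<open>The two factors of the rank one matrix are chosen at the parameter \<open>a\<close>;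
  (A1) makes the choice valid on the whole interval.\<close>

definition rc :: "'a \<Rightarrow> (real^2) \<times> (real^2)" where
  "rc s = (SOME p. norm (fst p) = 1 \<and> snd p \<noteq> 0 \<and> (\<forall>x. A a s *v x = (snd p \<bullet> x) *\<^sub>R fst p))"

definition rv :: "'a \<Rightarrow> real^2" where "rv s = fst (rc s)"
definition cv :: "'a \<Rightarrow> real^2" where "cv s = snd (rc s)"

lemma rank_one_letter:
  assumes s: "s \<in> Sg"
  shows norm_rv: "norm (rv s) = 1" and cv_nonzero: "cv s \<noteq> 0"
    and sing_apply: "t \<in> \<Lambda> \<Longrightarrow> A t s *v x = (cv s \<bullet> x) *\<^sub>R rv s"
proof -
  have "rank (A a s) = 1" using Mstar[of a] s by (auto simp: in_Mstar_def)
  then obtain r c where "norm r = 1 \<and> c \<noteq> 0 \<and> (\<forall>x. A a s *v x = (c \<bullet> x) *\<^sub>R r)"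
    using rank_one_matrix by blast
  then have "\<exists>p. norm (fst p) = 1 \<and> snd p \<noteq> 0 \<and> (\<forall>x. A a s *v x = (snd p \<bullet> x) *\<^sub>R fst p)"
    by (intro exI[of _ "(r, c)"]) simp
  from someI_ex[OF this] have *: "norm (rv s) = 1 \<and> cv s \<noteq> 0 \<and> (\<forall>x. A a s *v x = (cv s \<bullet> x) *\<^sub>R rv s)"
    unfolding rv_def cv_def rc_def .
  then show "norm (rv s) = 1" "cv s \<noteq> 0" by auto
  show "A t s *v x = (cv s \<bullet> x) *\<^sub>R rv s" if "t \<in> \<Lambda>" using * A1[OF that s] by simp
qed

lemma mrange_sing: "s \<in> Sg \<Longrightarrow> t \<in> \<Lambda> \<Longrightarrow> mrange (A t s) = range (\<lambda>k. k *\<^sub>R rv s)"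
proof (intro equalityI subsetI)
  fix y assume s: "s \<in> Sg" and t: "t \<in> \<Lambda>" and "y \<in> range (\<lambda>k. k *\<^sub>R rv s)"
  then obtain k where k: "y = k *\<^sub>R rv s" by blast
  have "y = A t s *v ((k / (cv s \<bullet> cv s)) *\<^sub>R cv s)"
    unfolding sing_apply[OF s t] k using cv_nonzero[OF s] by simp
  then show "y \<in> mrange (A t s)" unfolding mrange_def by blast
qed (auto simp: mrange_def sing_apply)

text \<open>Otherwise the range of one singular matrix and the kernel of the other would be the same
  line. This handles two singular letters in a row, where no rotation separates range and
  kernel.\<close>

lemma transversality:
  assumes s: "s \<in> Sg" and s': "s' \<in> Sg"
  shows "cv s' \<bullet> rv s \<noteq> 0"
proof
  assume 0: "cv s' \<bullet> rv s = 0"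
  have r: "rv s \<noteq> 0" "rv s' \<noteq> 0" using norm_rv[OF s] norm_rv[OF s'] by auto
  have a: "a \<in> \<Lambda>" by simp
  have "mrange (A a s) = mkernel (A a s')"
  proof (intro equalityI subsetI)
    fix x assume "x \<in> mkernel (A a s')"
    then have "cv s' \<bullet> x = 0" using r by (simp add: mkernel_def sing_apply[OF s' a])
    then have "wedge2 (rv s) x = 0" by (rule inner_eq_0_parallel[OF cv_nonzero[OF s'] 0])
    then show "x \<in> mrange (A a s)" unfolding mrange_sing[OF s a] using wedge2_eq_0D[OF _ r(1)] by blast
  qed (auto simp: mrange_sing[OF s a] mkernel_def sing_apply[OF s' a] 0)
  then show False using Mstar[OF a] s s' unfolding in_Mstar_def by blast
qed

lemma word_cont: "continuous_on \<Lambda> (\<lambda>t. wordmat (A t) w *v v)"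
proof (induction w rule: rev_induct)
  case (snoc j w)
  have "continuous_on \<Lambda> (\<lambda>t. A t j *v (wordmat (A t) w *v v))" by (intro mv_cont A_cont snoc)
  then show ?case by (simp add: wordmat_append matrix_vector_mul_assoc)
qed simp

definition growth :: real where
  "growth = (SOME b. growth_rate b)"

lemma growth_nonneg: "0 \<le> growth"
  and inv_word_nonzero: "set w \<subseteq> - Sg \<Longrightarrow> norm v = 1 \<Longrightarrow> t \<in> \<Lambda> \<Longrightarrow> wordmat (A t) w *v v \<noteq> 0"
  and inv_word_growth: "set w \<subseteq> - Sg \<Longrightarrow> norm v = 1 \<Longrightarrow> t \<in> \<Lambda> \<Longrightarrow>
    \<bar>ln (norm (wordmat (A t) w *v v))\<bar> \<le> growth * real (length w)"
  and inv_word_small_angle: "set w \<subseteq> - Sg \<Longrightarrow> norm v = 1 \<Longrightarrow> w \<noteq> [] \<Longrightarrow> norm u = 1 \<Longrightarrow> 0 < \<epsilon> \<Longrightarrow>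
    emeasure lborel {t\<in>\<Lambda>. \<bar>wedge2 (wordmat (A t) w *v v) u\<bar> \<le> \<epsilon>} \<le> ennreal (exp (growth * real (length w)) * \<epsilon>)"
proof -
  note * = someI_ex[OF growth_rate_exists, folded growth_def, unfolded growth_rate_def]
  show "0 \<le> growth" using * by (rule conjunct1)
  note ** = *[THEN conjunct2, rule_format]
  show "set w \<subseteq> - Sg \<Longrightarrow> norm v = 1 \<Longrightarrow> t \<in> \<Lambda> \<Longrightarrow> wordmat (A t) w *v v \<noteq> 0"
    "set w \<subseteq> - Sg \<Longrightarrow> norm v = 1 \<Longrightarrow> t \<in> \<Lambda> \<Longrightarrow> \<bar>ln (norm (wordmat (A t) w *v v))\<bar> \<le> growth * real (length w)"
    "set w \<subseteq> - Sg \<Longrightarrow> norm v = 1 \<Longrightarrow> w \<noteq> [] \<Longrightarrow> norm u = 1 \<Longrightarrow> 0 < \<epsilon> \<Longrightarrow>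
    emeasure lborel {t\<in>\<Lambda>. \<bar>wedge2 (wordmat (A t) w *v v) u\<bar> \<le> \<epsilon>} \<le> ennreal (exp (growth * real (length w)) * \<epsilon>)"
    using **[of w v] by (simp_all only: simp_thms)
qed

text \<open>The inner product with \<open>cv s'\<close> is small when the vector approaches the
  kernel of the letter \<open>s'\<close>. Rotation controls this for nonempty words; for the empty
  word \<open>transversality\<close> and a maximum over the finite alphabet take its place.\<close>

lemma inv_words_log_moment:
  "\<exists>C\<ge>0. \<forall>w s s'. set w \<subseteq> - Sg \<longrightarrow> s \<in> Sg \<longrightarrow> s' \<in> Sg \<longrightarrow>
    (\<integral>\<^sup>+t. ennreal ((ln \<bar>cv s' \<bullet> (wordmat (A t) w *v rv s)\<bar>)\<^sup>2) * indicator \<Lambda> t \<partial>lborel) \<le> ennreal (C * (1 + real (length w))\<^sup>2) \<and>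
    (AE t in lborel. t \<in> \<Lambda> \<longrightarrow> cv s' \<bullet> (wordmat (A t) w *v rv s) \<noteq> 0)"
proof -
  define b where "b = growth"
  have b: "0 \<le> b" unfolding b_def by (rule growth_nonneg)
  have up: "wordmat (A t) w *v v \<noteq> 0 \<and> \<bar>ln (norm (wordmat (A t) w *v v))\<bar> \<le> b * real (length w)"
    if "set w \<subseteq> - Sg" "norm v = 1" "t \<in> \<Lambda>" for w v t
    using inv_word_nonzero[OF that] inv_word_growth[OF that] unfolding b_def by blast
  note sm = inv_word_small_angle[folded b_def]
  obtain C1 where C1: "0 \<le> C1" and mom: "\<And>(f :: real \<Rightarrow> real) b a. f \<in> borel_measurable (restrict_space borel {a..a+1}) \<Longrightarrow> 0 \<le> b \<Longrightarrow>
    \<forall>t\<in>{a..a+1}. \<bar>f t\<bar> \<le> exp b \<Longrightarrow>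
    \<forall>\<epsilon>>0. emeasure lborel {t\<in>{a..a+1}. \<bar>f t\<bar> \<le> \<epsilon>} \<le> ennreal (exp b * \<epsilon>) \<Longrightarrow>
    (\<integral>\<^sup>+t. ennreal ((ln \<bar>f t\<bar>)\<^sup>2) * indicator {a..a+1} t \<partial>lborel) \<le> ennreal (C1 * (1 + b)\<^sup>2)"
    using log_square_moment by blast
  define d where "d = Max (range (\<lambda>s. \<bar>ln (norm (cv s))\<bar>) \<union> range (\<lambda>(s, s'). \<bar>ln \<bar>cv s' \<bullet> rv s\<bar>\<bar>))"
  have d1: "\<bar>ln (norm (cv s))\<bar> \<le> d" for s unfolding d_def by (rule Max_ge) auto
  have d2: "\<bar>ln \<bar>cv s' \<bullet> rv s\<bar>\<bar> \<le> d" for s s' unfolding d_def by (rule Max_ge) (auto intro!: image_eqI[of _ _ "(s, s')"])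
  have d0: "0 \<le> d" using d1 order_trans abs_ge_zero by blast
  show ?thesis
  \<comment> \<open>The witness rests on \<open>1 + (b * n + d) \<le> (1 + b + d) * (1 + n)\<close>,
    with \<open>n\<close> the length; the 1 added to \<open>C1\<close> pays for the bound
    \<open>d\<^sup>2\<close> of the empty word.\<close>
  proof (intro exI[of _ "(C1 + 1) * (1 + b + d)\<^sup>2"] conjI allI impI)
    show "0 \<le> (C1 + 1) * (1 + b + d)\<^sup>2" using C1 by simp
    fix w s s' assume w: "set w \<subseteq> - Sg" and s: "s \<in> Sg" and s': "s' \<in> Sg"
    define f where "f t = cv s' \<bullet> (wordmat (A t) w *v rv s)" for t
    define n where "n = real (length w)"
    have n0: "0 \<le> n" by (simp add: n_def)
    have cont: "continuous_on \<Lambda> f" unfolding f_def by (intro continuous_intros word_cont)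
    have cpos: "0 < norm (cv s')" using cv_nonzero[OF s'] by simp
    have final: "C1 * (1 + (b * n + d))\<^sup>2 \<le> (C1 + 1) * (1 + b + d)\<^sup>2 * (1 + n)\<^sup>2" "d\<^sup>2 \<le> (C1 + 1) * (1 + b + d)\<^sup>2 * (1 + n)\<^sup>2"
    proof -
      have "1 + (b * n + d) \<le> (1 + b + d) * (1 + n)" using b d0 n0 by (simp add: algebra_simps)
      then have "(1 + (b * n + d))\<^sup>2 \<le> ((1 + b + d) * (1 + n))\<^sup>2" using b d0 n0 by (intro power_mono) auto
      then show "C1 * (1 + (b * n + d))\<^sup>2 \<le> (C1 + 1) * (1 + b + d)\<^sup>2 * (1 + n)\<^sup>2"
        using C1 mult_mono[of C1 "C1 + 1" "(1 + (b * n + d))\<^sup>2" "((1 + b + d) * (1 + n))\<^sup>2"]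
        by (simp add: power_mult_distrib mult.assoc)
      have "d \<le> (1 + b + d) * (1 + n)" using b d0 n0 by (simp add: algebra_simps)
      then have "d\<^sup>2 \<le> ((1 + b + d) * (1 + n))\<^sup>2" using d0 by (intro power_mono) auto
      then show "d\<^sup>2 \<le> (C1 + 1) * (1 + b + d)\<^sup>2 * (1 + n)\<^sup>2"
        using C1 mult_mono[of 1 "C1 + 1" "d\<^sup>2" "((1 + b + d) * (1 + n))\<^sup>2"]
        by (simp add: power_mult_distrib mult.assoc)
    qed
    have small: "emeasure lborel {t\<in>\<Lambda>. \<bar>f t\<bar> \<le> \<epsilon>} \<le> ennreal (exp (b * n + d) * \<epsilon>)" if "w \<noteq> []" "0 < \<epsilon>" for \<epsilon>
    proof -
      define u where "u = (1 / norm (cv s')) *\<^sub>R perp (cv s')"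
      have u: "norm u = 1" using cpos by (simp add: u_def)
      have fu: "f t = norm (cv s') * wedge2 (wordmat (A t) w *v rv s) u" for t
        unfolding f_def u_def inner_eq_wedge2_perp wedge2_scale using cpos by simp
      have "{t\<in>\<Lambda>. \<bar>f t\<bar> \<le> \<epsilon>} = {t\<in>\<Lambda>. \<bar>wedge2 (wordmat (A t) w *v rv s) u\<bar> \<le> \<epsilon> / norm (cv s')}"
        unfolding fu using cpos by (auto simp: abs_mult field_simps)
      also have "emeasure lborel \<dots> \<le> ennreal (exp (b * n) * (\<epsilon> / norm (cv s')))"
        unfolding n_def by (rule sm[OF w norm_rv[OF s] that(1) u]) (use that cpos in simp)
      also have "\<dots> \<le> ennreal (exp (b * n + d) * \<epsilon>)"
      proof (rule ennreal_leI)
        have "1 / norm (cv s') = exp (- ln (norm (cv s')))" using cpos by (simp add: exp_minus field_simps)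
        also have "\<dots> \<le> exp d" using d1[of s'] by simp
        finally have "exp (b * n) * \<epsilon> * (1 / norm (cv s')) \<le> exp (b * n) * \<epsilon> * exp d"
          using that by (intro mult_left_mono) auto
        then show "exp (b * n) * (\<epsilon> / norm (cv s')) \<le> exp (b * n + d) * \<epsilon>" by (simp add: exp_add mult_ac)
      qed
      finally show ?thesis .
    qed
    have "(\<integral>\<^sup>+t. ennreal ((ln \<bar>f t\<bar>)\<^sup>2) * indicator \<Lambda> t \<partial>lborel) \<le> ennreal ((C1 + 1) * (1 + b + d)\<^sup>2 * (1 + n)\<^sup>2)"
    proof (cases "w = []")
      case True
      have "(\<integral>\<^sup>+t. ennreal ((ln \<bar>f t\<bar>)\<^sup>2) * indicator \<Lambda> t \<partial>lborel) = ennreal ((ln \<bar>cv s' \<bullet> rv s\<bar>)\<^sup>2)"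
        by (simp add: f_def True nn_integral_cmult_indicator)
      also have "(ln \<bar>cv s' \<bullet> rv s\<bar>)\<^sup>2 \<le> d\<^sup>2" using d2[of s' s] d0 by (simp add: abs_le_square_iff[symmetric])
      finally show ?thesis using final(2) by (meson ennreal_leI order_trans)
    next
      case False
      have "(\<integral>\<^sup>+t. ennreal ((ln \<bar>f t\<bar>)\<^sup>2) * indicator \<Lambda> t \<partial>lborel) \<le> ennreal (C1 * (1 + (b * n + d))\<^sup>2)"
      proof (rule mom)
        show "f \<in> borel_measurable (restrict_space borel \<Lambda>)"
          by (rule borel_measurable_continuous_on_restrict[OF cont])
        show "0 \<le> b * n + d" using b n0 d0 by simp
        show "\<forall>t\<in>\<Lambda>. \<bar>f t\<bar> \<le> exp (b * n + d)"
        proof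
          fix t assume t: "t \<in> \<Lambda>"
          have "\<bar>f t\<bar> \<le> norm (cv s') * norm (wordmat (A t) w *v rv s)"
            unfolding f_def by (rule Cauchy_Schwarz_ineq2)
          also have "norm (cv s') = exp (ln (norm (cv s')))" using cpos by simp
          also have "norm (wordmat (A t) w *v rv s) = exp (ln (norm (wordmat (A t) w *v rv s)))"
            using up[OF w norm_rv[OF s] t] by simp
          also have "exp (ln (norm (cv s'))) * exp (ln (norm (wordmat (A t) w *v rv s))) \<le> exp d * exp (b * n)"
            using d1[of s'] up[OF w norm_rv[OF s] t] unfolding n_def
            by (intro mult_mono exp_le_cancel_iff[THEN iffD2] exp_ge_zero) auto
          finally show "\<bar>f t\<bar> \<le> exp (b * n + d)" by (simp add: exp_add mult.commute)
        qed
      qed (use small[OF False] in blast)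
      then show ?thesis using final(1) by (meson ennreal_leI order_trans)
    qed
    then show "(\<integral>\<^sup>+t. ennreal ((ln \<bar>cv s' \<bullet> (wordmat (A t) w *v rv s)\<bar>)\<^sup>2) * indicator \<Lambda> t \<partial>lborel)
        \<le> ennreal ((C1 + 1) * (1 + b + d)\<^sup>2 * (1 + real (length w))\<^sup>2)" unfolding f_def n_def .
    show "AE t in lborel. t \<in> \<Lambda> \<longrightarrow> cv s' \<bullet> (wordmat (A t) w *v rv s) \<noteq> 0"
    proof (cases "w = []")
      case True
      then show ?thesis using transversality[OF s s'] by simp
    next
      case False
      show ?thesis
        using AE_nonzero_of_small_values[OF small[OF False] cont] unfolding f_def by simp
    qed
  qed
qed

lemma AE_transverse:
  assumes w: "set w \<subseteq> - Sg" "w \<noteq> []" and v: "v \<noteq> 0" and u: "u \<noteq> 0"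
  shows "AE t in lborel. t \<in> \<Lambda> \<longrightarrow> wedge2 (wordmat (A t) w *v v) u \<noteq> 0"
proof -
  let ?v = "(1 / norm v) *\<^sub>R v" and ?u = "(1 / norm u) *\<^sub>R u"
  have "AE t in lborel. t \<in> \<Lambda> \<longrightarrow> wedge2 (wordmat (A t) w *v ?v) ?u \<noteq> 0"
  proof (rule AE_nonzero_of_small_values)
    show "emeasure lborel {t\<in>\<Lambda>. \<bar>wedge2 (wordmat (A t) w *v ?v) ?u\<bar> \<le> \<epsilon>} \<le> ennreal (exp (growth * real (length w)) * \<epsilon>)" if "0 < \<epsilon>" for \<epsilon>
      by (rule inv_word_small_angle[OF w(1) _ w(2) _ that]) (use u v in auto)
    show "continuous_on \<Lambda> (\<lambda>t. wedge2 (wordmat (A t) w *v ?v) ?u)"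
      by (rule bounded_bilinear.continuous_on[OF bounded_bilinear_wedge2 word_cont]) simp
  qed simp
  then show ?thesis
    by eventually_elim (auto simp: matrix_vector_mult_scaleR wedge2_scale)
qed

lemma wordmat_split_sing:
  assumes "s \<in> Sg" "t \<in> \<Lambda>"
  shows "wordmat (A t) (w1 @ s # w2) *v v = (cv s \<bullet> (wordmat (A t) w1 *v v)) *\<^sub>R (wordmat (A t) w2 *v rv s)"
proof -
  have "wordmat (A t) (w1 @ s # w2) *v v = wordmat (A t) w2 *v (A t s *v (wordmat (A t) w1 *v v))"
    by (simp add: wordmat_append matrix_vector_mul_assoc matrix_mul_assoc)
  then show ?thesis by (simp add: sing_apply[OF assms] matrix_vector_mult_scaleR)
qed

text \<open>Induction on the length, splitting at the first singular letter. With weights equal to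
  the lengths of the parts, \<open>weighted_square_le\<close> returns \<open>(\<alpha> + \<beta>) *
  (C * \<alpha> + C * \<beta>) = C * (\<alpha> + \<beta>)\<^sup>2\<close>: the quadratic bound
  reproduces itself with the same \<open>C\<close>.\<close>

lemma words_log_moment:
  "\<exists>C\<ge>0. \<forall>w s. s \<in> Sg \<longrightarrow>
    (\<integral>\<^sup>+t. ennreal ((ln (norm (wordmat (A t) w *v rv s)))\<^sup>2) * indicator \<Lambda> t \<partial>lborel) \<le> ennreal (C * (1 + real (length w))\<^sup>2)"
proof -
  define b where "b = growth"
  have b: "0 \<le> b" unfolding b_def by (rule growth_nonneg)
  have up: "wordmat (A t) w *v v \<noteq> 0 \<and> \<bar>ln (norm (wordmat (A t) w *v v))\<bar> \<le> b * real (length w)"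
    if "set w \<subseteq> - Sg" "norm v = 1" "t \<in> \<Lambda>" for w v t
    using inv_word_nonzero[OF that] inv_word_growth[OF that] unfolding b_def by blast
  obtain C0 where C0: "0 \<le> C0" and inv: "\<And>w s s'. set w \<subseteq> - Sg \<Longrightarrow> s \<in> Sg \<Longrightarrow> s' \<in> Sg \<Longrightarrow>
    (\<integral>\<^sup>+t. ennreal ((ln \<bar>cv s' \<bullet> (wordmat (A t) w *v rv s)\<bar>)\<^sup>2) * indicator \<Lambda> t \<partial>lborel) \<le> ennreal (C0 * (1 + real (length w))\<^sup>2)"
    using inv_words_log_moment by blast
  define C where "C = C0 + b\<^sup>2"
  have C: "0 \<le> C" "C0 \<le> C" "b\<^sup>2 \<le> C" using C0 by (auto simp: C_def)
  let ?N = "\<lambda>w s t. ln (norm (wordmat (A t) w *v rv s))"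
  have meas: "(\<lambda>t. ennreal ((?N w s t)\<^sup>2) * indicator \<Lambda> t) \<in> borel_measurable lborel" for w s
    using log_square_measurable[OF continuous_on_norm[OF word_cont[of w "rv s"]]] by simp
  have "(\<integral>\<^sup>+t. ennreal ((?N w s t)\<^sup>2) * indicator \<Lambda> t \<partial>lborel) \<le> ennreal (C * (1 + real (length w))\<^sup>2)" if "s \<in> Sg" for w s
    using that
  proof (induction "length w" arbitrary: w s rule: less_induct)
    case less
    show ?case
    proof (cases "set w \<subseteq> - Sg")
      case True
      have "(\<integral>\<^sup>+t. ennreal ((?N w s t)\<^sup>2) * indicator \<Lambda> t \<partial>lborel)
        \<le> (\<integral>\<^sup>+t. ennreal (C * (1 + real (length w))\<^sup>2) * indicator \<Lambda> t \<partial>lborel)"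
      proof (rule nn_integral_mono)
        fix t
        show "ennreal ((?N w s t)\<^sup>2) * indicator \<Lambda> t \<le> ennreal (C * (1 + real (length w))\<^sup>2) * indicator \<Lambda> t"
        proof (cases "t \<in> \<Lambda>")
          case t: True
          have "\<bar>?N w s t\<bar> \<le> b * (1 + real (length w))"
            using up[OF True norm_rv[OF less.prems] t] b by (simp add: distrib_left)
          then have "(?N w s t)\<^sup>2 \<le> (b * (1 + real (length w)))\<^sup>2" using b by (intro abs_le_square_iff[THEN iffD1]) simp
          also have "\<dots> \<le> C * (1 + real (length w))\<^sup>2"
            unfolding power_mult_distrib using C by (intro mult_right_mono) auto
          finally show ?thesis by (intro mult_right_mono ennreal_leI) auto
        qed simp
      qed
      also have "\<dots> = ennreal (C * (1 + real (length w))\<^sup>2)" by (simp add: nn_integral_cmult_indicator)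
      finally show ?thesis .
    next
      case False
      then have "\<exists>x\<in>set w. x \<in> Sg" by blast
      from split_list_first_prop[OF this] obtain w1 s' w2 where w: "w = w1 @ s' # w2" "s' \<in> Sg" "\<forall>y\<in>set w1. y \<notin> Sg" by blast
      have w1: "set w1 \<subseteq> - Sg" using w(3) by blast
      \<comment> \<open>Both weights carry an extra 1; the singular letter between the parts
        provides the second, so that \<open>\<alpha> + \<beta>\<close> is
        \<open>1 + real (length w)\<close>.\<close>
      define \<alpha> where "\<alpha> = 1 + real (length w1)"
      define \<beta> where "\<beta> = 1 + real (length w2)"
      have ab: "0 < \<alpha>" "0 < \<beta>" "\<alpha> + \<beta> = 1 + real (length w)" by (auto simp: \<alpha>_def \<beta>_def w(1))
      have nn: "0 \<le> (\<alpha> + \<beta>) / \<alpha>" "0 \<le> (\<alpha> + \<beta>) / \<beta>" using ab(1,2) by auto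
      let ?f = "\<lambda>t. ln \<bar>cv s' \<bullet> (wordmat (A t) w1 *v rv s)\<bar>"
      have fm: "(\<lambda>t. ennreal ((?f t)\<^sup>2) * indicator \<Lambda> t) \<in> borel_measurable lborel"
        by (rule log_square_measurable) (intro continuous_intros word_cont)
      have "(\<integral>\<^sup>+t. ennreal ((?N w s t)\<^sup>2) * indicator \<Lambda> t \<partial>lborel)
        \<le> (\<integral>\<^sup>+t. ennreal ((\<alpha> + \<beta>) / \<alpha>) * (ennreal ((?f t)\<^sup>2) * indicator \<Lambda> t)
            + ennreal ((\<alpha> + \<beta>) / \<beta>) * (ennreal ((?N w2 s' t)\<^sup>2) * indicator \<Lambda> t) \<partial>lborel)"
      proof (rule nn_integral_mono)
        fix t
        show "ennreal ((?N w s t)\<^sup>2) * indicator \<Lambda> t \<le> ennreal ((\<alpha> + \<beta>) / \<alpha>) * (ennreal ((?f t)\<^sup>2) * indicator \<Lambda> t)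
            + ennreal ((\<alpha> + \<beta>) / \<beta>) * (ennreal ((?N w2 s' t)\<^sup>2) * indicator \<Lambda> t)"
        proof (cases "t \<in> \<Lambda>")
          case t: True
          define k where "k = cv s' \<bullet> (wordmat (A t) w1 *v rv s)"
          define z where "z = norm (wordmat (A t) w2 *v rv s')"
          have nz: "norm (wordmat (A t) w *v rv s) = \<bar>k\<bar> * z"
            unfolding w(1) wordmat_split_sing[OF w(2) t] k_def z_def by simp
          have z0: "0 \<le> z" by (simp add: z_def)
          have "(ln (\<bar>k\<bar> * z))\<^sup>2 \<le> (\<alpha> + \<beta>) * ((ln \<bar>k\<bar>)\<^sup>2 / \<alpha> + (ln z)\<^sup>2 / \<beta>)"
          \<comment> \<open>With \<open>ln 0 = 0\<close> the estimate holds even where the product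
            vanishes; that this happens for almost no parameter is shown separately in
            \<open>AE_nonvanishing\<close>.\<close>
          proof (cases "k = 0 \<or> z = 0")
            case True
            then have "ln (\<bar>k\<bar> * z) = 0" by auto
            then show ?thesis using ab by simp
          next
            case False
            then have "ln (\<bar>k\<bar> * z) = ln \<bar>k\<bar> + ln z" using z0 by (simp add: ln_mult)
            then show ?thesis using weighted_square_le[OF ab(1,2)] by simp
          qed
          also have "\<dots> = (\<alpha> + \<beta>) / \<alpha> * (ln \<bar>k\<bar>)\<^sup>2 + (\<alpha> + \<beta>) / \<beta> * (ln z)\<^sup>2" by (simp add: distrib_left)
          finally have "ennreal ((ln (\<bar>k\<bar> * z))\<^sup>2) \<le> ennreal ((\<alpha> + \<beta>) / \<alpha> * (ln \<bar>k\<bar>)\<^sup>2 + (\<alpha> + \<beta>) / \<beta> * (ln z)\<^sup>2)"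
            by (rule ennreal_leI)
          also have "\<dots> = ennreal ((\<alpha> + \<beta>) / \<alpha>) * ennreal ((ln \<bar>k\<bar>)\<^sup>2) + ennreal ((\<alpha> + \<beta>) / \<beta>) * ennreal ((ln z)\<^sup>2)"
            by (simp only: ennreal_mult[symmetric] ennreal_plus[symmetric] nn zero_le_power2 mult_nonneg_nonneg)
          finally show ?thesis using t by (simp add: nz k_def z_def)
        qed simp
      qed
      also have "\<dots> = ennreal ((\<alpha> + \<beta>) / \<alpha>) * (\<integral>\<^sup>+t. ennreal ((?f t)\<^sup>2) * indicator \<Lambda> t \<partial>lborel)
          + ennreal ((\<alpha> + \<beta>) / \<beta>) * (\<integral>\<^sup>+t. ennreal ((?N w2 s' t)\<^sup>2) * indicator \<Lambda> t \<partial>lborel)"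
        using fm meas[of w2 s'] by (simp add: nn_integral_add nn_integral_cmult)
      also have "\<dots> \<le> ennreal ((\<alpha> + \<beta>) / \<alpha>) * ennreal (C * \<alpha>\<^sup>2) + ennreal ((\<alpha> + \<beta>) / \<beta>) * ennreal (C * \<beta>\<^sup>2)"
      proof (intro add_mono mult_left_mono)
        have "(\<integral>\<^sup>+t. ennreal ((?f t)\<^sup>2) * indicator \<Lambda> t \<partial>lborel) \<le> ennreal (C0 * \<alpha>\<^sup>2)"
          unfolding \<alpha>_def by (rule inv[OF w1 less.prems w(2)])
        also have "\<dots> \<le> ennreal (C * \<alpha>\<^sup>2)" using C by (intro ennreal_leI mult_right_mono) auto
        finally show "(\<integral>\<^sup>+t. ennreal ((?f t)\<^sup>2) * indicator \<Lambda> t \<partial>lborel) \<le> ennreal (C * \<alpha>\<^sup>2)" .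
        show "(\<integral>\<^sup>+t. ennreal ((?N w2 s' t)\<^sup>2) * indicator \<Lambda> t \<partial>lborel) \<le> ennreal (C * \<beta>\<^sup>2)"
          unfolding \<beta>_def by (rule less.hyps[OF _ w(2)]) (simp add: w(1))
      qed auto
      also have "\<dots> = ennreal ((\<alpha> + \<beta>) / \<alpha> * (C * \<alpha>\<^sup>2) + (\<alpha> + \<beta>) / \<beta> * (C * \<beta>\<^sup>2))"
        by (simp only: ennreal_mult[symmetric] ennreal_plus[symmetric] nn zero_le_power2 mult_nonneg_nonneg C(1))
      also have "(\<alpha> + \<beta>) / \<alpha> * (C * \<alpha>\<^sup>2) + (\<alpha> + \<beta>) / \<beta> * (C * \<beta>\<^sup>2) = C * (\<alpha> + \<beta>)\<^sup>2"
        using ab(1,2) by (simp add: power2_eq_square field_simps)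
      finally show ?thesis unfolding ab(3) .
    qed
  qed
  then show ?thesis using C by blast
qed

text \<open>There are countably many words, so the exceptional sets of all invertible words form one
  null set. Outside it, every word is treated by splitting at its singular letters.\<close>

lemma AE_nonvanishing:
  "AE t in lborel. t \<in> \<Lambda> \<longrightarrow> (\<forall>w s. s \<in> Sg \<longrightarrow> wordmat (A t) w *v rv s \<noteq> 0)"
proof -
  have "AE t in lborel. \<forall>w s s'. set w \<subseteq> - Sg \<longrightarrow> s \<in> Sg \<longrightarrow> s' \<in> Sg \<longrightarrow> t \<in> \<Lambda> \<longrightarrow> cv s' \<bullet> (wordmat (A t) w *v rv s) \<noteq> 0"
    unfolding AE_all_countable
  proof (intro allI)
    fix w s s'
    show "AE t in lborel. set w \<subseteq> - Sg \<longrightarrow> s \<in> Sg \<longrightarrow> s' \<in> Sg \<longrightarrow> t \<in> \<Lambda> \<longrightarrow> cv s' \<bullet> (wordmat (A t) w *v rv s) \<noteq> 0"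
      using inv_words_log_moment by (cases "set w \<subseteq> - Sg \<and> s \<in> Sg \<and> s' \<in> Sg") auto
  qed
  then show ?thesis
  proof eventually_elim
    case (elim t)
    have "wordmat (A t) w *v rv s \<noteq> 0" if t: "t \<in> \<Lambda>" and s: "s \<in> Sg" for w s
      using s
    proof (induction "length w" arbitrary: w s rule: less_induct)
      case less
      show ?case
      proof (cases "set w \<subseteq> - Sg")
        case True
        then show ?thesis by (rule inv_word_nonzero[OF _ norm_rv[OF less.prems] t])
      next
        case False
        then have "\<exists>x\<in>set w. x \<in> Sg" by blast
        from split_list_first_prop[OF this] obtain w1 s' w2 where w: "w = w1 @ s' # w2" "s' \<in> Sg" "\<forall>y\<in>set w1. y \<notin> Sg" by blast
        have "cv s' \<bullet> (wordmat (A t) w1 *v rv s) \<noteq> 0" using elim w less.prems t by blast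
        moreover have "wordmat (A t) w2 *v rv s' \<noteq> 0" by (rule less.hyps[OF _ w(2)]) (simp add: w(1))
        ultimately show ?thesis unfolding w(1) wordmat_split_sing[OF w(2) t] by simp
      qed
    qed
    then show ?case by blast
  qed
qed

text \<open>Tonelli: the sum over words is integrated over \<open>t\<close> term by term, and a
  function with finite integral is finite almost everywhere.\<close>

lemma AE_moment_finite:
  fixes P :: "'a pmf"
  assumes s: "s \<in> Sg" and p: "pmf P s > 0"
  shows "AE t in lborel. t \<in> \<Lambda> \<longrightarrow> (\<Sum>n. \<integral>\<^sup>+w. indicator {w. s \<notin> set (butlast w)} w *
    ennreal ((ln (norm (wordmat (A t) w *v rv s)))\<^sup>2) \<partial>replicate_pmf n P) < \<top>"
proof -
  obtain C where C: "0 \<le> C" and mom: "\<And>w. (\<integral>\<^sup>+t. ennreal ((ln (norm (wordmat (A t) w *v rv s)))\<^sup>2) * indicator \<Lambda> t \<partial>lborel)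
      \<le> ennreal (C * (1 + real (length w))\<^sup>2)"
    using words_log_moment s by blast
  define g where "g w t = ennreal ((ln (norm (wordmat (A t) w *v rv s)))\<^sup>2) * indicator \<Lambda> t" for w t
  let ?I = "\<lambda>w. indicator {w. s \<notin> set (butlast w)} w :: ennreal"
  let ?W = "\<lambda>n. set_pmf (replicate_pmf n P)"
  have gm [measurable]: "g w \<in> borel_measurable borel" for w
    using log_square_measurable[OF continuous_on_norm[OF word_cont[of w "rv s"]]] by (simp add: g_def[abs_def])
  \<comment> \<open>Over a finite alphabet the inner integral is a finite sum, which gives
    measurability in \<open>t\<close> and the exchange of integrals at no cost.\<close>
  have finite_sum: "(\<integral>\<^sup>+w. f w \<partial>replicate_pmf n P) = (\<Sum>w\<in>?W n. f w * ennreal (pmf (replicate_pmf n P) w))" for f n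
    by (rule nn_integral_measure_pmf_finite[OF finite_set_replicate_pmf]) simp
  have m: "(\<lambda>t. \<integral>\<^sup>+w. ?I w * g w t \<partial>replicate_pmf n P) \<in> borel_measurable lborel" for n
    unfolding finite_sum by measurable
  have "(\<integral>\<^sup>+t. (\<Sum>n. \<integral>\<^sup>+w. ?I w * g w t \<partial>replicate_pmf n P) \<partial>lborel)
     = (\<Sum>n. \<integral>\<^sup>+t. (\<integral>\<^sup>+w. ?I w * g w t \<partial>replicate_pmf n P) \<partial>lborel)"
    by (rule nn_integral_suminf[OF m])
  also have "\<dots> \<le> (\<Sum>n. ennreal (C * (1 + real n)\<^sup>2) * ennreal ((1 - pmf P s) ^ (n - 1)))"
  proof (intro suminf_le)
    fix n
    have "(\<integral>\<^sup>+t. (\<integral>\<^sup>+w. ?I w * g w t \<partial>replicate_pmf n P) \<partial>lborel)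
       = (\<Sum>w\<in>?W n. \<integral>\<^sup>+t. ?I w * g w t * ennreal (pmf (replicate_pmf n P) w) \<partial>lborel)"
      unfolding finite_sum by (intro nn_integral_sum) measurable
    also have "\<dots> = (\<Sum>w\<in>?W n. ?I w * (\<integral>\<^sup>+t. g w t \<partial>lborel) * ennreal (pmf (replicate_pmf n P) w))"
      by (intro sum.cong refl) (subst nn_integral_multc, measurable, subst nn_integral_cmult, auto)
    also have "\<dots> \<le> (\<Sum>w\<in>?W n. ?I w * ennreal (C * (1 + real n)\<^sup>2) * ennreal (pmf (replicate_pmf n P) w))"
    proof (intro sum_mono mult_right_mono mult_left_mono)
      fix w assume "w \<in> ?W n"
      then have "length w = n" by (auto simp: set_replicate_pmf)
      then show "(\<integral>\<^sup>+t. g w t \<partial>lborel) \<le> ennreal (C * (1 + real n)\<^sup>2)" using mom[of w] by (simp add: g_def)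
    qed auto
    also have "\<dots> = (\<integral>\<^sup>+w. ?I w * ennreal (C * (1 + real n)\<^sup>2) \<partial>replicate_pmf n P)" by (simp only: finite_sum)
    also have "\<dots> = (\<integral>\<^sup>+w. ?I w \<partial>replicate_pmf n P) * ennreal (C * (1 + real n)\<^sup>2)" by (rule nn_integral_multc) simp
    also have "\<dots> = ennreal (C * (1 + real n)\<^sup>2) * ennreal ((1 - pmf P s) ^ (n - 1))"
      unfolding nn_integral_avoiding_butlast by (rule mult.commute)
    finally show "(\<integral>\<^sup>+t. (\<integral>\<^sup>+w. ?I w * g w t \<partial>replicate_pmf n P) \<partial>lborel)
       \<le> ennreal (C * (1 + real n)\<^sup>2) * ennreal ((1 - pmf P s) ^ (n - 1))" .
  qed auto
  also have "\<dots> < \<top>" by (rule polynomial_geometric_sum_finite[OF p pmf_le_1 C])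
  finally have "AE t in lborel. (\<Sum>n. \<integral>\<^sup>+w. ?I w * g w t \<partial>replicate_pmf n P) \<noteq> \<infinity>"
    using m by (intro nn_integral_PInf_AE) auto
  then show ?thesis
    by eventually_elim (auto simp: less_top[symmetric] g_def)
qed

end

section \<open>The central limit theorem\<close>

context letter_renewal
begin

lemma length_moment_finite:
  "moment (\<lambda>w. real (length w)) < \<top>"
proof -
  have "moment (\<lambda>w. real (length w))
    \<le> (\<Sum>n. ennreal (1 * (1 + real n)\<^sup>2) * ennreal ((1 - pmf P s) ^ (n - 1)))"
    unfolding moment_def
  proof (intro suminf_le)
    fix n
    have "(\<integral>\<^sup>+w. indicator {w. s \<notin> set (butlast w)} w * ennreal ((real (length w))\<^sup>2) \<partial>replicate_pmf n P)
      \<le> (\<integral>\<^sup>+w. ennreal (1 * (1 + real n)\<^sup>2) * indicator {w. s \<notin> set (butlast w)} w \<partial>replicate_pmf n P)"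
    proof (rule nn_integral_mono_AE, unfold AE_measure_pmf_iff, intro ballI)
      fix w assume "w \<in> set_pmf (replicate_pmf n P)"
      then have "length w = n" by (auto simp: set_replicate_pmf)
      then show "indicator {w. s \<notin> set (butlast w)} w * ennreal ((real (length w))\<^sup>2)
          \<le> ennreal (1 * (1 + real n)\<^sup>2) * indicator {w. s \<notin> set (butlast w)} w"
        by (auto simp: indicator_def intro!: ennreal_leI power_mono)
    qed
    also have "\<dots> = ennreal (1 * (1 + real n)\<^sup>2) * ennreal ((1 - pmf P s) ^ (n - 1))"
      by (simp add: nn_integral_cmult nn_integral_avoiding_butlast)
    finally show "(\<integral>\<^sup>+w. indicator {w. s \<notin> set (butlast w)} w * ennreal ((real (length w))\<^sup>2) \<partial>replicate_pmf n P)
      \<le> ennreal (1 * (1 + real n)\<^sup>2) * ennreal ((1 - pmf P s) ^ (n - 1))" .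
  qed auto
  also have "\<dots> < \<top>" by (rule polynomial_geometric_sum_finite) (use s_pos pmf_le_1 in auto)
  finally show ?thesis .
qed

lemma moment_subtract_drift:
  fixes f :: "'a list \<Rightarrow> real"
  assumes "moment f < \<top>"
  shows "moment (\<lambda>w. f w - L * real (length w)) < \<top>"
proof -
  let ?I = "\<lambda>w. indicator {w. s \<notin> set (butlast w)} w :: ennreal"
  have pt: "?I w * ennreal ((f w - L * real (length w))\<^sup>2)
     \<le> ennreal 2 * (?I w * ennreal ((f w)\<^sup>2)) + ennreal (2 * L\<^sup>2) * (?I w * ennreal ((real (length w))\<^sup>2))" for w
  proof (cases "s \<in> set (butlast w)")
    case False
    have "(f w - L * real (length w))\<^sup>2 \<le> 2 * (f w)\<^sup>2 + 2 * L\<^sup>2 * (real (length w))\<^sup>2"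
      using sum_squares_bound[of "f w" "- L * real (length w)"] by (simp add: power2_diff power_mult_distrib)
    then have "ennreal ((f w - L * real (length w))\<^sup>2) \<le> ennreal (2 * (f w)\<^sup>2 + 2 * L\<^sup>2 * (real (length w))\<^sup>2)"
      by (rule ennreal_leI)
    also have "\<dots> = ennreal 2 * ennreal ((f w)\<^sup>2) + ennreal (2 * L\<^sup>2) * ennreal ((real (length w))\<^sup>2)"
      by (simp only: ennreal_mult[symmetric] ennreal_plus[symmetric] zero_le_power2 mult_nonneg_nonneg zero_le_numeral)
    finally show ?thesis using False by simp
  qed simp
  have "moment (\<lambda>w. f w - L * real (length w))
    \<le> (\<Sum>n. \<integral>\<^sup>+w. ennreal 2 * (?I w * ennreal ((f w)\<^sup>2)) + ennreal (2 * L\<^sup>2) * (?I w * ennreal ((real (length w))\<^sup>2)) \<partial>replicate_pmf n P)"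
    unfolding moment_def by (intro suminf_le nn_integral_mono pt) auto
  also have "\<dots> = ennreal 2 * moment f + ennreal (2 * L\<^sup>2) * moment (\<lambda>w. real (length w))"
    unfolding moment_def by (subst nn_integral_add, simp, simp, subst nn_integral_cmult, simp, subst nn_integral_cmult, simp)
       (simp only: suminf_add[symmetric] summableI ennreal_suminf_cmult)
  also have "\<dots> < \<top>"
    using assms length_moment_finite by (simp add: ennreal_mult_eq_top_iff less_top[symmetric] del: replicate_pmf.simps)
  finally show ?thesis .
qed

end

text \<open>\<open>eta\<close> has a density with respect to counting measure, so an almost sure
  statement concerns exactly the lines where the density is positive, and these are images of
  singular ranges under invertible words.\<close>

lemma eta_atoms:
  assumes "\<And>s' w. s' \<in> Sg \<Longrightarrow> set w \<subseteq> - Sg \<Longrightarrow> R ((\<lambda>x. wordmat B w *v x) ` mrange (B s'))"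
  shows "AE lin in eta P Sg B. R lin"
proof -
  let ?d = "\<lambda>lin. \<Sum>s\<in>Sg. ennreal (pmf P s) *
       (\<Sum>n. ennreal (\<Sum>w\<in>{w. length w = n \<and> set w \<subseteq> -Sg}. (\<Prod>a\<leftarrow>w. pmf P a) *
             (if (\<lambda>x. wordmat B w *v x) ` mrange (B s) = lin then 1 else 0)))"
  have "R lin" if pos: "0 < ?d lin" for lin
  proof (rule ccontr)
    assume "\<not> R lin"
    then have ne: "(\<lambda>x. wordmat B w *v x) ` mrange (B s') \<noteq> lin" if "s' \<in> Sg" "set w \<subseteq> - Sg" for s' w
      using assms[OF that] by auto
    have "(\<Sum>w\<in>{w. length w = n \<and> set w \<subseteq> -Sg}. (\<Prod>a\<leftarrow>w. pmf P a) *
             (if (\<lambda>x. wordmat B w *v x) ` mrange (B s') = lin then 1 else 0)) = 0" if "s' \<in> Sg" for n s'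
      using ne[OF that] by (intro sum.neutral) auto
    then have "?d lin = 0" by (intro sum.neutral ballI) simp
    then show False using pos by simp
  qed
  then show ?thesis unfolding eta_def by (subst AE_density) (auto simp: AE_count_space)
qed

context cocycle_family
begin

lemma mrange_image:
  assumes "s \<in> Sg" "t \<in> \<Lambda>"
  shows "(\<lambda>x. wordmat (A t) w *v x) ` mrange (A t s) = range (\<lambda>k. k *\<^sub>R (wordmat (A t) w *v rv s))"
  unfolding mrange_sing[OF assms] image_image by (simp add: matrix_vector_mult_scaleR)

text \<open>All that the parameter estimates have to provide is collected in the hypotheses; what
  follows is probability for one fixed tuple of matrices.\<close>

theorem clt_at_parameter:
  fixes P :: "'a pmf"
  assumes t: "t \<in> \<Lambda>" and p_pos: "\<And>i. pmf P i > 0" and s: "s \<in> Sg" and j: "j \<notin> Sg"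
    and nz: "\<And>w s. s \<in> Sg \<Longrightarrow> wordmat (A t) w *v rv s \<noteq> 0"
    and mom: "(\<Sum>n. \<integral>\<^sup>+w. indicator {w. s \<notin> set (butlast w)} w *
        ennreal ((ln (norm (wordmat (A t) w *v rv s)))\<^sup>2) \<partial>replicate_pmf n P) < \<top>"
    and t1: "wedge2 (A t j *v rv s) (rv s) \<noteq> 0"
    and t2: "wedge2 (A t j *v perp (cv s)) (perp (cv s)) \<noteq> 0"
    and t3: "wedge2 (A t j *v (A t j *v rv s)) (rv s) \<noteq> 0"
  shows "\<exists>\<sigma>>0.
      (AE lin in eta P Sg (A t). \<forall>v. norm v = 1 \<and> line v = lin \<longrightarrow>
         weak_conv_m
           (\<lambda>n. distr (bernoulli P) borel
              (\<lambda>\<omega>. (ln (norm (prodA (A t) \<omega> n *v v)) - real n * L1 P (A t)) / (\<sigma> * sqrt (real n))))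
           std_normal_distribution)
    \<and> weak_conv_m
           (\<lambda>n. distr (bernoulli P) borel
              (\<lambda>\<omega>. (ln (opnorm (prodA (A t) \<omega> n)) - real n * L1 P (A t)) / (\<sigma> * sqrt (real n))))
           std_normal_distribution"
proof -
  define B where "B = A t"
  define r where "r = rv s"
  define c where "c = cv s"
  define N where "N w = ln (norm (wordmat B w *v r))" for w
  have c0: "c \<noteq> 0" unfolding c_def by (rule cv_nonzero[OF s])
  have split: "wordmat B (w1 @ s # w2) *v x = (c \<bullet> (wordmat B w1 *v x)) *\<^sub>R (wordmat B w2 *v r)" for w1 w2 x
    unfolding B_def c_def r_def by (rule wordmat_split_sing[OF s t])
  have rnz: "wordmat B w *v r \<noteq> 0" for w unfolding B_def r_def by (rule nz[OF s])
  \<comment> \<open>Appending \<open>s\<close> to the word turns nonvanishing of the vector into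
    nonvanishing of its inner product with \<open>c\<close>.\<close>
  have cnz: "c \<bullet> (wordmat B w *v rv s') \<noteq> 0" if "s' \<in> Sg" for w s'
    using nz[OF that, of "w @ [s]"] split[of w "[]" "rv s'"] unfolding B_def by auto
  interpret letter_renewal P s by unfold_locales (rule p_pos)
  have mom': "moment N < \<top>"
    using mom unfolding moment_def N_def B_def r_def .
  \<comment> \<open>Mean growth over a cycle divided by mean cycle length, as in the renewal reward
    theorem: the drift for which \<open>H\<close> is centred.\<close>
  define L where "L = measure_pmf.expectation Q N / measure_pmf.expectation Q (\<lambda>w. real (length w))"
  define H where "H w = N w - L * real (length w)" for w
  have ilen: "integrable (measure_pmf Q) (\<lambda>w. real (length w))"
    by (rule integrable_Q_of_moment[OF length_moment_finite])
  have iN: "integrable (measure_pmf Q) N" by (rule integrable_Q_of_moment[OF mom'])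
  have Elen: "measure_pmf.expectation Q (\<lambda>w. real (length w)) \<ge> 1"
  proof -
    have "measure_pmf.expectation Q (\<lambda>w. 1) \<le> measure_pmf.expectation Q (\<lambda>w. real (length w))"
    proof (rule integral_mono_AE[OF _ ilen], simp, use AE_Q in eventually_elim)
      fix w assume "first_hit s w"
      then show "(1::real) \<le> real (length w)" by (cases w) auto
    qed
    then show ?thesis by simp
  qed
  have N_split: "N (w1 @ s # w2) = ln \<bar>c \<bullet> (wordmat B w1 *v r)\<bar> + N w2" for w1 w2
    using cnz[OF s, of w1] rnz[of w2] unfolding N_def split by (simp add: ln_mult r_def[symmetric])
  interpret R: additive_functional P s H
  proof
    show "H (w @ u) = H w + H u" if "first_hit s w" for w u
    proof -
      obtain w1 where w1: "w = w1 @ [s]" using \<open>first_hit s w\<close> by (rule first_hitE)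
      have "N [] = 0" using norm_rv[OF s] by (simp add: N_def r_def)
      then show ?thesis using N_split[of w1 u] N_split[of w1 "[]"] by (simp add: H_def w1 algebra_simps)
    qed
    show "moment H < \<top>"
      unfolding H_def[abs_def] by (rule moment_subtract_drift[OF mom'])
    show "measure_pmf.expectation Q H = 0"
      unfolding H_def[abs_def] using iN ilen Elen by (simp add: L_def)
  qed
  have v_pos: "R.v > 0"
  proof (rule ccontr)
    assume "\<not> 0 < R.v"
    then have "R.v = 0" using R.v_nonneg by simp
    then have "AE w in Q. (H w)\<^sup>2 = 0"
      unfolding R.v_def using integral_nonneg_eq_0_iff_AE[OF R.integrable_H2] by simp
    then have H0: "H w = 0" if "w \<in> set_pmf Q" for w using that by (simp add: AE_measure_pmf_iff)
    \<comment> \<open>Zero variance forces \<open>H = 0\<close> on every cycle of positive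
      probability. The cycles made of \<open>n\<close> letters \<open>j\<close> and a final
      \<open>s\<close>, for \<open>n\<close> from 0 to 3, already give a contradiction.\<close>
    have pos: "replicate n j @ [s] \<in> set_pmf Q" for n
    proof -
      have "first_hit s (replicate n j @ [s])" using j s by (intro first_hit_snoc) auto
      moreover have "(\<Prod>a\<leftarrow>u. pmf P a) > 0" for u :: "'a list" by (induction u) (auto intro: mult_pos_pos p_pos)
      ultimately show ?thesis unfolding set_pmf_iff pmf_Q by (metis indicator_simps(1) mem_Collect_eq mult_1_right less_irrefl)
    qed
    define q where "q = exp L"
    \<comment> \<open>The exponent \<open>Suc n\<close> counts the closing letter \<open>s\<close>
      as well.\<close>
    have x: "\<bar>c \<bullet> (wordmat B (replicate n j) *v r)\<bar> = q ^ Suc n" for n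
    proof -
      have "N (replicate n j @ [s]) = L * real (Suc n)" using H0[OF pos[of n]] by (simp add: H_def)
      moreover have "N [] = 0" using norm_rv[OF s] by (simp add: N_def r_def)
      ultimately have "ln \<bar>c \<bullet> (wordmat B (replicate n j) *v r)\<bar> = L * real (Suc n)"
        using N_split[of "replicate n j" "[]"] by simp
      moreover have "0 < \<bar>c \<bullet> (wordmat B (replicate n j) *v r)\<bar>" using cnz[OF s, of "replicate n j"] by (simp add: r_def)
      ultimately have "\<bar>c \<bullet> (wordmat B (replicate n j) *v r)\<bar> = exp (real (Suc n) * L)"
        by (metis exp_ln mult.commute)
      then show ?thesis unfolding q_def by (simp only: exp_of_nat_mult)
    qed
    show False
    proof (rule exact_growth_impossible[of q c "B j" r])
      show "det (B j) > 0" unfolding B_def by (rule det_pos[OF t j])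
      show "\<bar>c \<bullet> r\<bar> = q" using x[of 0] by simp
      show "\<bar>c \<bullet> (B j *v r)\<bar> = q\<^sup>2" using x[of 1] by (simp add: power2_eq_square)
      show "\<bar>c \<bullet> (B j *v (B j *v r))\<bar> = q ^ 3"
        using x[of 2] by (simp add: numeral_2_eq_2 numeral_3_eq_3 matrix_vector_mul_assoc)
      show "\<bar>c \<bullet> (B j *v (B j *v (B j *v r)))\<bar> = q ^ 4"
        using x[of 3] by (simp add: eval_nat_numeral matrix_vector_mul_assoc matrix_mul_assoc)
    qed (use c0 t1 t2 t3 in \<open>auto simp: B_def c_def r_def q_def\<close>)
  qed
  define \<sigma> where "\<sigma> = sqrt (pmf P s * R.v)"
  have \<sigma>: "\<sigma> > 0" unfolding \<sigma>_def using v_pos p_pos by simp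
  \<comment> \<open>Once \<open>s\<close> has occurred the product has rank one, so its operator
    norm is exactly the norm of a functional times the length of the restarted vector, and no
    comparison of norms is involved.\<close>
  have op_split: "ln (opnorm (wordmat B (w1 @ s # w2))) = ln (onorm (\<lambda>x. c \<bullet> (wordmat B w1 *v x))) + N w2" for w1 w2
  proof -
    have bl: "bounded_linear (\<lambda>x. c \<bullet> (wordmat B w1 *v x))"
      by (intro bounded_linear_inner_right_comp matrix_vector_mul_bounded_linear)
    have "0 < onorm (\<lambda>x. c \<bullet> (wordmat B w1 *v x))"
      using cnz[OF s, of w1] by (subst onorm_pos_lt[OF bl]) blast
    moreover have "opnorm (wordmat B (w1 @ s # w2)) = onorm (\<lambda>x. c \<bullet> (wordmat B w1 *v x)) * norm (wordmat B w2 *v r)"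
      unfolding opnorm_def split by (rule onorm_scaleR_left[OF bl])
    ultimately show ?thesis using rnz[of w2] unfolding N_def by (simp add: ln_mult)
  qed
  define Fop where "Fop w = ln (opnorm (wordmat B w)) - L * real (length w)" for w
  have Fop: "Fop (w @ s # u) = (ln (onorm (\<lambda>x. c \<bullet> (wordmat B w *v x))) - L * real (Suc (length w))) + H u" for w u
    unfolding Fop_def op_split H_def by (simp add: algebra_simps)
  interpret PB: prob_space "bernoulli P" by (rule prob_space_bernoulli)
  have L1: "L1 P B = L"
    unfolding L1_def
  proof (rule the_equality)
    have "AE \<omega> in bernoulli P. (\<lambda>n. Fop (word n \<omega>) / real n) \<longlonglongrightarrow> 0"
      by (rule R.AE_sublinear) (rule Fop)
    then show lim: "AE \<omega> in bernoulli P. (\<lambda>n. ln (opnorm (prodA B \<omega> n)) / real n) \<longlonglongrightarrow> L"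
    proof eventually_elim
      case (elim \<omega>)
      have "(\<lambda>n. Fop (word n \<omega>) / real n + L) \<longlonglongrightarrow> 0 + L" by (intro tendsto_intros elim)
      then have "(\<lambda>n. Fop (word n \<omega>) / real n + L) \<longlonglongrightarrow> L" by simp
      then show ?case
      proof (rule Lim_transform_eventually)
        show "\<forall>\<^sub>F n in sequentially. Fop (word n \<omega>) / real n + L = ln (opnorm (prodA B \<omega> n)) / real n"
          using eventually_gt_at_top[of 0]
          by eventually_elim (simp add: Fop_def prodA_eq_wordmat diff_divide_distrib)
      qed
    qed
    fix L' assume "AE \<omega> in bernoulli P. (\<lambda>n. ln (opnorm (prodA B \<omega> n)) / real n) \<longlonglongrightarrow> L'"
    \<comment> \<open>On a probability space a constant statement that holds almost everywhere is
      true, which gives the uniqueness behind \<open>THE\<close>.\<close>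
    with lim have "AE \<omega> in bernoulli P. L' = L"
      by eventually_elim (rule LIMSEQ_unique)
    then show "L' = L" by simp
  qed
  have conv: "weak_conv_m (\<lambda>n. distr (bernoulli P) borel
      (\<lambda>\<omega>. (f (prodA B \<omega> n) - real n * L1 P B) / (\<sigma> * sqrt (real n)))) std_normal_distribution"
    if F: "\<And>w u. s \<notin> set w \<Longrightarrow> f (wordmat B (w @ s # u)) = Z w + N u" for f Z
  proof -
    have "weak_conv_m (\<lambda>n. distr (bernoulli P) borel (\<lambda>\<omega>. (f (wordmat B (word n \<omega>)) - L * real (length (word n \<omega>))) / (sqrt (pmf P s * R.v) * sqrt (real n))))
      std_normal_distribution"
      by (rule R.clt_bernoulli[OF v_pos, where Z="\<lambda>w. Z w - L * real (Suc (length w))"])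
         (simp add: F H_def algebra_simps)
    then show ?thesis unfolding L1 \<sigma>_def prodA_eq_wordmat by (simp add: mult.commute)
  qed
  show ?thesis
  proof (intro exI[of _ \<sigma>] conjI \<sigma>)
    show "weak_conv_m (\<lambda>n. distr (bernoulli P) borel
        (\<lambda>\<omega>. (ln (opnorm (prodA (A t) \<omega> n)) - real n * L1 P (A t)) / (\<sigma> * sqrt (real n)))) std_normal_distribution"
      unfolding B_def[symmetric] by (rule conv[of "\<lambda>M. ln (opnorm M)"]) (rule op_split)
    show "AE lin in eta P Sg (A t). \<forall>v. norm v = 1 \<and> line v = lin \<longrightarrow>
         weak_conv_m (\<lambda>n. distr (bernoulli P) borel
              (\<lambda>\<omega>. (ln (norm (prodA (A t) \<omega> n *v v)) - real n * L1 P (A t)) / (\<sigma> * sqrt (real n))))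
           std_normal_distribution"
    proof (rule eta_atoms, intro allI impI, elim conjE)
      fix s' w0 v
      assume s': "s' \<in> Sg" and v: "norm v = 1" and "line v = (\<lambda>x. wordmat (A t) w0 *v x) ` mrange (A t s')"
      then have "v \<in> range (\<lambda>k. k *\<^sub>R (wordmat (A t) w0 *v rv s'))"
        unfolding mrange_image[OF s' t] by (metis line_def span_base singletonI)
      then obtain k where k: "v = k *\<^sub>R (wordmat B w0 *v rv s')" unfolding B_def by blast
      have k0: "k \<noteq> 0" using v k by auto
      \<comment> \<open>Following \<open>w0\<close> by \<open>w\<close> is again one word applied to
        \<open>rv s'\<close>, so the nonvanishing assumption covers every line charged by
        \<open>eta\<close>.\<close>
      have cv0: "c \<bullet> (wordmat B w *v v) \<noteq> 0" for w
      proof -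
        have "wordmat B w *v v = k *\<^sub>R (wordmat B (w0 @ w) *v rv s')"
          unfolding k by (simp add: wordmat_append matrix_vector_mult_scaleR matrix_vector_mul_assoc)
        then show ?thesis using cnz[OF s', of "w0 @ w"] k0 by simp
      qed
      have "ln (norm (wordmat B (w @ s # u) *v v)) = ln \<bar>c \<bullet> (wordmat B w *v v)\<bar> + N u" for w u
        using cv0[of w] rnz[of u] unfolding split N_def by (simp add: ln_mult)
      then show "weak_conv_m (\<lambda>n. distr (bernoulli P) borel
              (\<lambda>\<omega>. (ln (norm (prodA (A t) \<omega> n *v v)) - real n * L1 P (A t)) / (\<sigma> * sqrt (real n))))
           std_normal_distribution"
        unfolding B_def[symmetric] by (rule conv[of "\<lambda>M. ln (norm (M *v v))"])
    qed
  qed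
qed

end

theorem theorem3p2:
  fixes P :: "'a::finite pmf"
    and Sg :: "'a set"
    and A :: "real \<Rightarrow> 'a \<Rightarrow> real^2^2"
    and a c0 :: real
  defines "\<Lambda> \<equiv> {a..a+1}"
  assumes sing_ne: "Sg \<noteq> {}" and inv_ne: "- Sg \<noteq> {}"
    and p_pos: "\<And>i. pmf P i > 0"
    and smooth: "\<And>i. smooth_on \<Lambda> (\<lambda>t. A t i)"
    and Mstar: "\<And>t. t \<in> \<Lambda> \<Longrightarrow> in_Mstar Sg (A t)"
    and A1: "\<And>t i. t \<in> \<Lambda> \<Longrightarrow> i \<in> Sg \<Longrightarrow> A t i = A a i"
    and c0_pos: "c0 > 0"
    and A2: "\<And>t j v. t \<in> \<Lambda> \<Longrightarrow> j \<notin> Sg \<Longrightarrow> v \<noteq> 0 \<Longrightarrow>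
       wedge2 (A t j *v v) (vector_derivative (\<lambda>s. A s j *v v) (at t within \<Lambda>))
         / (norm (A t j *v v))\<^sup>2 \<ge> c0"
  shows "AE t in lborel. t \<in> \<Lambda> \<longrightarrow>
    (\<exists>\<sigma>>0.
      (AE lin in eta P Sg (A t). \<forall>v. norm v = 1 \<and> line v = lin \<longrightarrow>
         weak_conv_m
           (\<lambda>n. distr (bernoulli P) borel
              (\<lambda>\<omega>. (ln (norm (prodA (A t) \<omega> n *v v)) - real n * L1 P (A t)) / (\<sigma> * sqrt (real n))))
           std_normal_distribution)
    \<and> weak_conv_m
           (\<lambda>n. distr (bernoulli P) borel
              (\<lambda>\<omega>. (ln (opnorm (prodA (A t) \<omega> n)) - real n * L1 P (A t)) / (\<sigma> * sqrt (real n))))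
           std_normal_distribution)"
  (is "AE t in lborel. t \<in> \<Lambda> \<longrightarrow> ?clt t")
proof -
  interpret F: cocycle_family Sg A a c0
    using smooth Mstar A1 c0_pos A2 unfolding \<Lambda>_def by unfold_locales
  obtain s where s: "s \<in> Sg" using sing_ne by blast
  obtain j where j: "j \<notin> Sg" using inv_ne by blast
  have r0: "F.rv s \<noteq> 0" using F.norm_rv[OF s] by auto
  have k0: "perp (F.cv s) \<noteq> 0" by (rule perp_nonzero[OF F.cv_nonzero[OF s]])
  \<comment> \<open>One singular letter \<open>s\<close> and one invertible letter \<open>j\<close>
    suffice. The word \<open>[j]\<close> must move both the range line of \<open>s\<close> and its
    kernel line, and \<open>[j, j]\<close> must move the range line; these are the three
    transversality hypotheses at a fixed parameter.\<close>
  have w: "set [j] \<subseteq> - Sg" "[j] \<noteq> []" "set [j, j] \<subseteq> - Sg" "[j, j] \<noteq> []" using j by auto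
  show ?thesis
    using F.AE_nonvanishing F.AE_moment_finite[OF s p_pos] F.AE_transverse[OF w(1,2) r0 r0]
      F.AE_transverse[OF w(1,2) k0 k0] F.AE_transverse[OF w(3,4) r0 r0]
  proof eventually_elim
    case (elim t)
    show ?case
    proof
      assume "t \<in> \<Lambda>"
      then have t: "t \<in> {a..a+1}" by (simp add: \<Lambda>_def)
      show "?clt t"
        by (rule F.clt_at_parameter[OF t p_pos s j])
           (use elim t in \<open>auto simp: matrix_vector_mul_assoc\<close>)
    qed
  qed
qed


end
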